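(* Let $S_n$ act on $[k]^n$ by $(g\cdot x)_i=x_{g^{-1}(i)}$, with $k\ge2$ and $n\ge1$; let $K$ be the classical Burnside kernel on $[k]^n$ and $Q$ the dual Burnside kernel on $S_n$. Let $\varepsilon\in(0,1)$. The following hold. (a) For integers $t\ge1$, $$d_Q(t),\ d_K(t)\le\left(1-\frac1{n!}\right)^t,\qquad t_{\mathrm{mix}}(Q;\varepsilon),\ t_{\mathrm{mix}}(K;\varepsilon)\le\left\lceil n!\log\frac1\varepsilon\right\rceil.$$ (b) For integers $t\ge1$, $$d_Q(t)\le n\left(1-\frac1k\right)^{t-1},\qquad\text{and}\qquad t_{\mathrm{mix}}(Q;\varepsilon)\le1+\left\lceil k\log\frac n\varepsilon\right\rceil.$$ (c) For fixed $k$, there is $c_k\in(0,1)$, independent of $n$, such that if $g$ is an $n$-cycle, then $$d_Q(g,t)\le(1-c_k)^{t-1}\qquad(t\ge1).$$ Hence $t_{\mathrm{mix}}(Q;g,\varepsilon)\le1+\left\lceil c_k^{-1}\log\frac1\varepsilon\right\rceil$. (d) In the case $k=n$, there is an absolute constant $c_{\mathrm{BE}}>0$ such that, for any all-equal word $x_0=a^n=(a,\dots,a)$, $$d_K(x_0,\ell)\ge c_{\mathrm{BE}}\qquad(0\le\ell\le\lfloor\log n\rfloor).$$ Hence $$d_K(\ell)\ge c_{\mathrm{BE}}\quad(0\le\ell\le\lfloor\log n\rfloor),\qquad d_Q(t)\ge c_{\mathrm{BE}}\quad(0\le t\le\lfloor\log n\rfloor-1),$$ and $$t_{\mathrm{mix}}(K;c_{\mathrm{BE}}/2)\ge\lfloor\log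 n\rfloor+1,\qquad t_{\mathrm{mix}}(Q;c_{\mathrm{BE}}/2)\ge\lfloor\log n\rfloor.$$
   Context: $[k]=\{1,\dots,k\}$. For the action of $G=S_n$ on $X=[k]^n$: $X_g=\{x\in X:g\cdot x=x\}$, $G_x=\{g\in G:g\cdot x=x\}$; every $X_g$ is nonempty. The classical Burnside kernel on $X$ is $K(x,y)=\frac1{|G_x|}\sum_{g\in G_x\cap G_y}\frac1{|X_g|}$ with stationary law $\pi_K(x)=|G_x|/(|G|\,|X/G|)$; the dual Burnside kernel on $S_n$ is $Q(g,h)=\frac1{|X_g|}\sum_{x\in X_g\cap X_h}\frac1{|G_x|}$ with stationary law $\pi_Q(g)=|X_g|/(|G|\,|X/G|)$. For a kernel $P$ on a finite set with stationary law $\pi$: $d_P(s,t):=\|P^t(s,\cdot)-\pi\|_{\mathrm{TV}}$ with $\|\mu-\nu\|_{\mathrm{TV}}=\frac12\sum_s|\mu(s)-\nu(s)|$; $d_P(t):=\max_sd_P(s,t)$; $t_{\mathrm{mix}}(P;s,\varepsilon):=\min\{t\ge0:d_P(s,t)\le\varepsilon\}$; $t_{\mathrm{mix}}(P;\varepsilon):=\min\{t\ge0:d_P(t)\le\varepsilon\}$ (integer $t$). $\log$ is the natural logarithm. "Absolute" means independent of $n$. *)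

theory Defs
  imports
    Complex_Main
    "HOL-Library.Extended_Nat"
    "HOL-Library.FuncSet"
    "HOL-Algebra.Group_Action"
    "HOL-Algebra.Sym_Groups"
begin

section \<open>Kernels on a finite state space\<close>

text \<open>
  A kernel on a finite set \<open>S\<close> is a function \<open>P :: 's \<Rightarrow> 's \<Rightarrow> real\<close> and a law on \<open>S\<close> is
  a function \<open>'s \<Rightarrow> real\<close>; only their values on \<open>S\<close> are ever used.
\<close>

fun kernel_power :: "'s set \<Rightarrow> ('s \<Rightarrow> 's \<Rightarrow> real) \<Rightarrow> nat \<Rightarrow> 's \<Rightarrow> 's \<Rightarrow> real" where
  "kernel_power S P 0 s r = (if s = r then 1 else 0)"
| "kernel_power S P (Suc t) s r = (\<Sum>u\<in>S. kernel_power S P t s u * P u r)"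

definition tv_dist :: "'s set \<Rightarrow> ('s \<Rightarrow> real) \<Rightarrow> ('s \<Rightarrow> real) \<Rightarrow> real" where
  "tv_dist S \<mu> \<nu> = 1 / 2 * (\<Sum>s\<in>S. \<bar>\<mu> s - \<nu> s\<bar>)"

definition dist_from ::
    "'s set \<Rightarrow> ('s \<Rightarrow> 's \<Rightarrow> real) \<Rightarrow> ('s \<Rightarrow> real) \<Rightarrow> 's \<Rightarrow> nat \<Rightarrow> real" where
  "dist_from S P \<pi> s t = tv_dist S (kernel_power S P t s) \<pi>"

definition dist_worst ::
    "'s set \<Rightarrow> ('s \<Rightarrow> 's \<Rightarrow> real) \<Rightarrow> ('s \<Rightarrow> real) \<Rightarrow> nat \<Rightarrow> real" where
  "dist_worst S P \<pi> t = Max ((\<lambda>s. dist_from S P \<pi> s t) ` S)"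

text \<open>
  Mixing times are extended naturals: the infimum below is the minimum if the threshold is
  ever reached, and \<open>\<infinity>\<close> otherwise. An upper bound on a mixing time therefore includes the
  assertion that the threshold is reached.
\<close>

definition first_below :: "(nat \<Rightarrow> real) \<Rightarrow> real \<Rightarrow> enat" where
  "first_below d \<epsilon> = (INF t\<in>{t. d t \<le> \<epsilon>}. enat t)"

definition mixing_time_from ::
    "'s set \<Rightarrow> ('s \<Rightarrow> 's \<Rightarrow> real) \<Rightarrow> ('s \<Rightarrow> real) \<Rightarrow> 's \<Rightarrow> real \<Rightarrow> enat" where
  "mixing_time_from S P \<pi> s \<epsilon> = first_below (dist_from S P \<pi> s) \<epsilon>"

definition mixing_time ::
    "'s set \<Rightarrow> ('s \<Rightarrow> 's \<Rightarrow> real) \<Rightarrow> ('s \<Rightarrow> real) \<Rightarrow> real \<Rightarrow> enat" where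
  "mixing_time S P \<pi> \<epsilon> = first_below (dist_worst S P \<pi>) \<epsilon>"


section \<open>Burnside kernels of a group action\<close>

text \<open>
  In the library's notation, \<open>G\<^sub>x\<close> is \<open>stabilizer G \<phi> x\<close>, \<open>X\<^sub>g\<close> is \<open>invariants X \<phi> g\<close>,
  and \<open>X/G\<close> is \<open>orbits G X \<phi>\<close>.
\<close>

definition burnside_kernel ::
    "('g, 'm) monoid_scheme \<Rightarrow> 'x set \<Rightarrow> ('g \<Rightarrow> 'x \<Rightarrow> 'x) \<Rightarrow> 'x \<Rightarrow> 'x \<Rightarrow> real" where
  "burnside_kernel G X \<phi> x y =
     1 / real (card (stabilizer G \<phi> x)) *
     (\<Sum>g\<in>stabilizer G \<phi> x \<inter> stabilizer G \<phi> y. 1 / real (card (invariants X \<phi> g)))"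

definition burnside_law ::
    "('g, 'm) monoid_scheme \<Rightarrow> 'x set \<Rightarrow> ('g \<Rightarrow> 'x \<Rightarrow> 'x) \<Rightarrow> 'x \<Rightarrow> real" where
  "burnside_law G X \<phi> x =
     real (card (stabilizer G \<phi> x)) / (real (order G) * real (card (orbits G X \<phi>)))"

definition dual_burnside_kernel ::
    "('g, 'm) monoid_scheme \<Rightarrow> 'x set \<Rightarrow> ('g \<Rightarrow> 'x \<Rightarrow> 'x) \<Rightarrow> 'g \<Rightarrow> 'g \<Rightarrow> real" where
  "dual_burnside_kernel G X \<phi> g h =
     1 / real (card (invariants X \<phi> g)) *
     (\<Sum>x\<in>invariants X \<phi> g \<inter> invariants X \<phi> h. 1 / real (card (stabilizer G \<phi> x)))"

definition dual_burnside_law ::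
    "('g, 'm) monoid_scheme \<Rightarrow> 'x set \<Rightarrow> ('g \<Rightarrow> 'x \<Rightarrow> 'x) \<Rightarrow> 'g \<Rightarrow> real" where
  "dual_burnside_law G X \<phi> g =
     real (card (invariants X \<phi> g)) / (real (order G) * real (card (orbits G X \<phi>)))"


section \<open>The symmetric group acting on words\<close>

definition words :: "nat \<Rightarrow> nat \<Rightarrow> (nat \<Rightarrow> nat) set" where
  "words n k = {1..n} \<rightarrow>\<^sub>E {1..k}"

text \<open>The outer restriction is what the library's \<^const>\<open>BijGroup\<close> asks of an action.\<close>

definition word_action :: "nat \<Rightarrow> nat \<Rightarrow> (nat \<Rightarrow> nat) \<Rightarrow> (nat \<Rightarrow> nat) \<Rightarrow> (nat \<Rightarrow> nat)" where
  "word_action n k g = (\<lambda>x\<in>words n k. \<lambda>i\<in>{1..n}. x (Hilbert_Choice.inv g i))"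

lemma word_action_closed:
  assumes "g permutes {1..n}" "x \<in> words n k"
  shows "word_action n k g x \<in> words n k"
  using assms permutes_in_image[OF permutes_inv[OF assms(1)]]
  unfolding word_action_def words_def by (auto simp: PiE_iff)

lemma word_action_compose:
  assumes g: "g permutes {1..n}" and h: "h permutes {1..n}" and x: "x \<in> words n k"
  shows "word_action n k (g \<circ> h) x = word_action n k g (word_action n k h x)"
proof -
  have "Hilbert_Choice.inv (g \<circ> h) = Hilbert_Choice.inv h \<circ> Hilbert_Choice.inv g"
    using g h by (simp add: o_inv_distrib permutes_bij)
  moreover have "Hilbert_Choice.inv g i \<in> {1..n}" if "i \<in> {1..n}" for i
    using that permutes_in_image[OF permutes_inv[OF g]] by blast
  ultimately show ?thesis
    using x word_action_closed[OF h x]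
    by (auto simp: word_action_def restrict_def fun_eq_iff)
qed

lemma word_action_id:
  assumes "x \<in> words n k"
  shows "word_action n k id x = x"
  using assms by (auto simp: word_action_def words_def PiE_iff extensional_restrict)

lemma word_action_Bij:
  assumes g: "g permutes {1..n}"
  shows "word_action n k g \<in> Bij (words n k)"
proof -
  let ?h = "Hilbert_Choice.inv g"
  have h: "?h permutes {1..n}" using g by (rule permutes_inv)
  have "bij_betw (word_action n k g) (words n k) (words n k)"
  proof (rule bij_betw_byWitness[where f' = "word_action n k ?h"])
    show "\<forall>x\<in>words n k. word_action n k ?h (word_action n k g x) = x"
      using word_action_compose[OF h g] permutes_inv_o(2)[OF g] word_action_id by metis
    show "\<forall>x\<in>words n k. word_action n k g (word_action n k ?h x) = x"
      using word_action_compose[OF g h] permutes_inv_o(1)[OF g] word_action_id by metis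
  qed (use word_action_closed[OF g] word_action_closed[OF h] in auto)
  then show ?thesis by (simp add: Bij_def word_action_def)
qed

lemma word_action_group_action:
  "group_action (sym_group n) (words n k) (word_action n k)"
proof -
  have "word_action n k \<in> hom (sym_group n) (BijGroup (words n k))"
  proof (rule homI)
    fix g assume "g \<in> carrier (sym_group n)"
    then show "word_action n k g \<in> carrier (BijGroup (words n k))"
      by (simp add: sym_group_carrier word_action_Bij BijGroup_def)
  next
    fix g h assume gh: "g \<in> carrier (sym_group n)" "h \<in> carrier (sym_group n)"
    then have p: "g permutes {1..n}" "h permutes {1..n}"
      by (simp_all add: sym_group_carrier)
    have "word_action n k (g \<circ> h) x = compose (words n k) (word_action n k g) (word_action n k h) x"
      for x
      by (cases "x \<in> words n k")
        (simp add: word_action_compose[OF p] compose_def, simp add: word_action_def compose_def)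
    then show "word_action n k (g \<otimes>\<^bsub>sym_group n\<^esub> h) =
        word_action n k g \<otimes>\<^bsub>BijGroup (words n k)\<^esub> word_action n k h"
      using p by (simp add: sym_group_mult BijGroup_def word_action_Bij fun_eq_iff)
  qed
  then show ?thesis
    by (simp add: group_action_def group_hom_def group_hom_axioms_def
        sym_group_is_group group_BijGroup)
qed

definition is_full_cycle :: "nat \<Rightarrow> (nat \<Rightarrow> nat) \<Rightarrow> bool" where
  "is_full_cycle n g \<longleftrightarrow> (\<exists>cs. cycle cs \<and> set cs = {1..n} \<and> g = cycle_of_list cs)"

definition const_word :: "nat \<Rightarrow> nat \<Rightarrow> (nat \<Rightarrow> nat)" where
  "const_word n a = (\<lambda>i\<in>{1..n}. a)"


section \<open>Distances and mixing times of the two chains\<close>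

definition dK_from :: "nat \<Rightarrow> nat \<Rightarrow> (nat \<Rightarrow> nat) \<Rightarrow> nat \<Rightarrow> real" where
  "dK_from n k = dist_from (words n k)
     (burnside_kernel (sym_group n) (words n k) (word_action n k))
     (burnside_law (sym_group n) (words n k) (word_action n k))"

definition dK :: "nat \<Rightarrow> nat \<Rightarrow> nat \<Rightarrow> real" where
  "dK n k = dist_worst (words n k)
     (burnside_kernel (sym_group n) (words n k) (word_action n k))
     (burnside_law (sym_group n) (words n k) (word_action n k))"

definition tmixK :: "nat \<Rightarrow> nat \<Rightarrow> real \<Rightarrow> enat" where
  "tmixK n k = mixing_time (words n k)
     (burnside_kernel (sym_group n) (words n k) (word_action n k))
     (burnside_law (sym_group n) (words n k) (word_action n k))"

definition dQ_from :: "nat \<Rightarrow> nat \<Rightarrow> (nat \<Rightarrow> nat) \<Rightarrow> nat \<Rightarrow> real" where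
  "dQ_from n k = dist_from (carrier (sym_group n))
     (dual_burnside_kernel (sym_group n) (words n k) (word_action n k))
     (dual_burnside_law (sym_group n) (words n k) (word_action n k))"

definition dQ :: "nat \<Rightarrow> nat \<Rightarrow> nat \<Rightarrow> real" where
  "dQ n k = dist_worst (carrier (sym_group n))
     (dual_burnside_kernel (sym_group n) (words n k) (word_action n k))
     (dual_burnside_law (sym_group n) (words n k) (word_action n k))"

definition tmixQ_from :: "nat \<Rightarrow> nat \<Rightarrow> (nat \<Rightarrow> nat) \<Rightarrow> real \<Rightarrow> enat" where
  "tmixQ_from n k = mixing_time_from (carrier (sym_group n))
     (dual_burnside_kernel (sym_group n) (words n k) (word_action n k))
     (dual_burnside_law (sym_group n) (words n k) (word_action n k))"

definition tmixQ :: "nat \<Rightarrow> nat \<Rightarrow> real \<Rightarrow> enat" where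
  "tmixQ n k = mixing_time (carrier (sym_group n))
     (dual_burnside_kernel (sym_group n) (words n k) (word_action n k))
     (dual_burnside_law (sym_group n) (words n k) (word_action n k))"

end

theory Submission
  imports Defs
begin

text \<open>
  Write \<open>K = A B\<close> and \<open>Q = B A\<close>, where \<open>A\<close> picks a uniform element of a stabilizer and \<open>B\<close> a uniform
  fixed point; this moves distances between the two chains at the cost of one step. Part (a) is
  Doeblin's argument through the identity permutation.

  On words, inserting one letter at a time gives \<open>K\<close> in closed form: independently for each block of
  equal letters of \<open>x\<close>, the new letters are drawn from a Polya urn with \<open>k\<close> colours of initial weight
  \<open>1/k\<close>; the stationary law is the same urn with weights \<open>1\<close> on a single block. For (b), two words
  differing in one letter lead to words that collide there with probability \<open>1/k\<close>, so \<open>K\<close> contracts the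
  Hamming--Lipschitz constant by \<open>1 - 1/k\<close>. For (c), on symmetric functions \<open>K\<close> satisfies a Doeblin
  minorization uniform in \<open>n\<close>: the weights \<open>1/k\<close> are compared with weights \<open>1\<close>, for which block counts are
  uniform on compositions; a block of size at least \<open>n/k\<close> spreads evenly, while the others stay nearly
  monochromatic with probability bounded below. An \<open>n\<close>-cycle fixes only constant words.

  For (d), a uniformly chosen letter of the largest block, of size \<open>m\<close>, has a new block at least as
  large, in mean logarithm, as a uniform number in \<open>{1..m}\<close>. So \<open>ln\<close> of the largest block drops by at
  most \<open>1\<close> per step, and by at most \<open>99/100\<close> since the maximum beats a size-biased part. After
  \<open>ln n\<close> steps from a constant word its mean is still \<open>(ln n) / 100\<close>, but its stationary mean is a
  smaller multiple of \<open>ln n\<close> for large \<open>n\<close>. Small \<open>n\<close> are handled by the eigenfunction \<open>x 1 = x 2\<close>.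
\<close>

section \<open>Finite chains\<close>

text \<open>All distances are treated by duality: a law is known through its averages of
  [0,1]-valued functions, and a kernel acts on functions. Couplings and random variables then become
  iterated finite averages, and one more position is one more average.

  In (c) the test functions are confined to symmetric ones because the block structure of
  \<open>x\<close> stays visible in the law \<open>K x\<close>; seen through letter counts alone it
  does not. From a constant word nothing is lost, since symmetrizing changes neither of the two
  averages compared.

  In (d) a drop of exactly 1 per step would be critical: it exhausts \<open>ln n\<close> just after
  \<open>ln n\<close> steps. The \<open>1 / 100\<close> that is gained must then beat the stationary
  mean. Moments of order \<open>p\<close> bound that mean by \<open>(ln n) / p\<close> plus a
  constant; \<open>p = 400\<close>, with the constant absorbed for large \<open>n\<close>, leaves
  half of the margin and fixes the threshold \<open>ln n \<ge> ln (fact 400) + 400\<close>.\<close>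

definition avg :: "'s set \<Rightarrow> ('s \<Rightarrow> real) \<Rightarrow> ('s \<Rightarrow> real) \<Rightarrow> real" where
  "avg S \<mu> f = (\<Sum>s\<in>S. \<mu> s * f s)"

definition unit_valued :: "'s set \<Rightarrow> ('s \<Rightarrow> real) \<Rightarrow> bool" where
  "unit_valued S f \<longleftrightarrow> (\<forall>s\<in>S. 0 \<le> f s \<and> f s \<le> 1)"

lemma avg_mono:
  assumes "\<And>s. s \<in> S \<Longrightarrow> 0 \<le> \<mu> s" "\<And>s. s \<in> S \<Longrightarrow> f s \<le> g s"
  shows "avg S \<mu> f \<le> avg S \<mu> g"
  unfolding avg_def using assms by (intro sum_mono mult_left_mono) auto

lemma avg_cong: "(\<And>s. s \<in> S \<Longrightarrow> f s = g s) \<Longrightarrow> avg S \<mu> f = avg S \<mu> g"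
  by (simp add: avg_def)

lemma avg_add: "avg S \<mu> (\<lambda>s. f s + g s) = avg S \<mu> f + avg S \<mu> g"
  by (simp add: avg_def sum.distrib distrib_left)

lemma avg_diff: "avg S \<mu> (\<lambda>s. f s - g s) = avg S \<mu> f - avg S \<mu> g"
  by (simp add: avg_def sum_subtractf right_diff_distrib)

lemma avg_scale: "avg S \<mu> (\<lambda>s. c * f s) = c * avg S \<mu> f"
  by (simp add: avg_def sum_distrib_left algebra_simps)

lemma avg_const: "avg S \<mu> (\<lambda>s. c) = c * sum \<mu> S"
  by (simp add: avg_def sum_distrib_left algebra_simps)

lemma avg_affine: "avg S \<mu> (\<lambda>s. a * f s + b) = a * avg S \<mu> f + b * sum \<mu> S"
  by (simp add: avg_add avg_scale avg_const)

text \<open>Equal masses make the positive and negative parts of \<open>\<mu> - \<nu>\<close>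
  equally heavy, so the indicator of \<open>\<nu> s \<le> \<mu> s\<close> attains the distance.
  Upper bounds thus reduce to [0,1]-valued test functions.\<close>

lemma tv_dist_le:
  assumes "finite S" "sum \<mu> S = sum \<nu> S"
    and "\<And>f. unit_valued S f \<Longrightarrow> avg S \<mu> f - avg S \<nu> f \<le> B"
  shows "tv_dist S \<mu> \<nu> \<le> B"
proof -
  let ?f = "\<lambda>s. if \<mu> s \<ge> \<nu> s then 1 else 0 :: real"
  have "(\<Sum>s\<in>S. \<bar>\<mu> s - \<nu> s\<bar>) = (\<Sum>s\<in>S. 2 * ((\<mu> s - \<nu> s) * ?f s) - (\<mu> s - \<nu> s))"
    by (intro sum.cong) auto
  also have "\<dots> = 2 * (avg S \<mu> ?f - avg S \<nu> ?f)"
    using assms(2) unfolding avg_def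
    by (simp add: sum_subtractf sum_distrib_left left_diff_distrib right_diff_distrib mult.assoc)
  finally have "tv_dist S \<mu> \<nu> = avg S \<mu> ?f - avg S \<nu> ?f" by (simp add: tv_dist_def)
  moreover have "unit_valued S ?f" by (simp add: unit_valued_def)
  ultimately show ?thesis using assms(3) by metis
qed

lemma tv_dist_ge:
  assumes "finite S" "sum \<mu> S = sum \<nu> S" "unit_valued S f"
  shows "avg S \<mu> f - avg S \<nu> f \<le> tv_dist S \<mu> \<nu>"
proof -
  have "(\<Sum>s\<in>S. (\<mu> s - \<nu> s) * (2 * f s - 1))
      = (\<Sum>s\<in>S. 2 * (\<mu> s * f s - \<nu> s * f s) - (\<mu> s - \<nu> s))"
    by (intro sum.cong) (simp_all add: algebra_simps)
  also have "\<dots> = 2 * (avg S \<mu> f - avg S \<nu> f)"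
    using assms(2) by (simp add: avg_def sum_subtractf sum_distrib_left[symmetric])
  finally have "2 * (avg S \<mu> f - avg S \<nu> f) = (\<Sum>s\<in>S. (\<mu> s - \<nu> s) * (2 * f s - 1))" ..
  also have "\<dots> \<le> (\<Sum>s\<in>S. \<bar>\<mu> s - \<nu> s\<bar>)"
  proof (rule sum_mono)
    fix s assume "s \<in> S"
    then have "\<bar>2 * f s - 1\<bar> \<le> 1" using assms(3) by (auto simp: unit_valued_def)
    then have "\<bar>(\<mu> s - \<nu> s) * (2 * f s - 1)\<bar> \<le> \<bar>\<mu> s - \<nu> s\<bar> * 1"
      unfolding abs_mult by (intro mult_left_mono) auto
    then show "(\<mu> s - \<nu> s) * (2 * f s - 1) \<le> \<bar>\<mu> s - \<nu> s\<bar>"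
      using abs_ge_self[of "(\<mu> s - \<nu> s) * (2 * f s - 1)"] by simp
  qed
  finally show ?thesis by (simp add: tv_dist_def)
qed

locale finite_chain =
  fixes S :: "'s set" and P :: "'s \<Rightarrow> 's \<Rightarrow> real" and \<pi> :: "'s \<Rightarrow> real"
  assumes finite_S: "finite S" and S_ne: "S \<noteq> {}"
    and P_nonneg: "s \<in> S \<Longrightarrow> r \<in> S \<Longrightarrow> 0 \<le> P s r"
    and P_sum: "s \<in> S \<Longrightarrow> (\<Sum>r\<in>S. P s r) = 1"
    and law_nonneg: "s \<in> S \<Longrightarrow> 0 \<le> \<pi> s"
    and law_sum: "sum \<pi> S = 1"
    and stationary: "r \<in> S \<Longrightarrow> (\<Sum>s\<in>S. \<pi> s * P s r) = \<pi> r"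
begin

definition step :: "('s \<Rightarrow> real) \<Rightarrow> 's \<Rightarrow> real" where
  "step f s = avg S (P s) f"

lemma step_cong: "(\<And>s. s \<in> S \<Longrightarrow> f s = g s) \<Longrightarrow> step f = step g"
  unfolding step_def by (intro ext avg_cong)

lemma step_mono:
  assumes "s \<in> S" "\<And>r. r \<in> S \<Longrightarrow> f r \<le> g r"
  shows "step f s \<le> step g s"
  unfolding step_def using assms P_nonneg by (intro avg_mono) auto

lemma step_affine: "s \<in> S \<Longrightarrow> step (\<lambda>r. a * f r + b) s = a * step f s + b"
  by (simp add: step_def avg_affine P_sum)

lemma step_const: "s \<in> S \<Longrightarrow> step (\<lambda>r. b) s = b"
  using step_affine[of s 0 _ b] by simp

lemma avg_law_step: "avg S \<pi> (step f) = avg S \<pi> f"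
proof -
  have "avg S \<pi> (step f) = (\<Sum>s\<in>S. \<Sum>r\<in>S. \<pi> s * P s r * f r)"
    by (simp add: avg_def step_def sum_distrib_left mult.assoc)
  also have "\<dots> = (\<Sum>r\<in>S. (\<Sum>s\<in>S. \<pi> s * P s r) * f r)"
    by (subst sum.swap) (simp add: sum_distrib_right)
  finally show ?thesis by (simp add: stationary avg_def)
qed

lemma avg_law_funpow: "avg S \<pi> ((step ^^ t) f) = avg S \<pi> f"
  by (induction t) (simp_all add: avg_law_step)

text \<open>Laws move forward, functions backward: the step that \<open>kernel_power\<close> appends
  on the right becomes the first operator applied to \<open>f\<close>, hence the induction for all
  \<open>f\<close>.\<close>

lemma avg_kernel_power:
  assumes "s \<in> S"
  shows "avg S (kernel_power S P t s) f = (step ^^ t) f s"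
proof (induction t arbitrary: f)
  case 0
  have "avg S (kernel_power S P 0 s) f = (\<Sum>r\<in>S. if s = r then f r else 0)"
    unfolding avg_def by (intro sum.cong) auto
  then show ?case using assms finite_S by (simp del: kernel_power.simps)
next
  case (Suc t)
  have "avg S (kernel_power S P (Suc t) s) f
      = (\<Sum>r\<in>S. \<Sum>u\<in>S. kernel_power S P t s u * P u r * f r)"
    by (simp add: avg_def sum_distrib_right)
  also have "\<dots> = avg S (kernel_power S P t s) (step f)"
    by (subst sum.swap) (simp add: avg_def step_def sum_distrib_left mult.assoc)
  finally show ?case by (simp add: Suc funpow_swap1 del: kernel_power.simps)
qed

lemma kernel_power_sum:
  assumes "s \<in> S"
  shows "sum (kernel_power S P t s) S = 1"
proof -
  have "(step ^^ t) (\<lambda>_. 1) s = 1"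
    using assms
  proof (induction t arbitrary: s)
    case (Suc t)
    then have "step ((step ^^ t) (\<lambda>_. 1)) = step (\<lambda>_. 1)" by (intro step_cong)
    then show ?case using Suc.prems by (simp add: step_const)
  qed simp
  then show ?thesis using avg_kernel_power[OF assms, of t "\<lambda>_. 1"] by (simp add: avg_def)
qed

lemma dist_from_le:
  assumes "s \<in> S" "\<And>f. unit_valued S f \<Longrightarrow> (step ^^ t) f s - avg S \<pi> f \<le> B"
  shows "dist_from S P \<pi> s t \<le> B"
  unfolding dist_from_def using assms
  by (intro tv_dist_le) (auto simp: finite_S kernel_power_sum law_sum avg_kernel_power)

lemma dist_from_ge:
  assumes "s \<in> S" "unit_valued S f"
  shows "(step ^^ t) f s - avg S \<pi> f \<le> dist_from S P \<pi> s t"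
  unfolding dist_from_def
  using tv_dist_ge[of S "kernel_power S P t s" \<pi> f] assms
  by (simp add: finite_S kernel_power_sum law_sum avg_kernel_power)

text \<open>By stationarity the limiting mean of \<open>f\<close> is also the mean of
  \<open>(step ^^ t) f\<close>, so the distance never exceeds the oscillation of the evolved
  function.\<close>

lemma dist_from_le_osc:
  assumes "s \<in> S"
    and "\<And>f r. unit_valued S f \<Longrightarrow> r \<in> S \<Longrightarrow> (step ^^ t) f s - (step ^^ t) f r \<le> B"
  shows "dist_from S P \<pi> s t \<le> B"
proof (rule dist_from_le[OF assms(1)])
  fix f :: "'s \<Rightarrow> real" assume f: "unit_valued S f"
  have "avg S \<pi> (\<lambda>r. (step ^^ t) f s - (step ^^ t) f r) \<le> avg S \<pi> (\<lambda>r. B)"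
    using assms(2)[OF f] law_nonneg by (intro avg_mono) auto
  then show "(step ^^ t) f s - avg S \<pi> f \<le> B"
    by (simp add: avg_diff avg_const law_sum avg_law_funpow)
qed

lemma dist_worst_le:
  assumes "\<And>s. s \<in> S \<Longrightarrow> dist_from S P \<pi> s t \<le> B"
  shows "dist_worst S P \<pi> t \<le> B"
  unfolding dist_worst_def using assms finite_S S_ne by auto

lemma dist_worst_ge: "s \<in> S \<Longrightarrow> dist_from S P \<pi> s t \<le> dist_worst S P \<pi> t"
  unfolding dist_worst_def using finite_S by auto

text \<open>Doeblin's contraction, on a class of test functions that the chain preserves.\<close>

lemma doeblin_osc:
  assumes step: "\<And>f. C f \<Longrightarrow> C (step f)"
    and affine: "\<And>f a b. C f \<Longrightarrow> C (\<lambda>s. a * f s + b)"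
    and minor: "\<And>f s. C f \<Longrightarrow> (\<forall>r\<in>S. 0 \<le> f r) \<Longrightarrow> s \<in> S \<Longrightarrow> avg S \<nu> f \<le> step f s"
    and mass: "sum \<nu> S = c"
    and f: "C f" "unit_valued S f"
  shows "C ((step ^^ t) f) \<and>
    (\<exists>lo hi. hi - lo = (1 - c) ^ t \<and> (\<forall>s\<in>S. lo \<le> (step ^^ t) f s \<and> (step ^^ t) f s \<le> hi))"
proof (induction t)
  case 0
  show ?case using f by (auto simp: unit_valued_def intro: exI[of _ 0])
next
  case (Suc t)
  let ?g = "(step ^^ t) f"
  obtain lo hi where g: "C ?g" "hi - lo = (1 - c) ^ t" "\<forall>s\<in>S. lo \<le> ?g s \<and> ?g s \<le> hi"
    using Suc by blast
  \<comment> \<open>The minorization is applied to the nonnegative functions \<open>?g - lo\<close>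
    and, below, \<open>hi - ?g\<close>. The average of \<open>?g\<close> under \<nu> cancels between
    the two shifts, whose total is \<open>c * (hi - lo)\<close>.\<close>
  have up: "lo + (avg S \<nu> ?g - c * lo) \<le> step ?g s" if s: "s \<in> S" for s
  proof -
    have "avg S \<nu> (\<lambda>s. 1 * ?g s + - lo) \<le> step (\<lambda>s. 1 * ?g s + - lo) s"
      using g(3) by (intro minor affine g(1) s) auto
    then show ?thesis unfolding step_affine[OF s] avg_affine mass by (simp add: algebra_simps)
  qed
  have dn: "step ?g s \<le> hi - (c * hi - avg S \<nu> ?g)" if s: "s \<in> S" for s
  proof -
    have "avg S \<nu> (\<lambda>s. (- 1) * ?g s + hi) \<le> step (\<lambda>s. (- 1) * ?g s + hi) s"
      using g(3) by (intro minor affine g(1) s) auto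
    then show ?thesis unfolding step_affine[OF s] avg_affine mass by (simp add: algebra_simps)
  qed
  have "(hi - (c * hi - avg S \<nu> ?g)) - (lo + (avg S \<nu> ?g - c * lo)) = (1 - c) * (hi - lo)"
    by (simp add: algebra_simps)
  then have "(hi - (c * hi - avg S \<nu> ?g)) - (lo + (avg S \<nu> ?g - c * lo)) = (1 - c) ^ Suc t"
    using g(2) by simp
  moreover have "\<forall>s\<in>S. lo + (avg S \<nu> ?g - c * lo) \<le> (step ^^ Suc t) f s \<and>
      (step ^^ Suc t) f s \<le> hi - (c * hi - avg S \<nu> ?g)"
    using up dn by simp
  moreover have "C ((step ^^ Suc t) f)" using step[OF g(1)] by simp
  ultimately show ?case by blast
qed

lemma doeblin_dist_from:
  assumes "\<And>f s. (\<forall>r\<in>S. 0 \<le> f r) \<Longrightarrow> s \<in> S \<Longrightarrow> avg S \<nu> f \<le> step f s"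
    and "sum \<nu> S = c" "s \<in> S"
  shows "dist_from S P \<pi> s t \<le> (1 - c) ^ t"
proof (rule dist_from_le_osc[OF assms(3)])
  fix f :: "'s \<Rightarrow> real" and r assume f: "unit_valued S f" and r: "r \<in> S"
  have "\<exists>lo hi. hi - lo = (1 - c) ^ t \<and>
      (\<forall>s\<in>S. lo \<le> (step ^^ t) f s \<and> (step ^^ t) f s \<le> hi)"
    using doeblin_osc[where C = "\<lambda>_. True", OF _ _ assms(1,2) _ f] by simp
  then obtain lo hi where h: "hi - lo = (1 - c) ^ t"
      "\<forall>s\<in>S. lo \<le> (step ^^ t) f s \<and> (step ^^ t) f s \<le> hi"
    by blast
  then have "(step ^^ t) f s \<le> hi" "lo \<le> (step ^^ t) f r" using r assms(3) by auto
  then show "(step ^^ t) f s - (step ^^ t) f r \<le> (1 - c) ^ t" using h(1) by linarith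
qed

end

section \<open>From distances to mixing times\<close>

lemma first_below_le: "d N \<le> \<epsilon> \<Longrightarrow> first_below d \<epsilon> \<le> enat N"
  unfolding first_below_def by (intro INF_lower) auto

lemma first_below_ge:
  assumes "\<And>t. t < N \<Longrightarrow> \<epsilon> < d t"
  shows "enat N \<le> first_below d \<epsilon>"
  unfolding first_below_def
proof (intro INF_greatest)
  fix t assume "t \<in> {t. d t \<le> \<epsilon>}"
  then show "enat N \<le> enat t" using assms[of t] by (cases "t < N") auto
qed

text \<open>From \<open>1 - x \<le> exp (- x)\<close>. The prefactor \<open>B\<close> is 1 in (a)
  and (c) and \<open>n\<close> in (b). If the logarithm is negative, \<open>nat\<close> turns the
  ceiling into 0, which still bounds it from above.\<close>

lemma one_minus_power_le:
  fixes x B \<epsilon> :: real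
  assumes "0 < x" "x \<le> 1" "0 < B" "0 < \<epsilon>" "N = nat \<lceil>inverse x * ln (B / \<epsilon>)\<rceil>"
  shows "B * (1 - x) ^ N \<le> \<epsilon>"
proof -
  have "inverse x * ln (B / \<epsilon>) \<le> real N" using assms(5) by linarith
  then have N: "ln (B / \<epsilon>) \<le> x * real N" using assms(1) by (simp add: field_simps)
  have "(1 - x) ^ N \<le> exp (- x) ^ N"
    using assms(1,2) exp_ge_add_one_self[of "-x"] by (intro power_mono) auto
  also have "\<dots> = exp (- (x * real N))" by (simp add: exp_of_nat_mult[symmetric] mult.commute)
  also have "\<dots> \<le> exp (- ln (B / \<epsilon>))" using N by simp
  also have "\<dots> = \<epsilon> / B" using assms by (simp add: exp_minus)
  finally show ?thesis using assms(3) by (simp add: field_simps)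
qed

section \<open>The two Burnside chains of a finite group action\<close>

locale finite_burnside = group_action G X \<phi> for G :: "('a, 'm) monoid_scheme" (structure) and X :: "'b set" and \<phi> +
  assumes fin_G: "finite (carrier G)" and fin_X: "finite X" and X_ne: "X \<noteq> {}"
    and inv_ne: "g \<in> carrier G \<Longrightarrow> invariants X \<phi> g \<noteq> {}"
begin

text \<open>The factors \<open>A\<close> and \<open>B\<close> as operators on functions:
  \<open>pick_group\<close> carries functions on the group to functions on the points,
  \<open>pick_point\<close> carries them back, so \<open>K\<close> acts on \<open>f\<close> as
  \<open>pick_group (pick_point f)\<close>.\<close>

definition pick_group :: "('a \<Rightarrow> real) \<Rightarrow> 'b \<Rightarrow> real" where
  "pick_group h x = (\<Sum>g\<in>stabilizer G \<phi> x. h g) / real (card (stabilizer G \<phi> x))"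

definition pick_point :: "('b \<Rightarrow> real) \<Rightarrow> 'a \<Rightarrow> real" where
  "pick_point f g = (\<Sum>x\<in>invariants X \<phi> g. f x) / real (card (invariants X \<phi> g))"

abbreviation "K \<equiv> burnside_kernel G X \<phi>"
abbreviation "Q \<equiv> dual_burnside_kernel G X \<phi>"
abbreviation "\<pi>\<^sub>K \<equiv> burnside_law G X \<phi>"
abbreviation "\<pi>\<^sub>Q \<equiv> dual_burnside_law G X \<phi>"

lemma fin_inv: "finite (invariants X \<phi> g)"
  using fin_X by (simp add: invariants_def)

lemma fin_stab: "finite (stabilizer G \<phi> x)"
  using fin_G by (simp add: stabilizer_def)

lemma card_inv_pos: "g \<in> carrier G \<Longrightarrow> 0 < card (invariants X \<phi> g)"
  using inv_ne fin_inv by (simp add: card_gt_0_iff)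

lemma card_stab_pos: "x \<in> X \<Longrightarrow> 0 < card (stabilizer G \<phi> x)"
  using stabilizer_one_closed fin_stab by (auto simp: card_gt_0_iff)

lemma stab_carrier: "g \<in> stabilizer G \<phi> x \<Longrightarrow> g \<in> carrier G"
  by (simp add: stabilizer_def)

lemma inv_X: "x \<in> invariants X \<phi> g \<Longrightarrow> x \<in> X"
  by (simp add: invariants_def)

section \<open>The factorization and the two stationary laws\<close>

lemma swap_fixed:
  fixes F :: "'a \<Rightarrow> 'b \<Rightarrow> real"
  shows "(\<Sum>x\<in>X. \<Sum>g\<in>stabilizer G \<phi> x. F g x) = (\<Sum>g\<in>carrier G. \<Sum>x\<in>invariants X \<phi> g. F g x)"
  unfolding stabilizer_def invariants_def by (rule sum.swap_restrict[OF fin_X fin_G])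

lemma avg_K: "avg X (K x) f = pick_group (pick_point f) x"
proof -
  have "(\<Sum>y\<in>X. \<Sum>g\<in>{g \<in> stabilizer G \<phi> x. \<phi> g y = y}. 1 / real (card (invariants X \<phi> g)) * f y)
     = (\<Sum>g\<in>stabilizer G \<phi> x. \<Sum>y\<in>{y\<in>X. \<phi> g y = y}. 1 / real (card (invariants X \<phi> g)) * f y)"
    by (rule sum.swap_restrict[OF fin_X fin_stab])
  moreover have "stabilizer G \<phi> x \<inter> stabilizer G \<phi> y = {g \<in> stabilizer G \<phi> x. \<phi> g y = y}" for y
    by (auto simp: stabilizer_def)
  ultimately show ?thesis
    unfolding avg_def burnside_kernel_def pick_group_def pick_point_def
    by (simp add: invariants_def sum_distrib_right sum_divide_distrib[symmetric])
qed

lemma avg_Q: "avg (carrier G) (Q g) h = pick_point (pick_group h) g"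
proof -
  have "(\<Sum>g'\<in>carrier G. \<Sum>x\<in>{x \<in> invariants X \<phi> g. \<phi> g' x = x}. 1 / real (card (stabilizer G \<phi> x)) * h g')
     = (\<Sum>x\<in>invariants X \<phi> g. \<Sum>g'\<in>{g'\<in>carrier G. \<phi> g' x = x}. 1 / real (card (stabilizer G \<phi> x)) * h g')"
    by (rule sum.swap_restrict[OF fin_G fin_inv])
  moreover have "invariants X \<phi> g \<inter> invariants X \<phi> g' = {x \<in> invariants X \<phi> g. \<phi> g' x = x}" for g'
    by (auto simp: invariants_def)
  ultimately show ?thesis
    unfolding avg_def dual_burnside_kernel_def pick_group_def pick_point_def
    by (simp add: stabilizer_def sum_distrib_right sum_divide_distrib[symmetric])
qed

text \<open>Both laws are marginals of the uniform law on the pairs (g, x) with g fixing x: the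
  stabilizer size in the law cancels the normalization of \<open>pick_group\<close>. Together with
  its mirror image \<open>avg_law_pick_point\<close> this gives the stationarity of both
  chains.\<close>

lemma avg_law_pick_group: "avg X \<pi>\<^sub>K (pick_group h) = avg (carrier G) \<pi>\<^sub>Q h"
proof -
  let ?c = "real (order G) * real (card (orbits G X \<phi>))"
  have "avg X \<pi>\<^sub>K (pick_group h) = (\<Sum>x\<in>X. (\<Sum>g\<in>stabilizer G \<phi> x. h g) / ?c)"
    unfolding avg_def burnside_law_def pick_group_def
    by (intro sum.cong refl) (use card_stab_pos in force)
  also have "\<dots> = (\<Sum>g\<in>carrier G. \<Sum>x\<in>invariants X \<phi> g. h g / ?c)"
    using swap_fixed[of "\<lambda>g x. h g / ?c"] by (simp add: sum_divide_distrib)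
  finally show ?thesis unfolding avg_def dual_burnside_law_def by simp
qed

lemma avg_law_pick_point: "avg (carrier G) \<pi>\<^sub>Q (pick_point f) = avg X \<pi>\<^sub>K f"
proof -
  let ?c = "real (order G) * real (card (orbits G X \<phi>))"
  have "avg (carrier G) \<pi>\<^sub>Q (pick_point f) = (\<Sum>g\<in>carrier G. (\<Sum>x\<in>invariants X \<phi> g. f x) / ?c)"
    unfolding avg_def dual_burnside_law_def pick_point_def
    by (intro sum.cong refl) (use card_inv_pos in force)
  also have "\<dots> = (\<Sum>x\<in>X. \<Sum>g\<in>stabilizer G \<phi> x. f x / ?c)"
    using swap_fixed[of "\<lambda>g x. f x / ?c"] by (simp add: sum_divide_distrib)
  finally show ?thesis unfolding avg_def burnside_law_def by simp
qed

lemma pick_group_const: "x \<in> X \<Longrightarrow> pick_group (\<lambda>_. c) x = c"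
  using card_stab_pos[of x] by (simp add: pick_group_def)

lemma pick_point_const: "g \<in> carrier G \<Longrightarrow> pick_point (\<lambda>_. c) g = c"
  using card_inv_pos[of g] by (simp add: pick_point_def)

lemma pick_group_mono:
  "(\<And>g. g \<in> stabilizer G \<phi> x \<Longrightarrow> h g \<le> h' g) \<Longrightarrow> pick_group h x \<le> pick_group h' x"
  unfolding pick_group_def by (intro divide_right_mono sum_mono) auto

lemma pick_point_mono:
  "(\<And>x. x \<in> invariants X \<phi> g \<Longrightarrow> f x \<le> f' x) \<Longrightarrow> pick_point f g \<le> pick_point f' g"
  unfolding pick_point_def by (intro divide_right_mono sum_mono) auto

lemma pick_group_cong:
  "(\<And>g. g \<in> carrier G \<Longrightarrow> h g = h' g) \<Longrightarrow> pick_group h = pick_group h'"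
  unfolding pick_group_def by (intro ext arg_cong2[where f = "(/)"] sum.cong) (auto simp: stab_carrier)

lemma pick_point_cong:
  "(\<And>x. x \<in> X \<Longrightarrow> f x = f' x) \<Longrightarrow> pick_point f = pick_point f'"
  unfolding pick_point_def by (intro ext arg_cong2[where f = "(/)"] sum.cong) (auto simp: inv_X)

lemma pick_group_unit: "unit_valued (carrier G) h \<Longrightarrow> unit_valued X (pick_group h)"
  using pick_group_mono[of _ "\<lambda>_. 0" h] pick_group_mono[of _ h "\<lambda>_. 1"] pick_group_const stab_carrier
  unfolding unit_valued_def by metis

lemma pick_point_unit: "unit_valued X f \<Longrightarrow> unit_valued (carrier G) (pick_point f)"
  using pick_point_mono[of _ "\<lambda>_. 0" f] pick_point_mono[of _ f "\<lambda>_. 1"] pick_point_const inv_X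
  unfolding unit_valued_def by metis

lemma burnside_double_count:
  "(\<Sum>g\<in>carrier G. real (card (invariants X \<phi> g))) = real (order G) * real (card (orbits G X \<phi>))"
  using burnside[OF fin_G fin_X] by (simp add: mult.commute flip: of_nat_mult of_nat_sum)

lemma sum_inv_pos: "0 < (\<Sum>g\<in>carrier G. real (card (invariants X \<phi> g)))"
proof -
  obtain x where "x \<in> X" using X_ne by blast
  then have "carrier G \<noteq> {}" using stabilizer_one_closed by (auto simp: stabilizer_def)
  then show ?thesis using fin_G card_inv_pos by (intro sum_pos) auto
qed

lemma law_Q_sum: "sum \<pi>\<^sub>Q (carrier G) = 1"
  using sum_inv_pos unfolding dual_burnside_law_def sum_divide_distrib[symmetric] burnside_double_count
  by (metis divide_self less_numeral_extra(3))

lemma law_K_sum: "sum \<pi>\<^sub>K X = 1"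
  using avg_law_pick_point[of "\<lambda>_. 1"] law_Q_sum
  by (simp add: avg_def pick_point_const)

sublocale K: finite_chain X K \<pi>\<^sub>K
proof
  fix s r assume s: "s \<in> X" and r: "r \<in> X"
  show "0 \<le> K s r" by (auto simp: burnside_kernel_def intro!: divide_nonneg_nonneg sum_nonneg)
next
  fix s assume s: "s \<in> X"
  show "0 \<le> \<pi>\<^sub>K s" by (simp add: burnside_law_def)
  have "avg X (K s) (\<lambda>_. 1) = pick_group (\<lambda>_. 1) s"
    unfolding avg_K using pick_point_const by (simp cong: pick_group_cong)
  then show "(\<Sum>r\<in>X. K s r) = 1" using s by (simp add: avg_def pick_group_const)
next
  fix r assume r: "r \<in> X"
  let ?d = "\<lambda>y. if y = r then 1 else 0 :: real"
  have d: "avg X \<mu> ?d = \<mu> r" for \<mu> :: "'b \<Rightarrow> real"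
  proof -
    have "avg X \<mu> ?d = (\<Sum>y\<in>X. if y = r then \<mu> y else 0)"
      unfolding avg_def by (intro sum.cong) auto
    then show ?thesis using r fin_X by simp
  qed
  have "avg X \<pi>\<^sub>K (\<lambda>s. K s r) = avg X \<pi>\<^sub>K (\<lambda>s. avg X (K s) ?d)" by (simp only: d)
  also have "\<dots> = avg X \<pi>\<^sub>K ?d" by (simp only: avg_K avg_law_pick_group avg_law_pick_point)
  finally show "(\<Sum>s\<in>X. \<pi>\<^sub>K s * K s r) = \<pi>\<^sub>K r" unfolding d by (simp add: avg_def)
qed (use fin_X X_ne law_K_sum in auto)

sublocale Q: finite_chain "carrier G" Q \<pi>\<^sub>Q
proof
  fix s r assume s: "s \<in> carrier G" and r: "r \<in> carrier G"
  show "0 \<le> Q s r" by (auto simp: dual_burnside_kernel_def intro!: divide_nonneg_nonneg sum_nonneg)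
next
  fix s assume s: "s \<in> carrier G"
  show "0 \<le> \<pi>\<^sub>Q s" by (simp add: dual_burnside_law_def)
  have "avg (carrier G) (Q s) (\<lambda>_. 1) = pick_point (\<lambda>_. 1) s"
    unfolding avg_Q using pick_group_const by (simp cong: pick_point_cong)
  then show "(\<Sum>r\<in>carrier G. Q s r) = 1" using s by (simp add: avg_def pick_point_const)
next
  fix r assume r: "r \<in> carrier G"
  let ?d = "\<lambda>y. if y = r then 1 else 0 :: real"
  have d: "avg (carrier G) \<mu> ?d = \<mu> r" for \<mu> :: "'a \<Rightarrow> real"
  proof -
    have "avg (carrier G) \<mu> ?d = (\<Sum>y\<in>carrier G. if y = r then \<mu> y else 0)"
      unfolding avg_def by (intro sum.cong) auto
    then show ?thesis using r fin_G by simp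
  qed
  have "avg (carrier G) \<pi>\<^sub>Q (\<lambda>s. Q s r) = avg (carrier G) \<pi>\<^sub>Q (\<lambda>s. avg (carrier G) (Q s) ?d)" by (simp only: d)
  also have "\<dots> = avg (carrier G) \<pi>\<^sub>Q ?d" by (simp only: avg_Q avg_law_pick_group avg_law_pick_point)
  finally show "(\<Sum>s\<in>carrier G. \<pi>\<^sub>Q s * Q s r) = \<pi>\<^sub>Q r" unfolding d by (simp add: avg_def)
qed (use fin_G law_Q_sum in auto)

lemma step_K: "K.step f = pick_group (pick_point f)"
  by (simp add: fun_eq_iff K.step_def avg_K)

lemma step_Q: "Q.step h = pick_point (pick_group h)"
  by (simp add: fun_eq_iff Q.step_def avg_Q)

section \<open>Transfer of distances between the two chains\<close>

lemma funpow_Q_Suc: "(Q.step ^^ Suc t) h = pick_point ((K.step ^^ t) (pick_group h))"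
  by (induction t) (simp_all add: step_K step_Q)

lemma funpow_K_Suc: "(K.step ^^ Suc t) f = pick_group ((Q.step ^^ t) (pick_point f))"
  by (induction t) (simp_all add: step_K step_Q)

text \<open>In \<open>(B A)^(t+1) = B (A B)^t A\<close> the inner \<open>A\<close> keeps test
  functions in [0,1] and the outer \<open>B\<close> averages the bounds over the fixed points of
  \<open>g\<close>. One step is lost, but only starting points fixed by \<open>g\<close> matter,
  which is what (c) exploits.\<close>

lemma dist_Q_Suc_le:
  assumes "g \<in> carrier G" "\<And>x. x \<in> invariants X \<phi> g \<Longrightarrow> dist_from X K \<pi>\<^sub>K x t \<le> B"
  shows "dist_from (carrier G) Q \<pi>\<^sub>Q g (Suc t) \<le> B"
proof (rule Q.dist_from_le[OF assms(1)])
  fix h assume h: "unit_valued (carrier G) h"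
  have "pick_point ((K.step ^^ t) (pick_group h)) g
      \<le> pick_point (\<lambda>_. B + avg X \<pi>\<^sub>K (pick_group h)) g"
    using K.dist_from_ge[OF inv_X pick_group_unit[OF h], of _ g t] assms(2)
    by (intro pick_point_mono) fastforce
  then show "(Q.step ^^ Suc t) h g - avg (carrier G) \<pi>\<^sub>Q h \<le> B"
    unfolding funpow_Q_Suc by (simp add: pick_point_const[OF assms(1)] avg_law_pick_group)
qed

lemma dist_K_Suc_le:
  assumes "x \<in> X" "\<And>g. g \<in> stabilizer G \<phi> x \<Longrightarrow> dist_from (carrier G) Q \<pi>\<^sub>Q g t \<le> B"
  shows "dist_from X K \<pi>\<^sub>K x (Suc t) \<le> B"
proof (rule K.dist_from_le[OF assms(1)])
  fix f assume f: "unit_valued X f"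
  have "pick_group ((Q.step ^^ t) (pick_point f)) x
      \<le> pick_group (\<lambda>_. B + avg (carrier G) \<pi>\<^sub>Q (pick_point f)) x"
    using Q.dist_from_ge[OF stab_carrier pick_point_unit[OF f], of _ x t] assms(2)
    by (intro pick_group_mono) fastforce
  then show "(K.step ^^ Suc t) f x - avg X \<pi>\<^sub>K f \<le> B"
    unfolding funpow_K_Suc by (simp add: pick_group_const[OF assms(1)] avg_law_pick_point)
qed

text \<open>The direction that carries lower bounds for \<open>K\<close> over to \<open>Q\<close>,
  at one step less.\<close>

lemma dist_worst_K_Suc_le: "dist_worst X K \<pi>\<^sub>K (Suc t) \<le> dist_worst (carrier G) Q \<pi>\<^sub>Q t"
  by (intro K.dist_worst_le dist_K_Suc_le Q.dist_worst_ge stab_carrier)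

text \<open>Minorization through the identity: it lies in every stabilizer and fixes every point.\<close>

lemma dist_K_le_order:
  assumes "x \<in> X"
  shows "dist_from X K \<pi>\<^sub>K x t \<le> (1 - 1 / real (order G)) ^ t"
proof (rule K.doeblin_dist_from[where \<nu> = "\<lambda>_. 1 / real (order G) / real (card X)", OF _ _ assms])
  fix f :: "'b \<Rightarrow> real" and s assume f: "\<forall>r\<in>X. 0 \<le> f r" and s: "s \<in> X"
  have nn: "0 \<le> pick_point f g" for g
    using f by (auto simp: pick_point_def inv_X intro!: divide_nonneg_nonneg sum_nonneg)
  have "invariants X \<phi> \<one> = X"
    using stabilizer_one_closed by (auto simp: invariants_def stabilizer_def)
  then have "sum f X / real (card X) = pick_point f \<one>" by (simp add: pick_point_def)
  also have "\<dots> \<le> (\<Sum>g\<in>stabilizer G \<phi> s. pick_point f g)"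
    using nn stabilizer_one_closed[OF s] fin_stab by (intro member_le_sum) auto
  finally have "sum f X / real (card X) / real (order G) \<le> pick_group (pick_point f) s"
    unfolding pick_group_def using card_stab_pos[OF s] nn
    by (intro frac_le sum_nonneg) (auto simp: order_def intro!: card_mono fin_G dest: stab_carrier)
  then show "avg X (\<lambda>_. 1 / real (order G) / real (card X)) f \<le> K.step f s"
    by (simp add: step_K avg_def sum_divide_distrib mult.commute)
qed (use fin_X X_ne in simp)

lemma dist_Q_le_order:
  assumes "g \<in> carrier G"
  shows "dist_from (carrier G) Q \<pi>\<^sub>Q g t \<le> (1 - 1 / real (order G)) ^ t"
proof (rule Q.doeblin_dist_from[where \<nu> = "\<lambda>h. if h = \<one> then 1 / real (order G) else 0", OF _ _ assms])
  have one: "\<one> \<in> carrier G" using stabilizer_one_closed X_ne by (auto simp: stabilizer_def)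
  show "(\<Sum>h\<in>carrier G. if h = \<one> then 1 / real (order G) else 0) = 1 / real (order G)"
    using one fin_G by simp
  fix h :: "'a \<Rightarrow> real" and s assume h: "\<forall>r\<in>carrier G. 0 \<le> h r" and s: "s \<in> carrier G"
  have "h \<one> / real (order G) \<le> pick_group h x" if x: "x \<in> X" for x
  proof -
    have "h \<one> \<le> (\<Sum>g\<in>stabilizer G \<phi> x. h g)"
      using h stabilizer_one_closed[OF x] fin_stab by (intro member_le_sum) (auto dest: stab_carrier)
    then show ?thesis
      unfolding pick_group_def using card_stab_pos[OF x] h
      by (intro frac_le sum_nonneg)
        (auto simp: order_def intro!: card_mono fin_G dest: stab_carrier)
  qed
  then have "pick_point (\<lambda>_. h \<one> / real (order G)) s \<le> pick_point (pick_group h) s"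
    by (intro pick_point_mono) (auto dest: inv_X)
  moreover have "avg (carrier G) (\<lambda>h. if h = \<one> then 1 / real (order G) else 0) h
      = (\<Sum>r\<in>carrier G. if r = \<one> then h \<one> / real (order G) else 0)"
    unfolding avg_def by (intro sum.cong) auto
  ultimately show "avg (carrier G) (\<lambda>h. if h = \<one> then 1 / real (order G) else 0) h \<le> Q.step h s"
    using one fin_G by (simp add: step_Q pick_point_const[OF s])
qed

end

section \<open>The Burnside kernel on words in closed form\<close>

definition cnt :: "nat set \<Rightarrow> (nat \<Rightarrow> 'l) \<Rightarrow> 'l \<Rightarrow> nat" where
  "cnt I z a = card {i\<in>I. z i = a}"

definition cnt2 :: "nat set \<Rightarrow> (nat \<Rightarrow> nat) \<Rightarrow> (nat \<Rightarrow> nat) \<Rightarrow> nat \<Rightarrow> nat \<Rightarrow> nat" where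
  "cnt2 I x y a b = cnt I (\<lambda>i. (x i, y i)) (a, b)"

abbreviation wrd :: "nat set \<Rightarrow> nat \<Rightarrow> (nat \<Rightarrow> nat) set" where
  "wrd I k \<equiv> I \<rightarrow>\<^sub>E {1..k}"

text \<open>This is k to the number of cycles of g. An arbitrary index set allows induction on
  positions.\<close>

definition fixwords :: "nat \<Rightarrow> nat set \<Rightarrow> (nat \<Rightarrow> nat) \<Rightarrow> nat" where
  "fixwords k I g = card {w \<in> wrd I k. \<forall>i\<in>I. w (g i) = w i}"

text \<open>For the paired word of x and y this is the sum in the kernel, and for
  \<open>k = 1\<close> the order of the stabilizer of z; the label type is left open to cover
  both.\<close>

definition stabsum :: "nat \<Rightarrow> nat set \<Rightarrow> (nat \<Rightarrow> 'l) \<Rightarrow> real" where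
  "stabsum k I z = (\<Sum>g | g permutes I \<and> (\<forall>i\<in>I. z (g i) = z i). 1 / real (fixwords k I g))"

lemma cnt_empty [simp]: "cnt {} z a = 0" "cnt2 {} x y c d = 0"
  by (simp_all add: cnt_def cnt2_def)

lemma cnt_insert:
  assumes "finite I" "i \<notin> I"
  shows "cnt (insert i I) z a = cnt I z a + (if z i = a then 1 else 0)"
proof -
  have "{j\<in>insert i I. z j = a} = (if z i = a then insert i {j\<in>I. z j = a} else {j\<in>I. z j = a})"
    by auto
  then show ?thesis using assms by (simp add: cnt_def)
qed

lemma cnt2_insert:
  assumes "finite I" "i \<notin> I"
  shows "cnt2 (insert i I) x y a b = cnt2 I x y a b + (if x i = a \<and> y i = b then 1 else 0)"
  using assms by (simp add: cnt2_def cnt_insert)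

lemma cnt_cong: "(\<And>i. i \<in> I \<Longrightarrow> z i = z' i) \<Longrightarrow> cnt I z = cnt I z'"
  unfolding cnt_def by (intro ext arg_cong[where f = card]) auto

lemma cnt2_cong:
  "(\<And>i. i \<in> I \<Longrightarrow> x i = x' i) \<Longrightarrow> (\<And>i. i \<in> I \<Longrightarrow> y i = y' i) \<Longrightarrow> cnt2 I x y = cnt2 I x' y'"
  unfolding cnt2_def by (intro ext) (metis (mono_tags, lifting) cnt_cong)

lemma cnt2_upd [simp]: "i \<notin> I \<Longrightarrow> cnt2 I x (u(i := c)) = cnt2 I x u"
  by (rule cnt2_cong) auto

lemma cnt_upd [simp]: "i \<notin> I \<Longrightarrow> cnt I (u(i := c)) = cnt I u"
  by (rule cnt_cong) auto

lemma cnt_sum: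
  assumes "finite I" "finite A" "\<And>i. i \<in> I \<Longrightarrow> z i \<in> A"
  shows "(\<Sum>a\<in>A. cnt I z a) = card I"
  using assms(1,3)
proof (induction I)
  case (insert i I)
  have "(\<Sum>a\<in>A. cnt (insert i I) z a) = (\<Sum>a\<in>A. cnt I z a) + (\<Sum>a\<in>A. if z i = a then 1 else 0)"
    using insert.hyps by (simp add: cnt_insert sum.distrib)
  then show ?case using insert assms(2) by simp
qed simp

lemma cnt2_sum:
  assumes "finite I" "finite A" "\<And>i. i \<in> I \<Longrightarrow> y i \<in> A"
  shows "(\<Sum>b\<in>A. cnt2 I x y a b) = cnt I x a"
  using assms(1,3)
proof (induction I)
  case (insert i I)
  have "(\<Sum>b\<in>A. cnt2 (insert i I) x y a b)
      = (\<Sum>b\<in>A. cnt2 I x y a b) + (\<Sum>b\<in>A. if y i = b then (if x i = a then 1 else 0) else 0)"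
    using insert.hyps unfolding sum.distrib[symmetric]
    by (intro sum.cong) (auto simp: cnt2_insert)
  then show ?case using insert assms(2) by (simp add: cnt_insert)
qed simp

lemma sum_wrd_insert:
  fixes F :: "(nat \<Rightarrow> nat) \<Rightarrow> 'c :: comm_monoid_add"
  assumes "i \<notin> I"
  shows "(\<Sum>y\<in>wrd (insert i I) k. F y) = (\<Sum>u\<in>wrd I k. \<Sum>c=1..k. F (u(i := c)))"
proof -
  have "(\<Sum>y\<in>wrd (insert i I) k. F y) = (\<Sum>(c, u)\<in>{1..k} \<times> wrd I k. F (u(i := c)))"
    unfolding PiE_insert_eq
    by (subst sum.reindex) (use inj_combinator[OF assms] in \<open>auto simp: o_def case_prod_unfold\<close>)
  also have "\<dots> = (\<Sum>c=1..k. \<Sum>u\<in>wrd I k. F (u(i := c)))" by (simp add: sum.cartesian_product)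
  also have "\<dots> = (\<Sum>u\<in>wrd I k. \<Sum>c=1..k. F (u(i := c)))" by (rule sum.swap)
  finally show ?thesis .
qed

lemma finite_wrd [simp]: "finite I \<Longrightarrow> finite (wrd I k)"
  by (simp add: finite_PiE)

section \<open>Permutations built by inserting one position\<close>

lemma invariant_insert:
  assumes "i \<notin> I" "j \<in> insert i I" "p permutes I"
  shows "(\<forall>l\<in>insert i I. z ((transpose i j \<circ> p) l) = z l) \<longleftrightarrow> z j = z i \<and> (\<forall>l\<in>I. z (p l) = z l)"
proof -
  have i: "(transpose i j \<circ> p) i = j" using assms by (simp add: permutes_not_in)
  have l: "z ((transpose i j \<circ> p) l) = z (p l)" if "z j = z i" "l \<in> I" for l
  proof -
    have "p l \<in> I" using permutes_in_image[OF assms(3)] that(2) by blast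
    then show ?thesis using that(1) assms(1) by (auto simp: transpose_def)
  qed
  show ?thesis using i l by auto
qed

text \<open>Composing with \<open>transpose i j\<close> splices \<open>i\<close> into the cycle of
  \<open>p\<close> just before \<open>j\<close>, or makes it a new fixed point when
  \<open>j = i\<close>. Only the latter adds a cycle, hence a free choice among \<open>k\<close>
  letters.\<close>

lemma fixwords_insert:
  assumes "finite I" "i \<notin> I" "j \<in> insert i I" "p permutes I"
  shows "fixwords k (insert i I) (transpose i j \<circ> p) = (if j = i then k else 1) * fixwords k I p"
proof -
  let ?inv = "\<lambda>J g (w :: nat \<Rightarrow> nat). \<forall>l\<in>J. w (g l) = w l"
  have card: "card {w \<in> wrd J k. P w} = (\<Sum>w\<in>wrd J k. if P w then 1 else 0)" if "finite J" for J P
    unfolding card_eq_sum using that by (intro sum.inter_filter finite_wrd)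
  have "p l \<noteq> i \<and> l \<noteq> i" if "l \<in> I" for l
    using that assms(2) permutes_in_image[OF assms(4)] by metis
  then have inv: "?inv I p (u(i := c)) \<longleftrightarrow> ?inv I p u" for u c by simp
  have "fixwords k (insert i I) (transpose i j \<circ> p)
      = (\<Sum>w\<in>wrd (insert i I) k. if ?inv (insert i I) (transpose i j \<circ> p) w then 1 else 0)"
    unfolding fixwords_def by (rule card) (use assms in simp)
  also have "\<dots> = (\<Sum>u\<in>wrd I k. \<Sum>c=1..k.
      if ?inv (insert i I) (transpose i j \<circ> p) (u(i := c)) then 1 else 0)"
    by (rule sum_wrd_insert[OF assms(2)])
  also have "\<dots> = (\<Sum>u\<in>wrd I k. \<Sum>c=1..k. if (u(i := c)) j = c \<and> ?inv I p u then 1 else 0)"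
    by (simp only: invariant_insert[OF assms(2-4)] inv fun_upd_same)
  also have "\<dots> = (\<Sum>u\<in>wrd I k. (if j = i then k else 1) * (if ?inv I p u then 1 else 0))"
  proof (intro sum.cong refl)
    fix u assume u: "u \<in> wrd I k"
    have "(\<Sum>c=1..k. if u j = c \<and> ?inv I p u then 1 else 0) = (if ?inv I p u then 1 else (0::nat))"
      if "j \<noteq> i"
    proof -
      have "u j \<in> {1..k}" using u that assms(3) by blast
      then show ?thesis by (cases "?inv I p u") simp_all
    qed
    then show "(\<Sum>c=1..k. if (u(i := c)) j = c \<and> ?inv I p u then 1 else 0)
        = (if j = i then k else 1) * (if ?inv I p u then 1 else 0)"
      by (cases "j = i") (simp_all only: fun_upd_same fun_upd_other if_True if_False, simp_all)
  qed
  finally show ?thesis unfolding fixwords_def card[OF assms(1)] sum_distrib_left .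
qed

text \<open>The Chinese restaurant recursion: \<open>i\<close> opens a cycle of its own with weight
  \<open>1 / k\<close>, or enters, with weight 1, just before any position that carries its
  label.\<close>

lemma stabsum_insert:
  assumes I: "finite I" "i \<notin> I"
  shows "stabsum k (insert i I) z = stabsum k I z * (1 / real k + real (cnt I z (z i)))"
proof -
  let ?inv = "\<lambda>J (g :: nat \<Rightarrow> nat). \<forall>l\<in>J. z (g l) = z l"
  have sum: "stabsum k J z = (\<Sum>g | g permutes J. if ?inv J g then 1 / real (fixwords k J g) else 0)"
    if "finite J" for J
    unfolding stabsum_def using finite_permutations[OF that] by (simp add: sum.If_cases Int_def)
  have "stabsum k (insert i I) z
      = (\<Sum>j\<in>insert i I. \<Sum>p | p permutes I. if ?inv (insert i I) (transpose i j \<circ> p)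
           then 1 / real (fixwords k (insert i I) (transpose i j \<circ> p)) else 0)"
    using I by (subst sum) (simp_all only: finite_insert sum_over_permutations_insert[OF I])
  also have "\<dots> = (\<Sum>j\<in>insert i I. (if z j = z i then if j = i then 1 / real k else 1 else 0) * stabsum k I z)"
    unfolding sum[OF I(1)] sum_distrib_left
  proof (intro sum.cong refl)
    fix j p assume j: "j \<in> insert i I" and "p \<in> {p. p permutes I}"
    then have p: "p permutes I" by simp
    show "(if ?inv (insert i I) (transpose i j \<circ> p)
         then 1 / real (fixwords k (insert i I) (transpose i j \<circ> p)) else 0)
       = (if z j = z i then if j = i then 1 / real k else 1 else 0) *
         (if ?inv I p then 1 / real (fixwords k I p) else 0)"
      unfolding invariant_insert[OF I(2) j p] fixwords_insert[OF I j p] by simp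
  qed
  also have "\<dots> = (1 / real k + (\<Sum>j\<in>I. if z j = z i then 1 else 0)) * stabsum k I z"
  proof -
    have "(\<Sum>j\<in>I. if z j = z i then if j = i then 1 / real k else 1 else 0)
        = (\<Sum>j\<in>I. if z j = z i then 1 else (0::real))"
      using I(2) by (intro sum.cong) auto
    then show ?thesis unfolding sum_distrib_right[symmetric] using I by simp
  qed
  also have "(\<Sum>j\<in>I. if z j = z i then 1 else 0) = real (cnt I z (z i))"
    using I(1) by (simp add: cnt_def sum.If_cases Int_def)
  finally show ?thesis by (simp add: mult.commute)
qed

lemma stabsum_empty [simp]: "stabsum k {} z = 1"
  by (simp add: stabsum_def fixwords_def Int_def)

text \<open>One Polya urn per letter \<open>a\<close> of \<open>x\<close>: the probability of the
  particular word \<open>y\<close> when the positions of block \<open>a\<close> draw from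
  \<open>k\<close> colours of initial weight \<alpha>. The value \<open>1 / k\<close> gives the
  Burnside kernel; the value 1 serves for the stationary law and as a comparison kernel.\<close>

definition kap :: "real \<Rightarrow> nat \<Rightarrow> nat set \<Rightarrow> (nat \<Rightarrow> nat) \<Rightarrow> (nat \<Rightarrow> nat) \<Rightarrow> real" where
  "kap \<alpha> k I x y = (\<Prod>a=1..k. (\<Prod>b=1..k. pochhammer \<alpha> (cnt2 I x y a b))
     / pochhammer (real k * \<alpha>) (cnt I x a))"

lemma kap_empty [simp]: "kap \<alpha> k {} x y = 1"
  by (simp add: kap_def)

lemma kap_cong:
  "(\<And>i. i \<in> I \<Longrightarrow> x i = x' i) \<Longrightarrow> (\<And>i. i \<in> I \<Longrightarrow> y i = y' i) \<Longrightarrow> kap \<alpha> k I x y = kap \<alpha> k I x' y'"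
  unfolding kap_def using cnt2_cong[of I x x' y y'] cnt_cong[of I x x'] by simp

lemma kap_upd [simp]: "i \<notin> I \<Longrightarrow> kap \<alpha> k I x (u(i := c)) = kap \<alpha> k I x u"
  by (rule kap_cong) auto

lemma kap_insert:
  assumes "finite I" "i \<notin> I" "x i \<in> {1..k}" "y i \<in> {1..k}"
  shows "kap \<alpha> k (insert i I) x y = kap \<alpha> k I x y *
    ((\<alpha> + real (cnt2 I x y (x i) (y i))) / (real k * \<alpha> + real (cnt I x (x i))))"
proof -
  let ?r = "(\<alpha> + real (cnt2 I x y (x i) (y i))) / (real k * \<alpha> + real (cnt I x (x i)))"
  have row: "(\<Prod>b=1..k. pochhammer \<alpha> (cnt2 (insert i I) x y a b))
     = (\<Prod>b=1..k. pochhammer \<alpha> (cnt2 I x y a b)) *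
       (if a = x i then \<alpha> + real (cnt2 I x y (x i) (y i)) else 1)" for a
  proof -
    have "(\<Prod>b=1..k. pochhammer \<alpha> (cnt2 (insert i I) x y a b))
       = (\<Prod>b=1..k. pochhammer \<alpha> (cnt2 I x y a b) *
          (if b = y i then if a = x i then \<alpha> + real (cnt2 I x y (x i) (y i)) else 1 else 1))"
      using assms(1,2) by (intro prod.cong) (auto simp: cnt2_insert pochhammer_Suc)
    then show ?thesis using assms(4) by (simp add: prod.distrib)
  qed
  have "kap \<alpha> k (insert i I) x y
     = (\<Prod>a=1..k. (\<Prod>b=1..k. pochhammer \<alpha> (cnt2 I x y a b)) / pochhammer (real k * \<alpha>) (cnt I x a) *
          (if a = x i then ?r else 1))"
    unfolding kap_def row using assms(1,2)
    by (intro prod.cong) (auto simp: cnt_insert pochhammer_Suc)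
  also have "\<dots> = kap \<alpha> k I x y * (\<Prod>a=1..k. if a = x i then ?r else 1)"
    unfolding kap_def by (rule prod.distrib)
  finally show ?thesis using assms(3) by (simp only: prod.delta finite_atLeastAtMost if_True)
qed

lemma pochhammer_ge_0: "0 \<le> (x::real) \<Longrightarrow> 0 \<le> pochhammer x n"
  by (induction n) (auto simp: pochhammer_Suc)

lemma kap_nonneg: "0 \<le> \<alpha> \<Longrightarrow> 0 \<le> kap \<alpha> k I x y"
  unfolding kap_def by (intro prod_nonneg ballI divide_nonneg_nonneg pochhammer_ge_0) auto

definition wt :: "real \<Rightarrow> nat \<Rightarrow> nat set \<Rightarrow> (nat \<Rightarrow> nat) \<Rightarrow> (nat \<Rightarrow> nat) \<Rightarrow> nat \<Rightarrow> nat \<Rightarrow> real" where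
  "wt \<alpha> k I x u a c = (\<alpha> + real (cnt2 I x u a c)) / (real k * \<alpha> + real (cnt I x a))"

lemma wt_nonneg: "0 \<le> \<alpha> \<Longrightarrow> 0 \<le> wt \<alpha> k I x u a c"
  by (simp add: wt_def)

lemma wt_sum:
  assumes "finite I" "0 < \<alpha>" "1 \<le> k" "u \<in> wrd I k"
  shows "(\<Sum>c=1..k. wt \<alpha> k I x u a c) = 1"
proof -
  have "real (\<Sum>c=1..k. cnt2 I x u a c) = real (cnt I x a)"
    using assms by (subst cnt2_sum) auto
  moreover have "0 < real k * \<alpha> + real (cnt I x a)" using assms by (intro add_pos_nonneg) auto
  ultimately show ?thesis
    unfolding wt_def sum_divide_distrib[symmetric] sum.distrib by simp
qed

text \<open>The colour of \<open>i\<close> is drawn last, with the predictive weights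
  \<open>wt\<close>. By exchangeability \<open>i\<close> may be any position; most later
  computations are inductions with this rule.\<close>

lemma avg_kap_insert:
  assumes "finite I" "i \<notin> I" "x i \<in> {1..k}"
  shows "avg (wrd (insert i I) k) (kap \<alpha> k (insert i I) x) f
    = avg (wrd I k) (kap \<alpha> k I x) (\<lambda>u. \<Sum>c=1..k. wt \<alpha> k I x u (x i) c * f (u(i := c)))"
proof -
  have "kap \<alpha> k (insert i I) x (u(i := c)) = kap \<alpha> k I x u * wt \<alpha> k I x u (x i) c"
    if "c \<in> {1..k}" for u c
    using that assms by (simp add: kap_insert wt_def del: atLeastAtMost_iff)
  then show ?thesis
    unfolding avg_def sum_wrd_insert[OF assms(2)] sum_distrib_left
    by (intro sum.cong refl) (simp add: mult.assoc del: atLeastAtMost_iff)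
qed

lemma sum_kap:
  assumes "finite I" "0 < \<alpha>" "1 \<le> k" "x ` I \<subseteq> {1..k}"
  shows "sum (kap \<alpha> k I x) (wrd I k) = 1"
proof -
  have "avg (wrd I k) (kap \<alpha> k I x) (\<lambda>_. 1) = 1"
    using assms(1,4)
  proof (induction I)
    case empty
    show ?case by (simp add: avg_def)
  next
    case (insert i I)
    have "avg (wrd (insert i I) k) (kap \<alpha> k (insert i I) x) (\<lambda>_. 1)
        = avg (wrd I k) (kap \<alpha> k I x) (\<lambda>u. \<Sum>c=1..k. wt \<alpha> k I x u (x i) c * 1)"
      using insert by (intro avg_kap_insert) auto
    also have "\<dots> = avg (wrd I k) (kap \<alpha> k I x) (\<lambda>u. 1)"
      using insert.hyps assms(2,3) by (intro avg_cong) (simp only: mult_1_right wt_sum)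
    finally show ?case using insert by simp
  qed
  then show ?thesis by (simp add: avg_def)
qed

text \<open>The two stabilizer sums obey parallel recursions, with increments \<open>1 / k\<close>
  plus a table entry and 1 plus a block size. Their quotient is the urn weight, since
  \<open>k * (1 / k) = 1\<close>.\<close>

lemma stabsum_ratio:
  assumes "finite I" "1 \<le> k" "x ` I \<subseteq> {1..k}" "y ` I \<subseteq> {1..k}"
  shows "stabsum k I (\<lambda>i. (x i, y i)) = stabsum 1 I x * kap (1 / real k) k I x y"
  using assms(1,3,4)
proof (induction I)
  case (insert i I)
  have i: "x i \<in> {1..k}" "y i \<in> {1..k}" using insert.prems by auto
  have arith: "s * q * w = s * (1 + d) * (q * (w / (1 + d)))" if "0 \<le> d" for s q w d :: real
    using that by (simp add: nonzero_eq_divide_eq)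
  have "real k * (1 / real k) = 1" using assms(2) by simp
  then show ?case
    using insert.IH insert.prems arith[of "real (cnt I x (x i))" "stabsum 1 I x"]
    unfolding stabsum_insert[OF insert.hyps(1,2)] kap_insert[where x = x and y = y, OF insert.hyps(1,2) i]
      cnt2_def by (simp del: One_nat_def)
qed simp

section \<open>The closed form for words of length n\<close>

lemma word_fixed_iff:
  assumes "g permutes {1..n}" "x \<in> words n k"
  shows "word_action n k g x = x \<longleftrightarrow> (\<forall>i\<in>{1..n}. x (g i) = x i)"
proof -
  have "word_action n k g x = x \<longleftrightarrow> (\<forall>i\<in>{1..n}. x (Hilbert_Choice.inv g i) = x i)"
    using assms(2) by (auto simp: word_action_def words_def fun_eq_iff restrict_def PiE_iff extensional_def)
  also have "\<dots> \<longleftrightarrow> (\<forall>i\<in>{1..n}. x (g i) = x i)"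
    by (metis assms(1) permutes_in_image permutes_inv permutes_inverses)
  finally show ?thesis .
qed

lemma stabilizer_word:
  "x \<in> words n k \<Longrightarrow> stabilizer (sym_group n) (word_action n k) x
    = {g. g permutes {1..n} \<and> (\<forall>i\<in>{1..n}. x (g i) = x i)}"
  by (auto simp: stabilizer_def word_fixed_iff sym_group_carrier)

lemma card_invariants_word:
  "g permutes {1..n} \<Longrightarrow> card (invariants (words n k) (word_action n k) g) = fixwords k {1..n} g"
  unfolding invariants_def fixwords_def words_def[symmetric]
  by (intro arg_cong[where f = card]) (auto simp: word_fixed_iff)

lemma fixwords_1: "g permutes I \<Longrightarrow> fixwords 1 I g = 1"
proof -
  assume g: "g permutes I"
  have "wrd I 1 = {\<lambda>i\<in>I. 1}"
    using PiE_singleton[of "\<lambda>i\<in>I. 1::nat" I] by (simp cong: PiE_cong)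
  then have "{w \<in> wrd I 1. \<forall>i\<in>I. w (g i) = w i} = {\<lambda>i\<in>I. 1}"
    using permutes_in_image[OF g] by (auto simp del: One_nat_def)
  then show ?thesis by (simp add: fixwords_def)
qed

lemma card_stabilizer_word:
  assumes "x \<in> words n k"
  shows "real (card (stabilizer (sym_group n) (word_action n k) x)) = stabsum 1 {1..n} x"
proof -
  have "stabsum 1 {1..n} x = (\<Sum>g | g permutes {1..n} \<and> (\<forall>i\<in>{1..n}. x (g i) = x i). 1)"
    unfolding stabsum_def
  proof (rule sum.cong[OF refl])
    fix g assume "g \<in> {g. g permutes {1..n} \<and> (\<forall>i\<in>{1..n}. x (g i) = x i)}"
    then have "fixwords 1 {1..n} g = 1" by (intro fixwords_1) simp
    then show "1 / real (fixwords 1 {1..n} g) = 1" by (simp only: of_nat_1 div_by_1)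
  qed
  then show ?thesis by (simp add: stabilizer_word[OF assms])
qed

lemma burnside_kernel_word:
  assumes "1 \<le> k" "x \<in> words n k" "y \<in> words n k"
  shows "burnside_kernel (sym_group n) (words n k) (word_action n k) x y
    = kap (1 / real k) k {1..n} x y"
proof -
  have "stabilizer (sym_group n) (word_action n k) x \<inter> stabilizer (sym_group n) (word_action n k) y
      = {g. g permutes {1..n} \<and> (\<forall>i\<in>{1..n}. (x (g i), y (g i)) = (x i, y i))}"
    using assms by (auto simp: stabilizer_word)
  then have "burnside_kernel (sym_group n) (words n k) (word_action n k) x y
      = stabsum k {1..n} (\<lambda>i. (x i, y i)) / stabsum 1 {1..n} x"
    unfolding burnside_kernel_def card_stabilizer_word[OF assms(2)] stabsum_def[of k] divide_inverse
      mult_1_left mult.commute[of "inverse (stabsum 1 {1..n} x)"]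
    by (intro arg_cong2[where f = "(*)"] sum.cong refl) (auto simp: card_invariants_word simp del: One_nat_def)
  moreover have "stabsum 1 {1..n} x \<noteq> 0"
  proof -
    have "id \<in> stabilizer (sym_group n) (word_action n k) x"
      by (simp add: stabilizer_word[OF assms(2)])
    moreover have "finite (stabilizer (sym_group n) (word_action n k) x)"
      using finite_permutations[of "{1..n}"] by (simp add: stabilizer_word[OF assms(2)])
    ultimately have "card (stabilizer (sym_group n) (word_action n k) x) \<noteq> 0" by auto
    then show ?thesis unfolding card_stabilizer_word[OF assms(2), symmetric] by simp
  qed
  ultimately show ?thesis
    using assms by (simp add: stabsum_ratio words_def PiE_iff image_subset_iff)
qed

lemma const_word_words: "a \<in> {1..k} \<Longrightarrow> const_word n a \<in> words n k"
  by (auto simp: const_word_def words_def)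

lemma const_word_fixed:
  "g permutes {1..n} \<Longrightarrow> a \<in> {1..k} \<Longrightarrow> const_word n a \<in> invariants (words n k) (word_action n k) g"
  using permutes_in_image[of g "{1..n}"]
  by (simp add: invariants_def const_word_words word_fixed_iff) (simp add: const_word_def)

lemma finite_burnside_words:
  assumes "1 \<le> k"
  shows "finite_burnside (sym_group n) (words n k) (word_action n k)"
proof -
  interpret group_action "sym_group n" "words n k" "word_action n k"
    by (rule word_action_group_action)
  have "invariants (words n k) (word_action n k) g \<noteq> {}" if "g \<in> carrier (sym_group n)" for g
    using const_word_fixed[of g n 1 k] assms that by (auto simp: sym_group_carrier)
  moreover have "finite (carrier (sym_group n))"
    using finite_permutations[of "{1..n}"] by (simp add: sym_group_def)
  moreover have "words n k \<noteq> {}" using const_word_words[of 1 k n] assms by auto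
  ultimately show ?thesis by unfold_locales (auto simp: words_def finite_PiE)
qed

locale word_chain =
  fixes n k :: nat
  assumes k_pos: "1 \<le> k"

sublocale word_chain \<subseteq> finite_burnside "sym_group n" "words n k" "word_action n k"
  using k_pos by (rule finite_burnside_words)

context word_chain
begin

lemma order_sym: "order (sym_group n) = fact n"
  using card_permutations[of "{1..n}" n] by (simp add: order_def sym_group_def)

lemma step_K_eq: "x \<in> words n k \<Longrightarrow> K.step f x = avg (wrd {1..n} k) (kap (1 / real k) k {1..n} x) f"
  using k_pos unfolding K.step_def avg_def words_def[symmetric]
  by (intro sum.cong) (simp_all add: burnside_kernel_word)

lemma dK_from_eq: "dK_from n k = dist_from (words n k) K \<pi>\<^sub>K"
  by (simp add: dK_from_def)

lemma dQ_from_eq: "dQ_from n k = dist_from (carrier (sym_group n)) Q \<pi>\<^sub>Q"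
  by (simp add: dQ_from_def)

lemma dK_le_fact: "dK n k t \<le> (1 - 1 / fact n) ^ t"
  unfolding dK_def using dist_K_le_order[of _ t] by (intro K.dist_worst_le) (simp add: order_sym)

lemma dQ_le_fact: "dQ n k t \<le> (1 - 1 / fact n) ^ t"
  unfolding dQ_def using dist_Q_le_order[of _ t] by (intro Q.dist_worst_le) (simp add: order_sym)

lemma tmix_le_fact:
  assumes "0 < \<epsilon>" "\<epsilon> < (1::real)"
  shows "tmixQ n k \<epsilon> \<le> enat (nat \<lceil>fact n * ln (1 / \<epsilon>)\<rceil>)"
    "tmixK n k \<epsilon> \<le> enat (nat \<lceil>fact n * ln (1 / \<epsilon>)\<rceil>)"
proof -
  let ?N = "nat \<lceil>fact n * ln (1 / \<epsilon>)\<rceil>"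
  have "1 * (1 - 1 / fact n) ^ ?N \<le> \<epsilon>"
    using assms by (intro one_minus_power_le) (auto simp: inverse_eq_divide)
  then show "tmixQ n k \<epsilon> \<le> enat ?N" "tmixK n k \<epsilon> \<le> enat ?N"
    using dQ_le_fact[of ?N] dK_le_fact[of ?N]
    unfolding tmixQ_def tmixK_def mixing_time_def dQ_def dK_def
    by (auto intro!: first_below_le)
qed

end

section \<open>Contraction of the Hamming--Lipschitz constant\<close>

text \<open>
  Two letters inserted in different blocks are conditionally independent given the rest, and their
  predictive laws \<open>p\<close>, \<open>q\<close> satisfy \<open>E (\<Sum>c. p c * q c) = 1 / k\<close>.
\<close>

lemma avg_kap_collision:
  assumes "finite J" "0 < \<alpha>" "1 \<le> k" "x ` J \<subseteq> {1..k}" "a \<noteq> a'"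
  shows "avg (wrd J k) (kap \<alpha> k J x)
      (\<lambda>u. \<Sum>c=1..k. (\<alpha> + real (cnt2 J x u a c)) * (\<alpha> + real (cnt2 J x u a' c)))
    = (real k * \<alpha> + real (cnt J x a)) * (real k * \<alpha> + real (cnt J x a')) / real k"
  using assms(1,4)
proof (induction J)
  case empty
  show ?case using assms(3) by (simp add: avg_def)
next
  case (insert i J)
  let ?n = "\<lambda>J u a c. \<alpha> + real (cnt2 J x u a c)"
  let ?m = "\<lambda>J a. real k * \<alpha> + real (cnt J x a)"
  let ?S = "\<lambda>u. \<Sum>c=1..k. ?n J u a c * ?n J u a' c"
  have m: "0 < ?m J a" for a using assms(2,3) by (intro add_pos_nonneg) auto
  \<comment> \<open>A new letter in block \<open>a\<close> or \<open>a'\<close> multiplies the sum,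
    in conditional mean, by 1 plus the reciprocal of that block's total; any other letter leaves it
    alone. The product of the two totals grows by the same factor, so the quotient keeps its initial
    value \<open>1 / k\<close>.\<close>
  let ?r = "if x i = a then 1 / ?m J a else if x i = a' then 1 / ?m J a' else 0"
  have inner: "(\<Sum>d=1..k. wt \<alpha> k J x u (x i) d *
      (\<Sum>c=1..k. ?n (insert i J) (u(i := d)) a c * ?n (insert i J) (u(i := d)) a' c))
    = (1 + ?r) * ?S u" if u: "u \<in> wrd J k" for u
  proof -
    have row: "(\<Sum>c=1..k. ?n (insert i J) (u(i := d)) a c * ?n (insert i J) (u(i := d)) a' c)
        = ?S u + (if x i = a then ?n J u a' d else if x i = a' then ?n J u a d else 0)"
      if d: "d \<in> {1..k}" for d
    proof -
      have "(\<Sum>c=1..k. ?n (insert i J) (u(i := d)) a c * ?n (insert i J) (u(i := d)) a' c)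
        = (\<Sum>c=1..k. ?n J u a c * ?n J u a' c +
           (if c = d then if x i = a then ?n J u a' d else if x i = a' then ?n J u a d else 0 else 0))"
        using insert.hyps assms(5) by (intro sum.cong) (auto simp: cnt2_insert algebra_simps)
      then show ?thesis using d by (simp add: sum.distrib)
    qed
    have "(\<Sum>d=1..k. wt \<alpha> k J x u (x i) d *
      (\<Sum>c=1..k. ?n (insert i J) (u(i := d)) a c * ?n (insert i J) (u(i := d)) a' c))
      = (\<Sum>d=1..k. wt \<alpha> k J x u (x i) d *
           (?S u + (if x i = a then ?n J u a' d else if x i = a' then ?n J u a d else 0)))"
      by (intro sum.cong refl arg_cong2[where f = "(*)"] row)
    also have "\<dots> = (\<Sum>d=1..k. wt \<alpha> k J x u (x i) d * ?S u) +
        (\<Sum>d=1..k. wt \<alpha> k J x u (x i) d *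
           (if x i = a then ?n J u a' d else if x i = a' then ?n J u a d else 0))"
      by (simp only: sum.distrib distrib_left)
    also have "(\<Sum>d=1..k. wt \<alpha> k J x u (x i) d * ?S u) = ?S u"
      using wt_sum[OF insert.hyps(1) assms(2,3) u] by (simp only: sum_distrib_right[symmetric] mult_1_left)
    also have "(\<Sum>d=1..k. wt \<alpha> k J x u (x i) d *
           (if x i = a then ?n J u a' d else if x i = a' then ?n J u a d else 0)) = ?r * ?S u"
      unfolding wt_def sum_distrib_left using assms(5)
      by (intro sum.cong) (auto simp: mult.commute)
    finally show ?thesis by (simp only: distrib_right mult_1_left)
  qed
  have xi: "x i \<in> {1..k}" using insert.prems by auto
  have "avg (wrd (insert i J) k) (kap \<alpha> k (insert i J) x)
      (\<lambda>u. \<Sum>c=1..k. ?n (insert i J) u a c * ?n (insert i J) u a' c)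
      = avg (wrd J k) (kap \<alpha> k J x) (\<lambda>u. (1 + ?r) * ?S u)"
    unfolding avg_kap_insert[where x = x, OF insert.hyps(1,2) xi] by (intro avg_cong inner)
  also have "\<dots> = (1 + ?r) * (?m J a * ?m J a' / real k)"
    using insert.IH insert.prems by (simp only: avg_scale image_insert insert_subset)
  also have "\<dots> = ?m (insert i J) a * ?m (insert i J) a' / real k"
  proof -
    have arith: "(1 + 1 / A) * (A * B / q) = (1 + A) * B / q" "(1 + 1 / B) * (A * B / q) = A * (1 + B) / q"
      if "0 < A" "0 < B" for A B q :: real
      using that by (simp_all add: distrib_right distrib_left add_divide_distrib)
    have m': "?m (insert i J) b = (if x i = b then 1 + ?m J b else ?m J b)" for b
      using insert.hyps by (simp add: cnt_insert)
    show ?thesis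
      using assms(5) arith[OF m[of a] m[of a'], of "real k"] unfolding m' by (cases "x i = a"; cases "x i = a'") simp_all
  qed
  finally show ?case .
qed

section \<open>Lipschitz functions of words\<close>

definition lip :: "nat \<Rightarrow> nat \<Rightarrow> real \<Rightarrow> ((nat \<Rightarrow> nat) \<Rightarrow> real) \<Rightarrow> bool" where
  "lip n k L f \<longleftrightarrow> (\<forall>w\<in>words n k. \<forall>i\<in>{1..n}. \<forall>c\<in>{1..k}. \<forall>d\<in>{1..k}. f (w(i := c)) - f (w(i := d)) \<le> L)"

lemma words_upd: "w \<in> words n k \<Longrightarrow> i \<in> {1..n} \<Longrightarrow> c \<in> {1..k} \<Longrightarrow> w(i := c) \<in> words n k"
  by (auto simp: words_def PiE_iff extensional_def)

lemma lip_path: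
  assumes "lip n k L f" "x \<in> words n k" "y \<in> words n k" "finite J" "J \<subseteq> {1..n}"
  shows "f (\<lambda>i. if i \<in> J then y i else x i) - f x \<le> real (card J) * L"
  using assms(4,5)
proof (induction J)
  case (insert j J)
  let ?w = "\<lambda>i. if i \<in> J then y i else x i"
  have w: "?w \<in> words n k" using insert assms(2,3) by (auto simp: words_def PiE_iff extensional_def)
  have j: "j \<in> {1..n}" "y j \<in> {1..k}" "x j \<in> {1..k}" using insert.prems assms(2,3) by (auto simp: words_def PiE_iff)
  have "f (?w(j := y j)) - f (?w(j := x j)) \<le> L"
    using assms(1) w j unfolding lip_def by blast
  moreover have "?w(j := x j) = ?w" "?w(j := y j) = (\<lambda>i. if i \<in> insert j J then y i else x i)"
    using insert.hyps by auto
  ultimately show ?case using insert by (simp add: algebra_simps)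
qed simp

lemma lip_osc:
  assumes "lip n k L f" "x \<in> words n k" "y \<in> words n k"
  shows "f y - f x \<le> real n * L"
proof -
  have "(\<lambda>i. if i \<in> {1..n} then y i else x i) = y"
    using assms(2,3) by (auto simp: words_def PiE_iff extensional_def)
  then show ?thesis using lip_path[OF assms, of "{1..n}"] by (simp del: atLeastAtMost_iff)
qed

text \<open>The independent coupling of \<open>p\<close> and \<open>q\<close>: the two values of
  \<open>F\<close> differ by at most \<open>L\<close> off the diagonal and by 0 on it, and the
  diagonal has mass \<open>\<Sum>c\<in>A. p c * q c\<close>.\<close>

lemma coupled_difference_le:
  fixes p q F :: "nat \<Rightarrow> real"
  assumes "\<And>c. c \<in> A \<Longrightarrow> 0 \<le> p c" "\<And>c. c \<in> A \<Longrightarrow> 0 \<le> q c" "sum p A = 1" "sum q A = 1" "finite A"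
    and L: "\<And>c d. c \<in> A \<Longrightarrow> d \<in> A \<Longrightarrow> F c - F d \<le> L"
  shows "(\<Sum>c\<in>A. p c * F c) - (\<Sum>c\<in>A. q c * F c) \<le> L - L * (\<Sum>c\<in>A. p c * q c)"
proof -
  have "(\<Sum>c\<in>A. \<Sum>d\<in>A. p c * q d * F c) = (\<Sum>c\<in>A. p c * F c)"
    using assms(4) by (simp add: sum_distrib_left[symmetric] sum_distrib_right[symmetric])
  moreover have "(\<Sum>c\<in>A. \<Sum>d\<in>A. p c * q d * F d) = (\<Sum>d\<in>A. q d * F d)"
    using assms(3) by (subst sum.swap) (simp add: sum_distrib_right[symmetric] mult.assoc)
  moreover have "(\<Sum>c\<in>A. \<Sum>d\<in>A. p c * q d * F c) - (\<Sum>c\<in>A. \<Sum>d\<in>A. p c * q d * F d)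
      \<le> (\<Sum>c\<in>A. \<Sum>d\<in>A. p c * q d * L - (if c = d then p c * q d * L else 0))"
    unfolding sum_subtractf[symmetric]
  proof (intro sum_mono)
    fix c d assume cd: "c \<in> A" "d \<in> A"
    have "p c * q d * (F c - F d) \<le> p c * q d * L"
      using assms(1,2) cd L by (intro mult_left_mono) auto
    then show "p c * q d * F c - p c * q d * F d \<le> p c * q d * L - (if c = d then p c * q d * L else 0)"
      by (auto simp: algebra_simps)
  qed
  moreover have "(\<Sum>c\<in>A. \<Sum>d\<in>A. p c * q d * L) = L"
    using assms(3,4) by (simp add: sum_distrib_left[symmetric] sum_distrib_right[symmetric])
  moreover have "(\<Sum>c\<in>A. \<Sum>d\<in>A. if c = d then p c * q d * L else 0) = L * (\<Sum>c\<in>A. p c * q c)"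
    using assms(5) by (simp add: sum_distrib_left mult_ac)
  ultimately show ?thesis by (simp add: sum_subtractf)
qed

context word_chain
begin

text \<open>The two words agree outside \<open>i\<close>, so the colours of all other positions have
  the same law and can be taken equal. Given these, \<open>i\<close> draws from the predictive laws
  of the blocks \<open>a\<close> and \<open>a'\<close>, coupled independently; their mean collision
  probability is \<open>1 / k\<close>.\<close>

lemma lip_step:
  assumes "lip n k L f"
  shows "lip n k ((1 - 1 / real k) * L) (K.step f)"
  unfolding lip_def
proof (intro ballI)
  fix w i a a' assume w: "w \<in> words n k" and i: "i \<in> {1..n}" and a: "a \<in> {1..k}" "a' \<in> {1..k}"
  have "f (w(i := 1)) - f (w(i := 1)) \<le> L"
    using assms w i k_pos unfolding lip_def by (metis atLeastAtMost_iff order_refl)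
  then have L: "0 \<le> L" by simp
  define \<alpha> where "\<alpha> = 1 / real k"
  define J where "J = {1..n} - {i}"
  have J: "finite J" "i \<notin> J" "insert i J = {1..n}" using i by (auto simp: J_def)
  have al: "0 < \<alpha>" using k_pos by (simp add: \<alpha>_def)
  have wJ: "w ` J \<subseteq> {1..k}" using w by (auto simp: words_def PiE_iff J_def)
  have K: "K.step f (w(i := b)) = avg (wrd J k) (kap \<alpha> k J w)
      (\<lambda>u. \<Sum>c=1..k. wt \<alpha> k J w u b c * f (u(i := c)))" if b: "b \<in> {1..k}" for b
  proof -
    have "kap \<alpha> k J (w(i := b)) = kap \<alpha> k J w"
      using J(2) by (intro ext kap_cong) auto
    moreover have "cnt2 J (w(i := b)) u = cnt2 J w u" for u by (rule cnt2_cong) (use J(2) in auto)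
    moreover have "cnt J (w(i := b)) = cnt J w" by (rule cnt_cong) (use J(2) in auto)
    ultimately show ?thesis
      using avg_kap_insert[OF J(1,2), of "w(i := b)" k \<alpha> f] b
      unfolding step_K_eq[OF words_upd[OF w i b]] J(3) \<alpha>_def by (simp add: wt_def)
  qed
  show "K.step f (w(i := a)) - K.step f (w(i := a')) \<le> (1 - 1 / real k) * L"
  proof (cases "a = a'")
    case True
    then show ?thesis using L k_pos by simp
  next
    case False
    let ?m = "\<lambda>a. real k * \<alpha> + real (cnt J w a)"
    have m: "0 < ?m a" for a using al k_pos by (intro add_pos_nonneg) auto
    have "K.step f (w(i := a)) - K.step f (w(i := a'))
      \<le> avg (wrd J k) (kap \<alpha> k J w) (\<lambda>u. (- L) * (\<Sum>c=1..k. wt \<alpha> k J w u a c * wt \<alpha> k J w u a' c) + L)"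
      unfolding K[OF a(1)] K[OF a(2)] avg_diff[symmetric]
    proof (rule avg_mono)
      fix u assume u: "u \<in> wrd J k"
      have u1: "u(i := 1) \<in> words n k"
        using u k_pos unfolding words_def J(3)[symmetric] by (auto simp: PiE_iff extensional_def)
      have "f (u(i := c)) - f (u(i := d)) \<le> L" if "c \<in> {1..k}" "d \<in> {1..k}" for c d
        using assms u1 i that unfolding lip_def by (metis fun_upd_upd)
      then show "(\<Sum>c=1..k. wt \<alpha> k J w u a c * f (u(i := c))) - (\<Sum>c=1..k. wt \<alpha> k J w u a' c * f (u(i := c)))
          \<le> (- L) * (\<Sum>c=1..k. wt \<alpha> k J w u a c * wt \<alpha> k J w u a' c) + L"
        using coupled_difference_le[of "{1..k}" "wt \<alpha> k J w u a" "wt \<alpha> k J w u a'" "\<lambda>c. f (u(i := c))" L]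
          wt_nonneg[of \<alpha>] wt_sum[OF J(1) al k_pos u] al by simp
    qed (use al kap_nonneg in auto)
    also have "(\<lambda>u. \<Sum>c=1..k. wt \<alpha> k J w u a c * wt \<alpha> k J w u a' c)
        = (\<lambda>u. 1 / (?m a * ?m a') * (\<Sum>c=1..k. (\<alpha> + real (cnt2 J w u a c)) * (\<alpha> + real (cnt2 J w u a' c))))"
      by (simp add: wt_def sum_divide_distrib)
    then have "avg (wrd J k) (kap \<alpha> k J w) (\<lambda>u. \<Sum>c=1..k. wt \<alpha> k J w u a c * wt \<alpha> k J w u a' c) = 1 / real k"
      using m[of a] m[of a'] by (simp only: avg_scale avg_kap_collision[OF J(1) al k_pos wJ False]) simp
    then have "avg (wrd J k) (kap \<alpha> k J w) (\<lambda>u. (- L) * (\<Sum>c=1..k. wt \<alpha> k J w u a c * wt \<alpha> k J w u a' c) + L)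
        = (1 - 1 / real k) * L"
      by (simp only: avg_affine sum_kap[OF J(1) al k_pos wJ]) (simp add: algebra_simps)
    finally show ?thesis .
  qed
qed

text \<open>Test functions start with constant 1, and two words are joined by at most
  \<open>n\<close> single-letter changes, which is the factor \<open>n\<close>.\<close>

lemma dK_from_le_lip:
  assumes "x \<in> words n k"
  shows "dK_from n k x t \<le> real n * (1 - 1 / real k) ^ t"
  unfolding dK_from_eq
proof (rule K.dist_from_le_osc[OF assms])
  fix f :: "(nat \<Rightarrow> nat) \<Rightarrow> real" and r assume f: "unit_valued (words n k) f" and r: "r \<in> words n k"
  have "lip n k ((1 - 1 / real k) ^ t) ((K.step ^^ t) f)"
  proof (induction t)
    case 0
    have "f y - f z \<le> 1" if "y \<in> words n k" "z \<in> words n k" for y z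
      using f that unfolding unit_valued_def by (smt (verit))
    then show ?case by (simp add: lip_def words_upd del: atLeastAtMost_iff)
  next
    case (Suc t)
    then show ?case using lip_step by simp
  qed
  then show "(K.step ^^ t) f x - (K.step ^^ t) f r \<le> real n * (1 - 1 / real k) ^ t"
    using lip_osc r assms by blast
qed

lemma dQ_Suc_le_lip: "dQ n k (Suc t) \<le> real n * (1 - 1 / real k) ^ t"
  using dK_from_le_lip unfolding dQ_def dK_from_eq
  by (intro Q.dist_worst_le dist_Q_Suc_le) (auto dest: inv_X)

lemma tmixQ_le_lip:
  assumes "1 \<le> n" "0 < \<epsilon>"
  shows "tmixQ n k \<epsilon> \<le> enat (1 + nat \<lceil>real k * ln (real n / \<epsilon>)\<rceil>)"
proof -
  let ?N = "nat \<lceil>real k * ln (real n / \<epsilon>)\<rceil>"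
  have "real n * (1 - 1 / real k) ^ ?N \<le> \<epsilon>"
    using assms k_pos by (intro one_minus_power_le) (auto simp: inverse_eq_divide)
  then have "dQ n k (1 + ?N) \<le> \<epsilon>" using dQ_Suc_le_lip[of ?N] by simp
  then show ?thesis unfolding tmixQ_def mixing_time_def dQ_def by (intro first_below_le)
qed

end

section \<open>Uniform minorization on symmetric functions\<close>

definition comps :: "nat \<Rightarrow> nat \<Rightarrow> (nat \<Rightarrow> nat) set" where
  "comps k m = {q. (\<forall>b. b \<notin> {1..k} \<longrightarrow> q b = 0) \<and> (\<Sum>b=1..k. q b) = m}"

definition bump :: "(nat \<Rightarrow> nat) \<Rightarrow> nat \<Rightarrow> nat \<Rightarrow> nat" where
  "bump q c = q(c := Suc (q c))"

text \<open>The binomial coefficient of \<open>m + k - 1\<close> over \<open>k - 1\<close>, in the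
  form that the recursion of the urn produces.\<close>

definition ncomps :: "nat \<Rightarrow> nat \<Rightarrow> real" where
  "ncomps k m = pochhammer (real k) m / fact m"

section \<open>Compositions and how many there are\<close>

lemma finite_comps: "finite (comps k m)"
proof (rule finite_subset)
  show "comps k m \<subseteq> (\<lambda>g b. if b \<in> {1..k} then g b else 0) ` ({1..k} \<rightarrow>\<^sub>E {..m})"
  proof
    fix q assume q: "q \<in> comps k m"
    have "q b \<le> m" if "b \<in> {1..k}" for b
      using q member_le_sum[of b "{1..k}" q] that by (auto simp: comps_def)
    then have "restrict q {1..k} \<in> {1..k} \<rightarrow>\<^sub>E {..m}" by auto
    moreover have "q = (\<lambda>b. if b \<in> {1..k} then restrict q {1..k} b else 0)"
      using q by (auto simp: comps_def)
    ultimately show "q \<in> (\<lambda>g b. if b \<in> {1..k} then g b else 0) ` ({1..k} \<rightarrow>\<^sub>E {..m})" by blast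
  qed
qed (simp add: finite_PiE)

lemma comps_0: "comps k 0 = {\<lambda>_. 0}"
proof -
  have "q \<in> comps k 0 \<longleftrightarrow> (\<forall>b. q b = 0)" for q
    by (simp only: comps_def mem_Collect_eq sum_eq_0_iff finite_atLeastAtMost) blast
  then show ?thesis by auto
qed

lemma sum_bump: "c \<in> {1..k} \<Longrightarrow> (\<Sum>b=1..k. bump q c b) = Suc (\<Sum>b=1..k. q b)"
proof -
  assume c: "c \<in> {1..k}"
  have "(\<Sum>b=1..k. bump q c b) = (\<Sum>b=1..k. q b + (if b = c then 1 else 0))"
    by (intro sum.cong) (auto simp: bump_def)
  then show ?thesis using c by (simp add: sum.distrib)
qed

lemma bump_comps: "q \<in> comps k m \<Longrightarrow> c \<in> {1..k} \<Longrightarrow> bump q c \<in> comps k (Suc m)"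
  using sum_bump[of c k q] by (auto simp: comps_def bump_def)

lemma unbump:
  assumes "q \<in> comps k (Suc m)" "0 < q c"
  shows "c \<in> {1..k}" "q(c := q c - 1) \<in> comps k m" "bump (q(c := q c - 1)) c = q"
proof -
  show c: "c \<in> {1..k}" using assms by (auto simp: comps_def)
  show b: "bump (q(c := q c - 1)) c = q" using assms(2) by (auto simp: bump_def)
  show "q(c := q c - 1) \<in> comps k m"
    using sum_bump[OF c, of "q(c := q c - 1)"] c assms(1) unfolding b by (auto simp: comps_def)
qed

text \<open>Double counting of compositions of \<open>m + 1\<close> with a marked nonempty part: the
  weight \<open>1 + q c\<close> is the new size of part \<open>c\<close>, and the sizes add up to
  \<open>m + 1\<close>. Hence an urn step with weights 1 carries the uniform law on compositions to
  the uniform law.\<close>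

lemma sum_comps_bump:
  fixes G :: "(nat \<Rightarrow> nat) \<Rightarrow> real"
  shows "(\<Sum>q\<in>comps k m. \<Sum>c=1..k. (1 + real (q c)) * G (bump q c))
    = real (Suc m) * (\<Sum>q\<in>comps k (Suc m). G q)"
proof -
  have "(\<Sum>q\<in>comps k m. \<Sum>c=1..k. (1 + real (q c)) * G (bump q c))
      = (\<Sum>(q, c)\<in>comps k m \<times> {1..k}. real (bump q c c) * G (bump q c))"
    by (simp add: sum.cartesian_product bump_def)
  also have "\<dots> = (\<Sum>(q, c)\<in>(SIGMA q:comps k (Suc m). {c. 0 < q c}). real (q c) * G q)"
    by (rule sum.reindex_bij_witness[where i = "\<lambda>(q, c). (q(c := q c - 1), c)" and j = "\<lambda>(q, c). (bump q c, c)"])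
      (auto simp: bump_comps unbump simp del: atLeastAtMost_iff fun_upd_apply One_nat_def, auto simp: bump_def)
  also have "\<dots> = (\<Sum>q\<in>comps k (Suc m). \<Sum>c | 0 < q c. real (q c) * G q)"
  proof (rule sum.Sigma[symmetric])
    show "\<forall>q\<in>comps k (Suc m). finite {c. 0 < q c}"
      by (auto intro!: finite_subset[of _ "{1..k}"] unbump(1) simp del: atLeastAtMost_iff)
  qed (rule finite_comps)
  also have "\<dots> = (\<Sum>q\<in>comps k (Suc m). real (Suc m) * G q)"
  proof (rule sum.cong[OF refl])
    fix q assume q: "q \<in> comps k (Suc m)"
    have "(\<Sum>c | 0 < q c. real (q c)) = (\<Sum>c=1..k. real (q c))"
      using unbump(1)[OF q] by (intro sum.mono_neutral_left) auto
    also have "\<dots> = real (Suc m)" using q by (auto simp: comps_def simp flip: of_nat_sum)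
    finally show "(\<Sum>c | 0 < q c. real (q c) * G q) = real (Suc m) * G q"
      by (simp only: sum_distrib_right[symmetric])
  qed
  finally show ?thesis by (simp only: sum_distrib_left)
qed

lemma ncomps_Suc: "1 \<le> k \<Longrightarrow> real (Suc m) / ((real k + real m) * ncomps k m) = 1 / ncomps k (Suc m)"
  by (simp add: ncomps_def pochhammer_Suc field_simps)

lemma ncomps_pos: "1 \<le> k \<Longrightarrow> 0 < ncomps k m"
  by (simp add: ncomps_def pochhammer_pos)

lemma ncomps_Suc_left: "1 \<le> k \<Longrightarrow> ncomps (Suc k) m = ncomps k m * ((real k + real m) / real k)"
  using pochhammer_rec[of "real k" m] pochhammer_rec'[of "real k" m]
  by (simp add: ncomps_def field_simps)

lemma ncomps_1: "ncomps (Suc 0) m = 1"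
  by (simp add: ncomps_def flip: pochhammer_fact)

text \<open>A polynomial of degree \<open>k - 1\<close> in \<open>m\<close>. The two bounds match up
  to a factor depending on \<open>k\<close> alone, which is what makes (c) uniform in
  \<open>n\<close>.\<close>

lemma ncomps_bounds:
  assumes "1 \<le> k"
  shows "(real m + 1) ^ (k - 1) / fact (k - 1) \<le> ncomps k m" "ncomps k m \<le> (real m + 1) ^ (k - 1)"
proof -
  have "(real m + 1) ^ j / fact j \<le> ncomps (Suc j) m \<and> ncomps (Suc j) m \<le> (real m + 1) ^ j" for j
  proof (induction j)
    case (Suc j)
    have le: "real (Suc j) + real m \<le> real (Suc j) * (real m + 1)" by (simp add: algebra_simps)
    have "(real m + 1) ^ j / fact j * ((real m + 1) / real (Suc j))
        \<le> ncomps (Suc j) m * ((real (Suc j) + real m) / real (Suc j))"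
      using Suc ncomps_pos[of "Suc j" m] by (intro mult_mono divide_right_mono) auto
    moreover have "ncomps (Suc j) m * ((real (Suc j) + real m) / real (Suc j))
        \<le> (real m + 1) ^ j * (real m + 1)"
      using Suc le ncomps_pos[of "Suc j" m] by (intro mult_mono) (auto simp: field_simps)
    ultimately show ?case by (simp add: ncomps_Suc_left field_simps)
  qed (simp add: ncomps_1)
  from this[of "k - 1"] show "(real m + 1) ^ (k - 1) / fact (k - 1) \<le> ncomps k m" "ncomps k m \<le> (real m + 1) ^ (k - 1)"
    using assms by auto
qed

lemma cnt_comps:
  assumes "finite A" "y ` A \<subseteq> {1..k}"
  shows "cnt A y \<in> comps k (card A)"
proof -
  have "cnt A y b = 0" if "b \<notin> {1..k}" for b
    using assms that by (auto simp: cnt_def)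
  moreover have "(\<Sum>b=1..k. cnt A y b) = card A" using assms by (intro cnt_sum) auto
  ultimately show ?thesis by (auto simp: comps_def)
qed

text \<open>For \<open>\<alpha> = 1\<close> the letter counts of a block are uniform on the compositions of its length,
  independently of the other blocks.\<close>

lemma avg_block:
  assumes "finite A" "finite R" "A \<inter> R = {}" "1 \<le> k" "x ` (A \<union> R) \<subseteq> {1..k}"
    and a: "\<And>i. i \<in> A \<Longrightarrow> x i = a" "\<And>i. i \<in> R \<Longrightarrow> x i \<noteq> a"
    and \<Psi>: "\<And>y y' q. (\<And>i. i \<in> R \<Longrightarrow> y i = y' i) \<Longrightarrow> \<Psi> y q = \<Psi> y' q"
  shows "avg (wrd (A \<union> R) k) (kap 1 k (A \<union> R) x) (\<lambda>y. \<Psi> y (cnt A y))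
    = avg (wrd R k) (kap 1 k R x) (\<lambda>u. (\<Sum>q\<in>comps k (card A). \<Psi> u q) / ncomps k (card A))"
  using assms(1,3,5) a(1) \<Psi>
proof (induction A arbitrary: \<Psi>)
  case empty
  have "cnt {} y = (\<lambda>_. 0)" for y :: "nat \<Rightarrow> nat" by auto
  then show ?case by (simp add: comps_0 ncomps_def)
next
  case (insert i A)
  let ?m = "card A"
  have i: "i \<notin> A \<union> R" "x i = a" "x i \<in> {1..k}"
    using insert.hyps(2) insert.prems(1-3) by (blast, simp, force)
  have A: "x j = a \<longleftrightarrow> j \<in> A" if "j \<in> A \<union> R" for j
    using that insert.prems(3) a(2) by auto
  have "{j \<in> A \<union> R. x j = a} = A" using A by blast
  then have cntx: "cnt (A \<union> R) x a = ?m" by (simp only: cnt_def)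
  have "{j \<in> A \<union> R. (x j, u j) = (a, b)} = {j \<in> A. u j = b}" for u :: "nat \<Rightarrow> nat" and b
    using A by blast
  then have cnt2: "cnt2 (A \<union> R) x u a = cnt A u" for u
    by (intro ext) (simp only: cnt_def cnt2_def)
  have bump: "cnt (insert i A) (u(i := c)) = bump (cnt A u) c" for u c
    using insert.hyps by (auto simp: cnt_insert bump_def)
  have upd: "\<Psi> (u(i := c)) q = \<Psi> u q" for u c q
    using i by (intro insert.prems(4)) auto
  \<comment> \<open>The mean of \<Psi> over the colour of \<open>i\<close>, given the rest. It again
    depends on \<open>A\<close> only through its counts, so the induction hypothesis applies to
    it.\<close>
  let ?\<Psi>' = "\<lambda>u q. \<Sum>c=1..k. (1 + real (q c)) * (\<Psi> u (bump q c) / (real k + real ?m))"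
  have "avg (wrd (insert i A \<union> R) k) (kap 1 k (insert i A \<union> R) x) (\<lambda>y. \<Psi> y (cnt (insert i A) y))
    = avg (wrd (A \<union> R) k) (kap 1 k (A \<union> R) x) (\<lambda>u. ?\<Psi>' u (cnt A u))"
  proof -
    have fin: "finite (A \<union> R)" using insert.hyps assms(2) by simp
    have "wt 1 k (A \<union> R) x u (x i) c * \<Psi> (u(i := c)) (cnt (insert i A) (u(i := c)))
        = (1 + real (cnt A u c)) * (\<Psi> u (bump (cnt A u) c) / (real k + real ?m))" for u c
      by (simp only: wt_def i(2) cntx cnt2 bump upd) simp
    then show ?thesis
      unfolding Un_insert_left avg_kap_insert[where x = x, OF fin i(1) i(3)] by (simp only:)
  qed
  also have "\<dots> = avg (wrd R k) (kap 1 k R x) (\<lambda>u. (\<Sum>q\<in>comps k ?m. ?\<Psi>' u q) / ncomps k ?m)"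
  proof (rule insert.IH)
    show "?\<Psi>' y q = ?\<Psi>' y' q" if "\<And>i. i \<in> R \<Longrightarrow> y i = y' i" for y y' q
      using insert.prems(4)[of y y'] that by (simp only:)
  qed (use insert.prems(1-3) in auto)
  also have "(\<lambda>u. (\<Sum>q\<in>comps k ?m. ?\<Psi>' u q) / ncomps k ?m)
      = (\<lambda>u. (\<Sum>q\<in>comps k (Suc ?m). \<Psi> u q) / ncomps k (Suc ?m))"
  proof
    fix u
    have "(\<Sum>q\<in>comps k ?m. ?\<Psi>' u q)
        = real (Suc ?m) * (\<Sum>q\<in>comps k (Suc ?m). \<Psi> u q / (real k + real ?m))"
      by (rule sum_comps_bump)
    then have "(\<Sum>q\<in>comps k ?m. ?\<Psi>' u q) / ncomps k ?m
        = (\<Sum>q\<in>comps k (Suc ?m). \<Psi> u q) * (real (Suc ?m) / ((real k + real ?m) * ncomps k ?m))"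
      unfolding sum_divide_distrib[symmetric] by (simp add: mult.commute del: of_nat_Suc)
    then show "(\<Sum>q\<in>comps k ?m. ?\<Psi>' u q) / ncomps k ?m = (\<Sum>q\<in>comps k (Suc ?m). \<Psi> u q) / ncomps k (Suc ?m)"
      unfolding ncomps_Suc[OF assms(4)] by simp
  qed
  finally show ?case using insert.hyps by simp
qed

text \<open>Parts \<open>2..k\<close> are chosen freely in the box and part 1 takes the remainder,
  which is nonnegative because \<open>(k - 1) * hi \<le> m\<close>.\<close>

lemma card_comps_box:
  assumes "1 \<le> k" "(k - 1) * hi \<le> m" "lo \<le> hi"
  shows "real (hi - lo + 1) ^ (k - 1) \<le> real (card {q\<in>comps k m. \<forall>b\<in>{2..k}. lo \<le> q b \<and> q b \<le> hi})"
proof -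
  let ?h = "\<lambda>g b. if b \<in> {2..k} then g b else if b = 1 then m - (\<Sum>b=2..k. g b) else (0::nat)"
  let ?D = "{2..k} \<rightarrow>\<^sub>E {lo..hi}"
  let ?B = "{q\<in>comps k m. \<forall>b\<in>{2..k}. lo \<le> q b \<and> q b \<le> hi}"
  have "inj_on ?h ?D"
  proof (rule inj_onI)
    fix g g' assume g: "g \<in> ?D" "g' \<in> ?D" "?h g = ?h g'"
    show "g = g'"
    proof (rule PiE_ext[OF g(1,2)])
      fix b assume "b \<in> {2..k}"
      then show "g b = g' b" using fun_cong[OF g(3), of b] by simp
    qed
  qed
  moreover have "?h ` ?D \<subseteq> ?B"
  proof (rule image_subsetI)
    fix g assume g: "g \<in> ?D"
    have "(\<Sum>b=2..k. g b) \<le> (\<Sum>b=2..k. hi)" using g by (intro sum_mono) auto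
    also have "\<dots> \<le> m" using assms(2) by simp
    finally have le: "(\<Sum>b=2..k. g b) \<le> m" .
    have k: "{1..k} = insert 1 {2..k}" using assms(1) by auto
    have "(\<Sum>b=1..k. ?h g b) = ?h g 1 + (\<Sum>b=2..k. ?h g b)" unfolding k by (subst sum.insert) auto
    also have "(\<Sum>b=2..k. ?h g b) = (\<Sum>b=2..k. g b)" by (intro sum.cong) auto
    also have "?h g 1 = m - (\<Sum>b=2..k. g b)" by simp
    finally have "(\<Sum>b=1..k. ?h g b) = m" using le by linarith
    then show "?h g \<in> ?B" using g assms(1) by (auto simp: comps_def PiE_iff)
  qed
  moreover have "card ?D = (hi - lo + 1) ^ (k - 1)" using assms(3) by (simp add: card_PiE Suc_diff_le)
  ultimately have "(hi - lo + 1) ^ (k - 1) \<le> card ?B"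
    using card_inj_on_le[of ?h ?D ?B] finite_comps by simp
  then have "real ((hi - lo + 1) ^ (k - 1)) \<le> real (card ?B)" by (simp only: of_nat_le_iff)
  then show ?thesis by (simp only: of_nat_power)
qed

lemma cnt_Un:
  assumes "finite A" "finite R" "A \<inter> R = {}"
  shows "cnt (A \<union> R) y b = cnt A y b + cnt R y b"
proof -
  have "{i \<in> A \<union> R. y i = b} = {i \<in> A. y i = b} \<union> {i \<in> R. y i = b}" by auto
  then show ?thesis using assms by (auto simp: cnt_def intro!: card_Un_disjoint)
qed

text \<open>With probability bounded below, each block of \<open>x\<close> is recoloured almost entirely with
  colour \<open>1\<close>.\<close>

lemma near_constant:
  assumes "finite B" "B \<subseteq> {1..k}" "finite I" "x ` I \<subseteq> {1..k}" "1 \<le> k" "k \<le> M"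
  shows "((1 / real M) ^ (k - 1)) ^ card B
    \<le> avg (wrd {i\<in>I. x i \<in> B} k) (kap 1 k {i\<in>I. x i \<in> B} x)
        (\<lambda>u. of_bool (\<forall>b\<in>{2..k}. M * cnt {i\<in>I. x i \<in> B} u b \<le> card {i\<in>I. x i \<in> B}))"
  using assms(1,2)
proof (induction B)
  case empty
  show ?case by (simp add: avg_def)
next
  case (insert a B)
  let ?p = "(1 / real M) ^ (k - 1)"
  define R where "R = {i\<in>I. x i \<in> B}"
  define A where "A = {i\<in>I. x i = a}"
  let ?near = "\<lambda>R u. \<forall>b\<in>{2..k}. M * cnt R u b \<le> card R"
  have AR: "{i\<in>I. x i \<in> insert a B} = A \<union> R" "finite A" "finite R" "A \<inter> R = {}"
    "\<And>i. i \<in> A \<Longrightarrow> x i = a" "\<And>i. i \<in> R \<Longrightarrow> x i \<noteq> a" "x ` (A \<union> R) \<subseteq> {1..k}"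
    using insert.hyps assms(3,4) by (auto simp: A_def R_def)
  have M: "0 < M" using assms by simp
  let ?m = "card A"
  let ?C = "{q\<in>comps k ?m. \<forall>b\<in>{2..k}. M * q b \<le> ?m}"
  \<comment> \<open>For one block of size m: parts \<open>2..k\<close> may each take any of the
    \<open>m div M + 1\<close> values up to \<open>m div M\<close>, there are at most
    \<open>(m + 1) ^ (k - 1)\<close> compositions in all, and
    \<open>m + 1 \<le> M * (m div M + 1)\<close>.\<close>
  have p: "?p \<le> real (card ?C) / ncomps k ?m"
  proof -
    have "real ?m + 1 \<le> real M * real (?m div M + 1)"
    proof -
      have "?m + 1 \<le> M * (?m div M + 1)"
        using mult_div_mod_eq[of M ?m] mod_less_divisor[OF M, of ?m] unfolding distrib_left by linarith
      then show ?thesis by (metis of_nat_1 of_nat_add of_nat_le_iff of_nat_mult)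
    qed
    then have "(1 / real M) * (real ?m + 1) \<le> real (?m div M + 1)" using M by (simp add: field_simps)
    then have "((1 / real M) * (real ?m + 1)) ^ (k - 1) \<le> real (?m div M + 1) ^ (k - 1)"
      by (intro power_mono) auto
    also have "\<dots> \<le> real (card {q\<in>comps k ?m. \<forall>b\<in>{2..k}. 0 \<le> q b \<and> q b \<le> ?m div M})"
    proof -
      have "(k - 1) * (?m div M) \<le> M * (?m div M)" using assms(6) by (intro mult_right_mono) auto
      also have "\<dots> \<le> ?m" by simp
      finally show ?thesis using card_comps_box[of k "?m div M" ?m 0] assms(5) by simp
    qed
    also have "{q\<in>comps k ?m. \<forall>b\<in>{2..k}. 0 \<le> q b \<and> q b \<le> ?m div M} = ?C"
      using M by (simp add: less_eq_div_iff_mult_less_eq mult.commute)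
    finally have le: "?p * (real ?m + 1) ^ (k - 1) \<le> real (card ?C)" by (simp only: power_mult_distrib)
    have "?p * ncomps k ?m \<le> ?p * (real ?m + 1) ^ (k - 1)"
      using ncomps_bounds(2)[OF assms(5)] by (intro mult_left_mono) auto
    then show ?thesis using le ncomps_pos[OF assms(5), of ?m] by (simp add: pos_le_divide_eq)
  qed
  let ?\<Psi> = "\<lambda>y q. of_bool (?near R y) * of_bool (\<forall>b\<in>{2..k}. M * q b \<le> ?m) :: real"
  have "?p ^ card (insert a B) = ?p * ?p ^ card B" using insert.hyps by simp
  also have "\<dots> \<le> ?p * avg (wrd R k) (kap 1 k R x) (\<lambda>u. of_bool (?near R u))"
    using insert unfolding R_def by (intro mult_left_mono) auto
  also have "\<dots> = avg (wrd R k) (kap 1 k R x) (\<lambda>u. ?p * of_bool (?near R u))"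
    by (simp only: avg_scale)
  also have "\<dots> \<le> avg (wrd R k) (kap 1 k R x) (\<lambda>u. (\<Sum>q\<in>comps k ?m. ?\<Psi> u q) / ncomps k ?m)"
  proof (rule avg_mono)
    fix u
    have "(\<Sum>q\<in>comps k ?m. ?\<Psi> u q) = of_bool (?near R u) * real (card ?C)"
      unfolding sum_distrib_left[symmetric] using finite_comps by (simp add: Int_def)
    then show "?p * of_bool (?near R u) \<le> (\<Sum>q\<in>comps k ?m. ?\<Psi> u q) / ncomps k ?m"
      using p by simp
  qed (simp add: kap_nonneg)
  also have "\<dots> = avg (wrd (A \<union> R) k) (kap 1 k (A \<union> R) x) (\<lambda>y. ?\<Psi> y (cnt A y))"
  proof (rule avg_block[where \<Psi> = ?\<Psi> and a = a, symmetric])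
    fix y y' :: "nat \<Rightarrow> nat" and q assume "\<And>i. i \<in> R \<Longrightarrow> y i = y' i"
    then have "cnt R y = cnt R y'" by (rule cnt_cong)
    then show "?\<Psi> y q = ?\<Psi> y' q" by (simp only:)
  qed (fact AR assms(5))+
  also have "\<dots> \<le> avg (wrd (A \<union> R) k) (kap 1 k (A \<union> R) x) (\<lambda>u. of_bool (?near (A \<union> R) u))"
  proof (rule avg_mono)
    fix y
    have "?near (A \<union> R) y" if "?near R y" "\<forall>b\<in>{2..k}. M * cnt A y b \<le> ?m"
      using that AR(2-4) by (auto simp: cnt_Un card_Un_disjoint distrib_left intro: add_mono)
    then show "?\<Psi> y (cnt A y) \<le> of_bool (?near (A \<union> R) y)" by auto
  qed (simp add: kap_nonneg)
  finally show ?case unfolding AR(1) .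
qed

text \<open>Comparison of the Burnside kernel with the kernel for \<open>\<alpha> = 1\<close>: the weights
  \<open>poch \<alpha> m / m!\<close> decay like \<open>m ^ (\<alpha> - 1)\<close>, so the loss is bounded independently of the block sizes.\<close>

definition pw :: "real \<Rightarrow> nat \<Rightarrow> real" where
  "pw \<alpha> m = pochhammer \<alpha> m / fact m"

lemma pw_0 [simp]: "pw \<alpha> 0 = 1"
  by (simp add: pw_def)

lemma pw_Suc: "pw \<alpha> (Suc m) = pw \<alpha> m * ((\<alpha> + real m) / (real m + 1))"
  by (simp add: pw_def pochhammer_Suc field_simps)

lemma pw_pos: "0 < \<alpha> \<Longrightarrow> 0 < pw \<alpha> m"
  by (simp add: pw_def pochhammer_pos)

lemma pw_antimono:
  assumes "0 < \<alpha>" "\<alpha> \<le> 1" "i \<le> m"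
  shows "pw \<alpha> m \<le> pw \<alpha> i"
  using assms(3)
proof (induction rule: dec_induct)
  case (step j)
  have "pw \<alpha> j * ((\<alpha> + real j) / (real j + 1)) \<le> pw \<alpha> j * 1"
    using assms pw_pos[of \<alpha> j] by (intro mult_left_mono) auto
  then show ?case using step by (simp add: pw_Suc)
qed simp

text \<open>The \<open>k\<close>-th power of
  \<open>pw (1 / k) m \<ge> (1 / k) * (m + 1) powr (1 / k - 1)\<close>, a form without fractional
  exponents. The inductive step is Bernoulli's inequality
  \<open>1 + 1 / s \<le> (1 + 1 / (k * s)) ^ k\<close>.\<close>

lemma pw_lower:
  assumes "1 \<le> k"
  shows "(1 / real k) ^ k \<le> pw (1 / real k) m ^ k * (real m + 1) ^ (k - 1)"
proof -
  let ?a = "1 / real k"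
  have a: "0 < ?a" using assms by simp
  \<comment> \<open>Shifted by one: at \<open>pw ?a 1 = 1 / k\<close> the induction starts with
    equality.\<close>
  have "?a ^ k \<le> pw ?a (Suc j) ^ k * (real j + 1) ^ (k - 1)" for j
  proof (induction j)
    case 0
    show ?case by (simp add: pw_Suc)
  next
    case (Suc j)
    let ?s = "real j + 1"
    have s: "0 < ?s" by simp
    have "1 + 1 / ?s \<le> (1 + ?a / ?s) ^ k"
    proof -
      have "1 + 1 / ?s = 1 + real k * (?a / ?s)" using assms by simp
      also have "\<dots> \<le> (1 + ?a / ?s) ^ k"
      proof (rule Bernoulli_inequality)
        have "0 \<le> ?a / ?s" by simp
        then show "- 1 \<le> ?a / ?s" by linarith
      qed
      finally show ?thesis .
    qed
    then have "(1 + 1 / ?s) * ?s ^ k \<le> ((1 + ?a / ?s) * ?s) ^ k"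
      unfolding power_mult_distrib by (intro mult_right_mono) auto
    moreover have "(1 + ?a / ?s) * ?s = ?a + ?s" using s by (simp add: distrib_right)
    moreover have "(1 + 1 / ?s) * ?s ^ k = (?s + 1) * ?s ^ (k - 1)"
    proof -
      have "(1 + 1 / s) * s ^ k = (s + 1) * s ^ (k - 1)" if "0 < s" for s :: real
      proof -
        have "(1 + 1 / s) * s ^ k = ((1 + 1 / s) * s) * s ^ (k - 1)" using assms by (cases k) simp_all
        then show ?thesis using that by (simp add: distrib_right)
      qed
      then show ?thesis using s by blast
    qed
    ultimately have key: "(?s + 1) * ?s ^ (k - 1) \<le> (?a + ?s) ^ k" by simp
    have "?a ^ k \<le> pw ?a (Suc j) ^ k * ?s ^ (k - 1)" using Suc by simp
    also have "\<dots> = pw ?a (Suc j) ^ k * ((?s + 1) * ?s ^ (k - 1)) / (?s + 1)" using s by simp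
    also have "\<dots> \<le> pw ?a (Suc j) ^ k * (?a + ?s) ^ k / (?s + 1)"
      using key pw_pos[OF a, of "Suc j"] by (intro divide_right_mono mult_left_mono) auto
    also have "\<dots> = (pw ?a (Suc j) * (?a + ?s) / (?s + 1)) ^ k * (?s + 1) ^ k / (?s + 1)"
      using s by (simp add: power_mult_distrib power_divide)
    also have "\<dots> = pw ?a (Suc (Suc j)) ^ k * (?s + 1) ^ (k - 1)"
      using assms s by (cases k) (simp_all add: pw_Suc[of _ "Suc j"] add_ac)
    finally show ?case by (simp add: add_ac)
  qed
  note S = this
  show ?thesis
  proof (cases m)
    case 0
    then show ?thesis using assms by (simp add: power_le_one)
  next
    case (Suc j)
    have "pw ?a (Suc j) ^ k * (real j + 1) ^ (k - 1) \<le> pw ?a (Suc j) ^ k * (real m + 1) ^ (k - 1)"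
      using pw_pos[OF a, of "Suc j"] Suc by (intro mult_left_mono power_mono) auto
    then show ?thesis using S[of j] unfolding Suc by linarith
  qed
qed

text \<open>One block of \<open>m\<close> letters. Each part has a weight \<open>pw\<close> at least
  that of \<open>m\<close>, so the product is at least of order \<open>(m + 1) ^ (1 - k)\<close> in
  real exponents; the number of compositions, which normalizes the case \<alpha> = 1, is at least of
  order \<open>(m + 1) ^ (k - 1)\<close>, and the powers cancel.\<close>

lemma row_compare:
  assumes "1 \<le> k" "\<And>b. b \<in> {1..k} \<Longrightarrow> N b \<le> m"
  shows "(1 / real k) ^ k / fact (k - 1) * ((\<Prod>b=1..k. pochhammer 1 (N b)) / pochhammer (real k * 1) m)
    \<le> (\<Prod>b=1..k. pochhammer (1 / real k) (N b)) / pochhammer (real k * (1 / real k)) m"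
proof -
  let ?a = "1 / real k" and ?F = "\<Prod>b=1..k. fact (N b) :: real"
  have a: "0 < ?a" "?a \<le> 1" using assms(1) by auto
  have F: "0 < ?F" by (intro prod_pos) auto
  have m: "0 < (real m + 1) ^ (k - 1)" by simp
  have "pw ?a m ^ k = (\<Prod>b=1..k. pw ?a m)" by simp
  also have "\<dots> \<le> (\<Prod>b=1..k. pw ?a (N b))"
    using assms(2) a pw_pos[OF a(1)] by (intro prod_mono) (auto intro: pw_antimono less_imp_le)
  finally have "?a ^ k \<le> (\<Prod>b=1..k. pw ?a (N b)) * (real m + 1) ^ (k - 1)"
    using pw_lower[OF assms(1), of m] m by (smt (verit) mult_right_mono)
  then have 1: "?a ^ k / (real m + 1) ^ (k - 1) \<le> (\<Prod>b=1..k. pw ?a (N b))"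
    using m by (simp add: pos_divide_le_eq)
  have 2: "(real m + 1) ^ (k - 1) / fact (k - 1) * fact m \<le> pochhammer (real k) m"
    using ncomps_bounds(1)[OF assms(1), of m] by (simp add: ncomps_def field_simps)
  have "?a ^ k / fact (k - 1) * (?F / pochhammer (real k) m)
      \<le> ?a ^ k / fact (k - 1) * (?F / ((real m + 1) ^ (k - 1) / fact (k - 1) * fact m))"
    using F 2 m a pochhammer_pos[of "real k" m] assms(1)
    by (intro mult_left_mono divide_left_mono) (auto intro!: mult_pos_pos divide_pos_pos)
  also have "\<dots> = ?a ^ k / (real m + 1) ^ (k - 1) * ?F / fact m" using m by (simp add: field_simps)
  also have "\<dots> \<le> (\<Prod>b=1..k. pw ?a (N b)) * ?F / fact m"
    using 1 F by (intro divide_right_mono mult_right_mono) auto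
  also have "(\<Prod>b=1..k. pw ?a (N b)) * ?F = (\<Prod>b=1..k. pochhammer ?a (N b))"
    unfolding prod.distrib[symmetric] by (simp add: pw_def)
  finally show ?thesis using assms(1) by (simp add: pochhammer_fact[symmetric])
qed

lemma kap_compare:
  assumes "1 \<le> k" "finite I" "y ` I \<subseteq> {1..k}"
  shows "((1 / real k) ^ k / fact (k - 1)) ^ k * kap 1 k I x y \<le> kap (1 / real k) k I x y"
proof -
  let ?c = "(1 / real k) ^ k / fact (k - 1)"
  have "?c ^ k * kap 1 k I x y = (\<Prod>a=1..k. ?c * ((\<Prod>b=1..k. pochhammer 1 (cnt2 I x y a b)) / pochhammer (real k * 1) (cnt I x a)))"
    unfolding kap_def prod.distrib by simp
  also have "\<dots> \<le> kap (1 / real k) k I x y"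
    unfolding kap_def
  proof (intro prod_mono conjI)
    fix a
    have "cnt2 I x y a b \<le> cnt I x a" for b
      unfolding cnt_def cnt2_def using assms(2) by (intro card_mono) auto
    then show "?c * ((\<Prod>b=1..k. pochhammer 1 (cnt2 I x y a b)) / pochhammer (real k * 1) (cnt I x a))
      \<le> (\<Prod>b=1..k. pochhammer (1 / real k) (cnt2 I x y a b)) / pochhammer (real k * (1 / real k)) (cnt I x a)"
      by (intro row_compare assms(1))
  qed (auto intro!: mult_nonneg_nonneg divide_nonneg_nonneg prod_nonneg pochhammer_ge_0)
  finally show ?thesis .
qed

lemma ex_word:
  assumes "q \<in> comps k n"
  shows "\<exists>w\<in>words n k. cnt {1..n} w = q"
  using assms
proof (induction n arbitrary: q)
  case 0
  then show ?case by (auto simp: comps_0 words_def fun_eq_iff)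
next
  case (Suc m)
  have "(\<Sum>b=1..k. q b) = Suc m" using Suc.prems by (simp add: comps_def)
  then obtain c where c: "0 < q c" by (metis gr0I nat.distinct(1) sum.neutral)
  obtain w where w: "w \<in> words m k" "cnt {1..m} w = q(c := q c - 1)"
    using Suc.IH[OF unbump(2)[OF Suc.prems c]] by blast
  have I: "{1..Suc m} = insert (Suc m) {1..m}" by auto
  have "cnt {1..Suc m} (w(Suc m := c)) = q"
    unfolding I using w(2) c by (intro ext) (auto simp: cnt_insert)
  moreover have "w(Suc m := c) \<in> words (Suc m) k"
    using w(1) unbump(1)[OF Suc.prems c] unfolding words_def I by (auto simp: PiE_iff extensional_def)
  ultimately show ?case by blast
qed

section \<open>Functions invariant under permuting positions\<close>

lemma count_image_mset_set: "finite I \<Longrightarrow> count (image_mset z (mset_set I)) a = cnt I z a"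
  by (induction I rule: finite_induct) (simp_all add: cnt_insert)

lemma cnt_permute: "g permutes I \<Longrightarrow> cnt I (\<lambda>i. z (g i)) a = cnt I z a"
  unfolding cnt_def
proof (rule bij_betw_same_card[of g])
  assume g: "g permutes I"
  show "bij_betw g {i \<in> I. z (g i) = a} {i \<in> I. z i = a}"
    by (rule bij_betw_byWitness[where f' = "Hilbert_Choice.inv g"])
      (auto simp: permutes_inverses[OF g] permutes_in_image[OF g] permutes_in_image[OF permutes_inv[OF g]])
qed

definition sym_fun :: "nat \<Rightarrow> nat \<Rightarrow> ((nat \<Rightarrow> nat) \<Rightarrow> real) \<Rightarrow> bool" where
  "sym_fun n k f \<longleftrightarrow> (\<forall>g w. g permutes {1..n} \<longrightarrow> w \<in> words n k \<longrightarrow> f (word_action n k g w) = f w)"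

lemma word_action_apply:
  "x \<in> words n k \<Longrightarrow> i \<in> {1..n} \<Longrightarrow> word_action n k g x i = x (Hilbert_Choice.inv g i)"
  by (simp add: word_action_def)

lemma cnt2_action:
  assumes "g permutes {1..n}" "x \<in> words n k" "y \<in> words n k"
  shows "cnt2 {1..n} (word_action n k g x) (word_action n k g y) a b = cnt2 {1..n} x y a b"
proof -
  have "cnt2 {1..n} (word_action n k g x) (word_action n k g y) a b
      = cnt {1..n} (\<lambda>i. (\<lambda>j. (x j, y j)) (Hilbert_Choice.inv g i)) (a, b)"
    unfolding cnt2_def using assms by (intro fun_cong[OF cnt_cong]) (simp add: word_action_apply del: atLeastAtMost_iff)
  also have "\<dots> = cnt2 {1..n} x y a b"
    unfolding cnt2_def by (rule cnt_permute[OF permutes_inv[OF assms(1)]])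
  finally show ?thesis .
qed

lemma cnt_action:
  assumes "g permutes {1..n}" "x \<in> words n k"
  shows "cnt {1..n} (word_action n k g x) a = cnt {1..n} x a"
proof -
  have "cnt {1..n} (word_action n k g x) a = cnt {1..n} (\<lambda>i. x (Hilbert_Choice.inv g i)) a"
    using assms by (intro fun_cong[OF cnt_cong]) (simp add: word_action_apply del: atLeastAtMost_iff)
  also have "\<dots> = cnt {1..n} x a"
    by (rule cnt_permute[OF permutes_inv[OF assms(1)]])
  finally show ?thesis .
qed

lemma kap_action:
  assumes "g permutes {1..n}" "x \<in> words n k" "y \<in> words n k"
  shows "kap \<alpha> k {1..n} (word_action n k g x) (word_action n k g y) = kap \<alpha> k {1..n} x y"
  unfolding kap_def using assms by (simp only: cnt2_action cnt_action)

lemma sym_fun_cnt: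
  assumes "sym_fun n k f" "w \<in> words n k" "w' \<in> words n k" "cnt {1..n} w = cnt {1..n} w'"
  shows "f w = f w'"
proof -
  have "image_mset w (mset_set {1..n}) = image_mset w' (mset_set {1..n})"
    using assms(4) by (intro multiset_eqI) (simp add: count_image_mset_set del: One_nat_def)
  then obtain p where p: "p permutes {1..n}" "\<forall>i\<in>{1..n}. w i = w' (p i)"
    by (metis finite_atLeastAtMost image_mset_eq_implies_permutes)
  have "word_action n k (Hilbert_Choice.inv p) w' = w"
  proof
    fix i
    have "Hilbert_Choice.inv (Hilbert_Choice.inv p) = p" using p(1) by (simp add: inv_inv_eq permutes_bij)
    then show "word_action n k (Hilbert_Choice.inv p) w' i = w i"
      using assms(2,3) p by (cases "i \<in> {1..n}") (auto simp: word_action_def words_def PiE_iff extensional_def)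
  qed
  then show ?thesis using assms(1,3) permutes_inv[OF p(1)] unfolding sym_fun_def by metis
qed

lemma sum_word_action:
  assumes "g permutes {1..n}"
  shows "(\<Sum>y\<in>words n k. F (word_action n k g y)) = (\<Sum>y\<in>words n k. F y)"
proof -
  have "bij_betw (word_action n k g) (words n k) (words n k)"
    using word_action_Bij[OF assms] by (simp add: Bij_def)
  then show ?thesis by (rule sum.reindex_bij_betw)
qed

text \<open>The first factor pays for replacing the weights \<open>1 / k\<close> by 1 in all
  \<open>k\<close> rows, the second for keeping every block but one nearly of colour 1, with
  tolerance \<open>1 / M\<close> for \<open>M = 2 * k\<^sup>2\<close>.\<close>

definition sym_const :: "nat \<Rightarrow> real" where
  "sym_const k = ((1 / real k) ^ k / fact (k - 1)) ^ k * ((1 / real (2 * k\<^sup>2)) ^ (k - 1)) ^ k"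

lemma stabsum_1_prod:
  fixes y :: "nat \<Rightarrow> nat"
  assumes "finite I" "y ` I \<subseteq> {1..k}"
  shows "stabsum 1 I y = (\<Prod>b=1..k. fact (cnt I y b))"
  using assms
proof (induction I)
  case (insert i I)
  have "(\<Prod>b=1..k. fact (cnt (insert i I) y b)) =
      (\<Prod>b=1..k. fact (cnt I y b) * (if b = y i then 1 + real (cnt I y (y i)) else 1))"
    using insert.hyps by (intro prod.cong) (auto simp: cnt_insert algebra_simps)
  also have "\<dots> = (\<Prod>b=1..k. fact (cnt I y b)) * (\<Prod>b=1..k. if b = y i then 1 + real (cnt I y (y i)) else 1)"
    by (rule prod.distrib)
  also have "(\<Prod>b=1..k. if b = y i then 1 + real (cnt I y (y i)) else 1) = 1 + real (cnt I y (y i))"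
    using insert.prems by (subst prod.delta) auto
  finally show ?case using insert by (simp add: stabsum_insert)
qed simp

lemma kap_const_row:
  assumes "finite I" "a \<in> {1..k}" "\<And>i. i \<in> I \<Longrightarrow> x i = a"
  shows "kap \<alpha> k I x y = (\<Prod>b=1..k. pochhammer \<alpha> (cnt I y b)) / pochhammer (real k * \<alpha>) (card I)"
proof -
  have c: "cnt2 I x y a' b = (if a' = a then cnt I y b else 0)" "cnt I x a' = (if a' = a then card I else 0)" for a' b
  proof -
    have "{i \<in> I. x i = a' \<and> y i = b} = (if a' = a then {i \<in> I. y i = b} else {})"
      "{i \<in> I. x i = a'} = (if a' = a then I else {})"
      using assms(3) by auto
    then show "cnt2 I x y a' b = (if a' = a then cnt I y b else 0)" "cnt I x a' = (if a' = a then card I else 0)"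
      by (simp_all add: cnt_def cnt2_def)
  qed
  have "kap \<alpha> k I x y = (\<Prod>a'=1..k. if a' = a
      then (\<Prod>b=1..k. pochhammer \<alpha> (cnt I y b)) / pochhammer (real k * \<alpha>) (card I) else 1)"
    unfolding kap_def c by (intro prod.cong) auto
  then show ?thesis using assms(2) by (subst (asm) prod.delta) auto
qed

lemma const_word_apply: "i \<in> {1..n} \<Longrightarrow> const_word n a i = a"
  by (simp add: const_word_def)

context word_chain
begin

text \<open>Both sides are proportional to the product of the factorials of the letter counts and
  both have mass one, so the number of orbits need not be evaluated.\<close>

lemma law_K_eq:
  assumes a: "a \<in> {1..k}" and x: "x \<in> words n k"
  shows "\<pi>\<^sub>K x = kap 1 k {1..n} (const_word n a) x"
proof -
  let ?kap = "kap 1 k {1..n} (const_word n a)"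
  define s where "s = pochhammer (real k * 1) n / (real (order (sym_group n)) * real (card (orbits (sym_group n) (words n k) (word_action n k))))"
  have pos: "0 < pochhammer (real k * 1) n" using k_pos by (intro pochhammer_pos) simp
  have eq: "\<pi>\<^sub>K y = s * ?kap y" if y: "y \<in> words n k" for y
  proof -
    have "y ` {1..n} \<subseteq> {1..k}" using y by (auto simp: words_def)
    then have "real (card (stabilizer (sym_group n) (word_action n k) y)) = (\<Prod>b=1..k. pochhammer 1 (cnt {1..n} y b))"
      unfolding card_stabilizer_word[OF y] by (simp only: stabsum_1_prod finite_atLeastAtMost pochhammer_fact)
    moreover have "?kap y = (\<Prod>b=1..k. pochhammer 1 (cnt {1..n} y b)) / pochhammer (real k * 1) n"
      using kap_const_row[of "{1..n}" a k "const_word n a" 1 y] a by (simp add: const_word_apply del: One_nat_def atLeastAtMost_iff)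
    ultimately show ?thesis using pos unfolding burnside_law_def s_def by simp
  qed
  have "const_word n a ` {1..n} \<subseteq> {1..k}" using a by (auto simp: const_word_def)
  then have "sum ?kap (words n k) = 1" unfolding words_def using k_pos by (intro sum_kap) auto
  moreover have "sum \<pi>\<^sub>K (words n k) = s * sum ?kap (words n k)"
    unfolding sum_distrib_left by (intro sum.cong) (simp_all add: eq)
  ultimately have "s = 1" using law_K_sum by simp
  then show ?thesis using eq[OF x] by simp
qed

lemma step_action:
  assumes g: "g permutes {1..n}" and x: "x \<in> words n k"
  shows "K.step f (word_action n k g x) = K.step (\<lambda>w. f (word_action n k g w)) x"
proof -
  let ?K = "kap (1 / real k) k {1..n}"
  have "K.step f (word_action n k g x) = (\<Sum>y\<in>words n k. ?K (word_action n k g x) y * f y)"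
    unfolding step_K_eq[OF word_action_closed[OF g x]] avg_def words_def[symmetric] ..
  also have "\<dots> = (\<Sum>y\<in>words n k. ?K (word_action n k g x) (word_action n k g y) * f (word_action n k g y))"
    by (rule sum_word_action[OF g, symmetric])
  also have "\<dots> = (\<Sum>y\<in>words n k. ?K x y * f (word_action n k g y))"
    by (intro sum.cong refl) (simp only: kap_action[OF g x])
  finally show ?thesis unfolding step_K_eq[OF x] avg_def words_def[symmetric] .
qed

lemma step_sym: "sym_fun n k f \<Longrightarrow> sym_fun n k (K.step f)"
  unfolding sym_fun_def
proof (intro allI impI)
  fix g w assume f: "\<forall>g w. g permutes {1..n} \<longrightarrow> w \<in> words n k \<longrightarrow> f (word_action n k g w) = f w"
    and g: "g permutes {1..n}" and w: "w \<in> words n k"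
  show "K.step f (word_action n k g w) = K.step f w"
    unfolding step_action[OF g w] by (rule fun_cong[OF K.step_cong]) (use f g in blast)
qed

lemma funpow_step_action:
  assumes "g permutes {1..n}" "x \<in> words n k"
  shows "(K.step ^^ t) f (word_action n k g x) = (K.step ^^ t) (\<lambda>w. f (word_action n k g w)) x"
  using assms(2)
proof (induction t arbitrary: x)
  case (Suc t)
  have "K.step (\<lambda>w. (K.step ^^ t) f (word_action n k g w)) = K.step ((K.step ^^ t) (\<lambda>w. f (word_action n k g w)))"
    by (intro K.step_cong Suc.IH)
  then show ?case using step_action[OF assms(1) Suc.prems] by simp
qed simp

lemma avg_law_action:
  assumes g: "g permutes {1..n}"
  shows "avg (words n k) \<pi>\<^sub>K (\<lambda>w. f (word_action n k g w)) = avg (words n k) \<pi>\<^sub>K f"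
proof -
  have a: "1 \<in> {1..k}" using k_pos by simp
  have "\<pi>\<^sub>K (word_action n k g w) = \<pi>\<^sub>K w" if w: "w \<in> words n k" for w
  proof -
    have "word_action n k g (const_word n 1) = const_word n 1"
      using const_word_fixed[OF g a] by (simp add: invariants_def)
    then show ?thesis
      using kap_action[OF g const_word_words[OF a] w, of 1]
      by (simp only: law_K_eq[OF a w] law_K_eq[OF a word_action_closed[OF g w]])
  qed
  then have "avg (words n k) \<pi>\<^sub>K (\<lambda>w. f (word_action n k g w))
      = (\<Sum>w\<in>words n k. \<pi>\<^sub>K (word_action n k g w) * f (word_action n k g w))"
    unfolding avg_def by (intro sum.cong) auto
  also have "\<dots> = avg (words n k) \<pi>\<^sub>K f" unfolding avg_def by (rule sum_word_action[OF g])
  finally show ?thesis .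
qed

end

context word_chain
begin

text \<open>\<open>Good\<close> collects the count vectors in which each colour except 1 has between
  \<open>s\<close> and \<open>2 * s\<close> letters. A block of \<open>m \<ge> n / k\<close> letters
  is set apart. If the remaining letters contain at most \<open>s\<close> of each colour except 1,
  every vector in \<open>Good\<close> is completed by exactly one composition of \<open>m\<close>,
  and under weights 1 each composition has probability \<open>1 / ncomps k m\<close>, at least
  \<open>1 / (n + 1) ^ (k - 1)\<close>.\<close>

lemma sym_minor:
  assumes sym: "sym_fun n k f" and f: "\<And>w. w \<in> words n k \<Longrightarrow> 0 \<le> f w" and x: "x \<in> words n k"
    and rep: "\<And>q. q \<in> comps k n \<Longrightarrow> rep q \<in> words n k \<and> cnt {1..n} (rep q) = q"
    and M: "M = 2 * k\<^sup>2" and s: "s = n div M"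
    and Good: "Good = {q\<in>comps k n. \<forall>b\<in>{2..k}. s \<le> q b \<and> q b \<le> 2 * s}"
  shows "sym_const k / (real n + 1) ^ (k - 1) * (\<Sum>q\<in>Good. f (rep q)) \<le> K.step f x"
proof -
  let ?I = "{1..n}" and ?F = "\<lambda>q. f (rep q)"
  let ?\<kappa> = "((1 / real k) ^ k / fact (k - 1)) ^ k"
  have kM: "k \<le> M" "0 < M" using k_pos unfolding M by (auto simp: power2_eq_square)
  have x_im: "x ` ?I \<subseteq> {1..k}" using x by (auto simp: words_def)
  have fF: "f w = ?F (cnt ?I w)" if w: "w \<in> words n k" for w
  proof -
    have "w ` ?I \<subseteq> {1..k}" using w by (auto simp: words_def)
    then have "cnt ?I w \<in> comps k n" using cnt_comps[of ?I w k] by simp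
    then show ?thesis using rep by (intro sym_fun_cnt[OF sym w]) auto
  qed
  have F_nn: "0 \<le> ?F q" if "q \<in> comps k n" for q using rep[OF that] f by blast
  have "\<exists>a\<in>{1..k}. n \<le> k * cnt ?I x a"
  proof (rule ccontr)
    assume "\<not> (\<exists>a\<in>{1..k}. n \<le> k * cnt ?I x a)"
    then have "(\<Sum>a=1..k. k * cnt ?I x a) < (\<Sum>a=1..k. n)"
      using k_pos by (intro sum_strict_mono) (auto simp: not_le)
    moreover have "(\<Sum>a=1..k. cnt ?I x a) = n" using x_im by (subst cnt_sum) (simp_all add: image_subset_iff)
    ultimately show False by (simp add: sum_distrib_left[symmetric])
  qed
  then obtain a where a: "a \<in> {1..k}" "n \<le> k * cnt ?I x a" by blast
  define B where "B = {1..k} - {a}"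
  define A where "A = {i\<in>?I. x i = a}"
  define R where "R = {i\<in>?I. x i \<in> B}"
  define m where "m = card A"
  have AR: "finite A" "finite R" "A \<inter> R = {}" "x ` (A \<union> R) \<subseteq> {1..k}"
      "\<And>i. i \<in> A \<Longrightarrow> x i = a" "\<And>i. i \<in> R \<Longrightarrow> x i \<noteq> a"
    using x_im by (auto simp: A_def R_def B_def)
  have I: "?I = A \<union> R" using x_im a by (auto simp: A_def R_def B_def)
  have cards: "m + card R = n" using card_Un_disjoint[OF AR(1-3)] by (simp add: I[symmetric] m_def)
  have m: "n \<le> k * m" using a(2) by (simp add: cnt_def A_def m_def)
  have Ms: "M * s \<le> n" unfolding s by simp
  \<comment> \<open>\<open>M = 2 * k\<^sup>2\<close> is chosen for this: block \<open>A\<close> has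
    room even for \<open>2 * s\<close> letters of each colour except 1.\<close>
  have "k * ((k - 1) * (2 * s)) \<le> k * m"
  proof -
    have "k * ((k - 1) * (2 * s)) \<le> k * (k * (2 * s))" by (intro mult_le_mono) auto
    also have "\<dots> = M * s" by (simp add: M power2_eq_square)
    finally show ?thesis using Ms m by linarith
  qed
  then have hi: "(k - 1) * (2 * s) \<le> m" using k_pos by simp
  let ?near = "\<lambda>u. \<forall>b\<in>{2..k}. M * cnt R u b \<le> card R"
  let ?\<Psi> = "\<lambda>u q. ?F (\<lambda>b. q b + cnt R u b)"
  have sum_ge: "(\<Sum>q\<in>Good. ?F q) \<le> (\<Sum>q\<in>comps k m. ?\<Psi> u q)" if u: "u \<in> wrd R k" "?near u" for u
  proof -
    let ?c = "cnt R u"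
    have c: "?c \<in> comps k (card R)" using u(1) AR(2) by (intro cnt_comps) auto
    let ?sh = "\<lambda>q b. q b - ?c b"
    have le: "?c b \<le> q b" if q: "q \<in> Good" for q b
    proof (cases "b \<in> {2..k}")
      case True
      have "M * ?c b \<le> n" using u(2) True cards by fastforce
      then have "?c b \<le> s" unfolding s using kM(2) by (simp add: less_eq_div_iff_mult_less_eq mult.commute)
      moreover have "s \<le> q b" using q True by (simp add: Good)
      ultimately show ?thesis by (rule le_trans)
    next
      case False
      show ?thesis
      proof (cases "b = 1")
        case True
        \<comment> \<open>Parts \<open>2..k\<close> of \<open>q\<close> sum to at most
          \<open>m\<close>, which leaves at least \<open>n - m = card R\<close> for colour
          1.\<close>
        have k: "{1..k} = insert 1 {2..k}" using k_pos by auto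
        have "(\<Sum>b=1..k. q b) = n" using q by (simp add: Good comps_def)
        then have "q 1 + (\<Sum>b=2..k. q b) = n" unfolding k by (subst (asm) sum.insert) auto
        moreover have "(\<Sum>b=2..k. q b) \<le> (\<Sum>b=2..k. 2 * s)" using q by (intro sum_mono) (auto simp: Good)
        then have "(\<Sum>b=2..k. q b) \<le> m" using hi by simp
        moreover have "?c 1 \<le> (\<Sum>b=1..k. ?c b)" using k_pos by (intro member_le_sum) auto
        then have "?c 1 \<le> card R" using c by (simp add: comps_def)
        ultimately show ?thesis using True cards by simp
      next
        case b: False
        then show ?thesis using c False by (auto simp: comps_def)
      qed
    qed
    have sh: "?sh q \<in> comps k m" if q: "q \<in> Good" for q
    proof -
      have "(\<Sum>b=1..k. q b - ?c b) = (\<Sum>b=1..k. q b) - (\<Sum>b=1..k. ?c b)"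
        using le[OF q] by (intro sum_subtractf_nat) auto
      also have "\<dots> = m" using q c cards by (simp add: Good comps_def)
      finally show ?thesis using q by (auto simp: Good comps_def)
    qed
    have unsh: "(\<lambda>b. ?sh q b + ?c b) = q" if "q \<in> Good" for q using le[OF that] by auto
    have inj: "inj_on ?sh Good" by (rule inj_onI) (metis unsh)
    have "(\<Sum>q\<in>Good. ?F q) = (\<Sum>q\<in>Good. ?\<Psi> u (?sh q))" using unsh by (intro sum.cong) auto
    also have "\<dots> = (\<Sum>q\<in>?sh ` Good. ?\<Psi> u q)" by (simp add: sum.reindex[OF inj] o_def)
    also have "\<dots> \<le> (\<Sum>q\<in>comps k m. ?\<Psi> u q)"
    proof (rule sum_mono2[OF finite_comps])
      show "?sh ` Good \<subseteq> comps k m" using sh by blast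
      fix q assume "q \<in> comps k m - ?sh ` Good"
      then have "(\<lambda>b. q b + ?c b) \<in> comps k n" using c cards by (auto simp: comps_def sum.distrib)
      then show "0 \<le> ?\<Psi> u q" by (rule F_nn)
    qed
    finally show ?thesis .
  qed
  have S: "0 \<le> (\<Sum>q\<in>Good. ?F q)" by (intro sum_nonneg F_nn) (auto simp: Good)
  have nc: "0 < ncomps k m" "ncomps k m \<le> (real n + 1) ^ (k - 1)"
  proof -
    show "0 < ncomps k m" by (rule ncomps_pos[OF k_pos])
    have "ncomps k m \<le> (real m + 1) ^ (k - 1)" by (rule ncomps_bounds(2)[OF k_pos])
    also have "\<dots> \<le> (real n + 1) ^ (k - 1)" using cards by (intro power_mono) auto
    finally show "ncomps k m \<le> (real n + 1) ^ (k - 1)" .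
  qed
  let ?T = "(\<Sum>q\<in>Good. ?F q) / (real n + 1) ^ (k - 1)"
  have T: "0 \<le> ?T" using S by (intro divide_nonneg_nonneg) auto
  let ?P = "avg (wrd R k) (kap 1 k R x) (\<lambda>u. of_bool (?near u))"
  have "((1 / real M) ^ (k - 1)) ^ k \<le> ((1 / real M) ^ (k - 1)) ^ card B"
  proof (rule power_decreasing)
    show "card B \<le> k" using card_mono[of "{1..k}" B] by (auto simp: B_def)
    show "(1 / real M) ^ (k - 1) \<le> 1" using kM by (intro power_le_one) auto
  qed simp
  also have "\<dots> \<le> ?P"
    unfolding R_def using x_im kM(1) k_pos by (intro near_constant) (auto simp: B_def)
  finally have P: "((1 / real M) ^ (k - 1)) ^ k \<le> ?P" .
  have kap0: "0 \<le> ?\<kappa>" by simp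
  have "sym_const k / (real n + 1) ^ (k - 1) * (\<Sum>q\<in>Good. ?F q) = ?\<kappa> * (?T * ((1 / real M) ^ (k - 1)) ^ k)"
    by (simp add: sym_const_def M)
  also have "\<dots> \<le> ?\<kappa> * (?T * ?P)" using P T kap0 by (intro mult_left_mono)
  also have "?T * ?P = avg (wrd R k) (kap 1 k R x) (\<lambda>u. ?T * of_bool (?near u))"
    by (simp only: avg_scale)
  also have "?\<kappa> * \<dots> \<le> ?\<kappa> * avg (wrd R k) (kap 1 k R x) (\<lambda>u. (\<Sum>q\<in>comps k (card A). ?\<Psi> u q) / ncomps k (card A))"
  proof (rule mult_left_mono[OF avg_mono kap0])
    fix u assume u: "u \<in> wrd R k"
    show "?T * of_bool (?near u) \<le> (\<Sum>q\<in>comps k (card A). ?\<Psi> u q) / ncomps k (card A)"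
    proof (cases "?near u")
      case True
      have "?T \<le> (\<Sum>q\<in>Good. ?F q) / ncomps k m"
        using S nc by (intro divide_left_mono mult_pos_pos) auto
      also have "\<dots> \<le> (\<Sum>q\<in>comps k m. ?\<Psi> u q) / ncomps k m"
        using sum_ge[OF u True] nc(1) by (intro divide_right_mono) auto
      finally show ?thesis using True by (simp add: m_def)
    next
      case False
      have "0 \<le> ?\<Psi> u q" if "q \<in> comps k m" for q
      proof (rule F_nn)
        have "cnt R u \<in> comps k (card R)" using u AR(2) by (intro cnt_comps) auto
        then show "(\<lambda>b. q b + cnt R u b) \<in> comps k n" using that cards by (auto simp: comps_def sum.distrib)
      qed
      then have "0 \<le> (\<Sum>q\<in>comps k m. ?\<Psi> u q) / ncomps k m"
        using nc(1) by (intro divide_nonneg_nonneg sum_nonneg) auto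
      moreover have "?T * of_bool (?near u) = 0" using False by (simp only: of_bool_eq(1) mult_zero_right)
      ultimately show ?thesis by (simp only: m_def)
    qed
  qed (simp add: kap_nonneg)
  also have "avg (wrd R k) (kap 1 k R x) (\<lambda>u. (\<Sum>q\<in>comps k (card A). ?\<Psi> u q) / ncomps k (card A))
      = avg (wrd (A \<union> R) k) (kap 1 k (A \<union> R) x) (\<lambda>y. ?\<Psi> y (cnt A y))"
  proof (rule avg_block[where \<Psi> = ?\<Psi> and a = a, symmetric])
    fix y y' :: "nat \<Rightarrow> nat" and q assume "\<And>i. i \<in> R \<Longrightarrow> y i = y' i"
    then have "cnt R y = cnt R y'" by (rule cnt_cong)
    then show "?\<Psi> y q = ?\<Psi> y' q" by (simp only:)
  qed (fact AR k_pos)+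
  also have "\<dots> = avg (words n k) (kap 1 k ?I x) f"
    unfolding I[symmetric] words_def[symmetric]
  proof (rule avg_cong)
    fix y assume y: "y \<in> words n k"
    have "(\<lambda>b. cnt A y b + cnt R y b) = cnt ?I y" unfolding I by (rule ext) (rule cnt_Un[OF AR(1-3), symmetric])
    then show "?\<Psi> y (cnt A y) = f y" using fF[OF y] by simp
  qed
  also have "?\<kappa> * \<dots> = (\<Sum>y\<in>words n k. ?\<kappa> * kap 1 k ?I x y * f y)"
    by (simp only: avg_def sum_distrib_left mult.assoc)
  also have "\<dots> \<le> (\<Sum>y\<in>words n k. kap (1 / real k) k ?I x y * f y)"
  proof (intro sum_mono mult_right_mono f)
    fix y assume "y \<in> words n k"
    then show "?\<kappa> * kap 1 k ?I x y \<le> kap (1 / real k) k ?I x y"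
      using k_pos by (intro kap_compare) (auto simp: words_def)
  qed
  also have "\<dots> = K.step f x" unfolding step_K_eq[OF x] avg_def words_def[symmetric] ..
  finally show ?thesis .
qed

end

text \<open>The total mass of the minorizing measure: \<open>Good\<close> has at least
  \<open>(s + 1) ^ (k - 1)\<close> elements, and
  \<open>(s + 1) / (n + 1) \<ge> 1 / (2 * k\<^sup>2)\<close> removes \<open>n\<close>.\<close>

definition cycle_rate :: "nat \<Rightarrow> real" where
  "cycle_rate k = sym_const k * (1 / real (2 * k\<^sup>2)) ^ (k - 1)"

lemma avg_sum_divide:
  "avg S \<mu> (\<lambda>w. (\<Sum>g\<in>G. h g w) / N) = (\<Sum>g\<in>G. avg S \<mu> (h g)) / N"
proof -
  have "avg S \<mu> (\<lambda>w. (\<Sum>g\<in>G. h g w) / N) = (\<Sum>s\<in>S. \<Sum>g\<in>G. \<mu> s * h g s) / N"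
    unfolding avg_def sum_divide_distrib[of _ S] by (simp add: sum_distrib_left)
  then show ?thesis unfolding avg_def by (simp only: sum.swap[of _ S])
qed

context word_chain
begin

lemma const_action:
  "g permutes {1..n} \<Longrightarrow> a \<in> {1..k} \<Longrightarrow> word_action n k g (const_word n a) = const_word n a"
  using const_word_fixed[of g n a k] by (simp add: invariants_def)

definition symmetrize :: "((nat \<Rightarrow> nat) \<Rightarrow> real) \<Rightarrow> (nat \<Rightarrow> nat) \<Rightarrow> real" where
  "symmetrize f w = (\<Sum>g | g permutes {1..n}. f (word_action n k g w)) / fact n"

lemma card_perms: "real (card {g. g permutes {1..n}}) = fact n"
  using card_permutations[of "{1..n}" n] by simp

lemma symmetrize_sym: "sym_fun n k (symmetrize f)"
  unfolding sym_fun_def symmetrize_def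
proof (intro allI impI)
  fix h w assume h: "h permutes {1..n}" and w: "w \<in> words n k"
  have "(\<Sum>g | g permutes {1..n}. f (word_action n k g (word_action n k h w)))
      = (\<Sum>g | g permutes {1..n}. f (word_action n k (g \<circ> h) w))"
    using word_action_compose[OF _ h w] by (intro sum.cong) auto
  also have "\<dots> = (\<Sum>g | g permutes {1..n}. f (word_action n k g w))"
    by (rule sum_permutations_compose_right[OF h, symmetric])
  finally show "(\<Sum>g | g permutes {1..n}. f (word_action n k g (word_action n k h w))) / fact n
      = (\<Sum>g | g permutes {1..n}. f (word_action n k g w)) / fact n" by simp
qed

lemma symmetrize_unit:
  assumes "unit_valued (words n k) f"
  shows "unit_valued (words n k) (symmetrize f)"
  unfolding unit_valued_def
proof (intro ballI conjI)
  fix w assume w: "w \<in> words n k"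
  have b: "0 \<le> f (word_action n k g w) \<and> f (word_action n k g w) \<le> 1" if "g permutes {1..n}" for g
    using assms word_action_closed[OF that w] by (simp add: unit_valued_def)
  show "0 \<le> symmetrize f w" unfolding symmetrize_def using b by (intro divide_nonneg_nonneg sum_nonneg) auto
  have "(\<Sum>g | g permutes {1..n}. f (word_action n k g w)) \<le> (\<Sum>g | g permutes {1..n}. 1)"
    using b by (intro sum_mono) auto
  then show "symmetrize f w \<le> 1" using card_perms by (simp add: symmetrize_def)
qed

text \<open>A constant word is fixed by all permutations and \<open>K\<close> commutes with them, so
  its evolved law is exchangeable and cannot tell \<open>f\<close> from its symmetrization.\<close>

lemma funpow_symmetrize:
  assumes a: "a \<in> {1..k}"
  shows "(K.step ^^ t) (symmetrize f) (const_word n a) = (K.step ^^ t) f (const_word n a)"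
proof -
  let ?x = "const_word n a"
  have x: "?x \<in> words n k" by (rule const_word_words[OF a])
  have "(K.step ^^ t) (symmetrize f) ?x
      = (\<Sum>g | g permutes {1..n}. (K.step ^^ t) (\<lambda>w. f (word_action n k g w)) ?x) / fact n"
    unfolding K.avg_kernel_power[OF x, symmetric] symmetrize_def by (rule avg_sum_divide)
  also have "\<dots> = (\<Sum>g | g permutes {1..n}. (K.step ^^ t) f ?x) / fact n"
    using funpow_step_action[OF _ x, of _ t f] const_action[OF _ a]
    by (intro arg_cong2[where f = "(/)"] sum.cong) auto
  also have "\<dots> = (K.step ^^ t) f ?x" using card_perms by simp
  finally show ?thesis .
qed

lemma avg_law_symmetrize: "avg (words n k) \<pi>\<^sub>K (symmetrize f) = avg (words n k) \<pi>\<^sub>K f"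
proof -
  have "avg (words n k) \<pi>\<^sub>K (symmetrize f)
      = (\<Sum>g | g permutes {1..n}. avg (words n k) \<pi>\<^sub>K (\<lambda>w. f (word_action n k g w))) / fact n"
    unfolding symmetrize_def by (rule avg_sum_divide)
  also have "\<dots> = (\<Sum>g | g permutes {1..n}. avg (words n k) \<pi>\<^sub>K f) / fact n"
    by (intro arg_cong2[where f = "(/)"] sum.cong) (auto simp: avg_law_action)
  finally show ?thesis using card_perms by simp
qed

text \<open>Doeblin's contraction is confined to symmetric test functions; symmetrizing
  \<open>f\<close> alters neither its mean after \<open>t\<close> steps from a constant word nor its
  stationary mean.\<close>

lemma dK_from_const_le:
  assumes a: "a \<in> {1..k}"
  shows "dK_from n k (const_word n a) t \<le> (1 - cycle_rate k) ^ t"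
proof -
  have "\<exists>rep. \<forall>q\<in>comps k n. rep q \<in> words n k \<and> cnt {1..n} (rep q) = q"
    using ex_word by (intro bchoice ballI) blast
  then obtain rep where rep: "\<And>q. q \<in> comps k n \<Longrightarrow> rep q \<in> words n k \<and> cnt {1..n} (rep q) = q"
    by blast
  define M where "M = 2 * k\<^sup>2"
  define s where "s = n div M"
  define Good where "Good = {q\<in>comps k n. \<forall>b\<in>{2..k}. s \<le> q b \<and> q b \<le> 2 * s}"
  have M: "0 < M" using k_pos by (simp add: M_def)
  have fG: "finite Good" using finite_comps by (simp add: Good_def)
  have inj: "inj_on rep Good" 
  proof (rule inj_onI)
    fix q q' assume "q \<in> Good" "q' \<in> Good" "rep q = rep q'"
    then show "q = q'" using rep[of q] rep[of q'] by (simp add: Good_def)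
  qed
  have repG: "rep ` Good \<subseteq> words n k" using rep by (auto simp: Good_def)
  have "(k - 1) * (2 * s) \<le> n"
  proof -
    have "k - 1 \<le> k * k" using le_square[of k] by linarith
    then have "(k - 1) * (2 * s) \<le> k * k * (2 * s)" by (rule mult_le_mono1)
    also have "\<dots> = M * s" by (simp add: M_def power2_eq_square)
    also have "\<dots> \<le> n" by (simp add: s_def)
    finally show ?thesis .
  qed
  then have G: "real (s + 1) ^ (k - 1) \<le> real (card Good)"
    using card_comps_box[of k "2 * s" n s] k_pos by (simp add: Good_def)
  moreover have "0 < real (s + 1) ^ (k - 1)" by simp
  ultimately have Gpos: "0 < real (card Good)" by linarith
  have sym0: "0 \<le> sym_const k" by (simp add: sym_const_def)
  let ?c = "cycle_rate k"
  have c_le: "?c / real (card Good) \<le> sym_const k / (real n + 1) ^ (k - 1)"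
  proof -
    have "n + 1 \<le> M * (s + 1)"
      using mult_div_mod_eq[of M n] mod_less_divisor[OF M, of n] unfolding distrib_left s_def by linarith
    then have "real n + 1 \<le> real M * real (s + 1)" by (metis of_nat_1 of_nat_add of_nat_le_iff of_nat_mult)
    then have "(1 / real M) * (real n + 1) \<le> real (s + 1)" using M by (simp add: field_simps)
    then have "((1 / real M) * (real n + 1)) ^ (k - 1) \<le> real (s + 1) ^ (k - 1)"
      by (intro power_mono) auto
    then have "(1 / real M) ^ (k - 1) * (real n + 1) ^ (k - 1) \<le> real (card Good)"
      using G by (simp only: power_mult_distrib)
    then have "sym_const k * ((1 / real M) ^ (k - 1) * (real n + 1) ^ (k - 1)) \<le> sym_const k * real (card Good)"
      using sym0 by (intro mult_left_mono)
    then have "?c * (real n + 1) ^ (k - 1) \<le> sym_const k * real (card Good)"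
      by (simp only: cycle_rate_def M_def mult.assoc)
    then show ?thesis using Gpos by (simp add: pos_divide_le_eq pos_le_divide_eq)
  qed
  define \<nu> where "\<nu> = (\<lambda>w. if w \<in> rep ` Good then ?c / real (card Good) else 0)"
  have avg_\<nu>: "avg (words n k) \<nu> f = ?c / real (card Good) * (\<Sum>q\<in>Good. f (rep q))" for f
  proof -
    have "avg (words n k) \<nu> f = (\<Sum>w\<in>rep ` Good. ?c / real (card Good) * f w)"
      unfolding avg_def using repG fin_X by (intro sum.mono_neutral_cong_right) (auto simp: \<nu>_def)
    then show ?thesis by (simp add: sum.reindex[OF inj] sum_distrib_left)
  qed
  have mass: "sum \<nu> (words n k) = ?c"
    using avg_\<nu>[of "\<lambda>_. 1"] Gpos by (simp add: avg_def)
  have minor: "avg (words n k) \<nu> f \<le> K.step f w"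
    if f: "sym_fun n k f" "\<forall>r\<in>words n k. 0 \<le> f r" and w: "w \<in> words n k" for f w
  proof -
    have "0 \<le> (\<Sum>q\<in>Good. f (rep q))" using f(2) repG by (intro sum_nonneg) auto
    then have "?c / real (card Good) * (\<Sum>q\<in>Good. f (rep q))
        \<le> sym_const k / (real n + 1) ^ (k - 1) * (\<Sum>q\<in>Good. f (rep q))"
      using c_le by (intro mult_right_mono)
    also have "\<dots> \<le> K.step f w"
      using f(2) by (intro sym_minor[OF f(1) _ w rep M_def s_def Good_def]) auto
    finally show ?thesis unfolding avg_\<nu> .
  qed
  have x: "const_word n a \<in> words n k" by (rule const_word_words[OF a])
  show ?thesis
    unfolding dK_from_eq
  proof (rule K.dist_from_le[OF x])
    fix f :: "(nat \<Rightarrow> nat) \<Rightarrow> real" assume f: "unit_valued (words n k) f"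
    let ?g = "(K.step ^^ t) (symmetrize f)"
    have aff: "sym_fun n k (\<lambda>s. c * h s + d)" if "sym_fun n k h" for h c d
      using that by (simp add: sym_fun_def)
    obtain lo hi where lh: "hi - lo = (1 - ?c) ^ t" "\<forall>s\<in>words n k. lo \<le> ?g s \<and> ?g s \<le> hi"
      using K.doeblin_osc[where C = "sym_fun n k" and \<nu> = \<nu> and t = t, OF step_sym aff minor mass
          symmetrize_sym symmetrize_unit[OF f]] by blast
    have "avg (words n k) \<pi>\<^sub>K (\<lambda>_. lo) \<le> avg (words n k) \<pi>\<^sub>K ?g"
      using lh(2) K.law_nonneg by (intro avg_mono) auto
    then have "lo \<le> avg (words n k) \<pi>\<^sub>K f"
      by (simp add: avg_const law_K_sum K.avg_law_funpow avg_law_symmetrize)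
    moreover have "(K.step ^^ t) f (const_word n a) \<le> hi"
      using lh(2) x funpow_symmetrize[OF a] by metis
    ultimately show "(K.step ^^ t) f (const_word n a) - avg (words n k) \<pi>\<^sub>K f \<le> (1 - ?c) ^ t"
      using lh(1) by linarith
  qed
qed

end

section \<open>Words fixed by an n-cycle\<close>

lemma rotate1_fixed:
  assumes "rotate1 l = l" "j < length l"
  shows "l ! j = l ! 0"
  using assms(2)
proof (induction j)
  case (Suc j)
  have "l ! j = l ! (Suc j mod length l)" using nth_rotate1[of j l] Suc.prems assms(1) by simp
  then show ?case using Suc by simp
qed simp

lemma invariants_full_cycle:
  assumes "1 \<le> n" "is_full_cycle n g" "x \<in> invariants (words n k) (word_action n k) g"
  shows "\<exists>a\<in>{1..k}. x = const_word n a"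
proof -
  obtain cs where cs: "cycle cs" "set cs = {1..n}" "g = cycle_of_list cs"
    using assms(2) by (auto simp: is_full_cycle_def)
  have g: "g permutes {1..n}" using cycle_permutes[of cs] cs by simp
  have x: "x \<in> words n k" "\<forall>i\<in>{1..n}. x (g i) = x i"
    using assms(3) word_fixed_iff[OF g, of x k] by (auto simp: invariants_def)
  \<comment> \<open>Applying \<open>g\<close> to the entries of its cycle list rotates the list, so
    for an invariant word the letters read along the cycle form a list equal to its own
    rotation.\<close>
  have "map x (rotate1 cs) = map x (map g cs)"
    using cyclic_rotation[OF cs(1), of 1] cs(3) by simp
  also have "\<dots> = map x cs" using x(2) cs(2) by simp
  finally have rot: "rotate1 (map x cs) = map x cs" by (simp add: rotate1_map)
  have "x i = x (cs ! 0)" if "i \<in> {1..n}" for i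
  proof -
    have "i \<in> set cs" using that cs(2) by (simp only:)
    then obtain j where j: "j < length cs" "cs ! j = i" unfolding in_set_conv_nth by blast
    then have "map x cs ! j = map x cs ! 0" by (intro rotate1_fixed[OF rot]) simp
    moreover have "0 < length cs" using j(1) by linarith
    ultimately show ?thesis using j by (simp add: nth_map)
  qed
  have eq: "x = const_word n (x 1)"
  proof -
    have one: "1 \<in> {1..n}" using assms(1) by simp
    have "x i = const_word n (x 1) i" for i
    proof (cases "i \<in> {1..n}")
      case True
      then have "x i = x 1" using \<open>\<And>i. i \<in> {1..n} \<Longrightarrow> x i = x (cs ! 0)\<close>[OF True]
          \<open>\<And>i. i \<in> {1..n} \<Longrightarrow> x i = x (cs ! 0)\<close>[OF one] by (simp only:)
      then show ?thesis using True by (simp only: const_word_apply)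
    next
      case False
      then show ?thesis using x(1) unfolding words_def const_word_def
        by (simp add: PiE_iff extensional_def restrict_def del: atLeastAtMost_iff One_nat_def)
    qed
    then show ?thesis by (rule ext)
  qed
  have "x 1 \<in> {1..k}" using x(1) assms(1) by (auto simp: words_def PiE_iff)
  then show ?thesis using eq by blast
qed

lemma cycle_rate_bounds:
  assumes "2 \<le> k"
  shows "0 < cycle_rate k" "cycle_rate k < 1"
proof -
  let ?p = "1 / real (2 * k\<^sup>2)"
  have "2 * 2 \<le> k * k" using assms by (intro mult_le_mono)
  then have "1 < 2 * k\<^sup>2" unfolding power2_eq_square by linarith
  then have "1 < real (2 * k\<^sup>2)" by (metis of_nat_1 of_nat_less_iff)
  moreover have "0 < 1 / r \<and> 1 / r < 1" if "1 < r" for r :: real using that by simp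
  ultimately have p: "0 < ?p" "?p < 1" by blast+
  have \<kappa>: "0 < (1 / real k) ^ k / fact (k - 1)" "(1 / real k) ^ k / fact (k - 1) \<le> 1"
  proof -
    have "(1 / real k) ^ k \<le> 1" using assms by (intro power_le_one) auto
    also have "(1::real) \<le> fact (k - 1)" by (rule fact_ge_1)
    finally show "(1 / real k) ^ k / fact (k - 1) \<le> 1" by simp
  qed (use assms in simp)
  have s: "0 < sym_const k" "sym_const k \<le> 1"
    unfolding sym_const_def using p \<kappa> by (auto intro!: mult_pos_pos mult_le_one power_le_one)
  obtain j where j: "k - 1 = Suc j" using assms by (cases "k - 1") auto
  have "?p ^ (k - 1) < 1" unfolding j using p by (intro power_Suc_less_one)
  moreover have "sym_const k * ?p ^ (k - 1) \<le> 1 * ?p ^ (k - 1)"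
    using s p by (intro mult_right_mono) auto
  ultimately have "sym_const k * ?p ^ (k - 1) < 1" by linarith
  then show "cycle_rate k < 1" by (simp add: cycle_rate_def)
  show "0 < cycle_rate k" unfolding cycle_rate_def using s p by (intro mult_pos_pos) auto
qed

text \<open>The first half-step from an \<open>n\<close>-cycle lands on a constant word, so the
  bound for such words applies with one step less.\<close>

lemma (in word_chain) dQ_from_cycle_le:
  assumes "1 \<le> n" "is_full_cycle n g"
  shows "dQ_from n k g (Suc t) \<le> (1 - cycle_rate k) ^ t"
  unfolding dQ_from_eq
proof (rule dist_Q_Suc_le)
  show "g \<in> carrier (sym_group n)"
  proof -
    obtain cs where "set cs = {1..n}" "g = cycle_of_list cs"
      using assms(2) unfolding is_full_cycle_def by blast
    then show ?thesis using cycle_permutes[of cs] unfolding sym_group_carrier by simp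
  qed
  fix x assume "x \<in> invariants (words n k) (word_action n k) g"
  then obtain a where "a \<in> {1..k}" "x = const_word n a" using invariants_full_cycle[OF assms] by blast
  then show "dist_from (words n k) K \<pi>\<^sub>K x t \<le> (1 - cycle_rate k) ^ t"
    using dK_from_const_le[of a t] by (simp add: dK_from_eq)
qed

lemma (in word_chain) tmixQ_from_cycle_le:
  assumes "1 \<le> n" "2 \<le> k" "is_full_cycle n g" "0 < \<epsilon>"
  shows "tmixQ_from n k g \<epsilon> \<le> enat (1 + nat \<lceil>inverse (cycle_rate k) * ln (1 / \<epsilon>)\<rceil>)"
proof -
  let ?N = "nat \<lceil>inverse (cycle_rate k) * ln (1 / \<epsilon>)\<rceil>"
  have "1 * (1 - cycle_rate k) ^ ?N \<le> \<epsilon>"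
    using cycle_rate_bounds[OF assms(2)] assms(4) by (intro one_minus_power_le) auto
  then have "dQ_from n k g (1 + ?N) \<le> \<epsilon>" using dQ_from_cycle_le[OF assms(1,3), of ?N] by simp
  then show ?thesis unfolding tmixQ_from_def mixing_time_from_def dQ_from_def by (intro first_below_le)
qed

section \<open>A tagged letter of the urn\<close>

text \<open>\<open>urn \<alpha> r g\<close> is the mean of \<open>g\<close> at the number of letters sharing the colour of a tagged letter
  in a block of \<open>r + 1\<close> letters, when \<open>k \<alpha> = 1\<close>.\<close>

primrec urn :: "real \<Rightarrow> nat \<Rightarrow> (nat \<Rightarrow> real) \<Rightarrow> real" where
  "urn \<alpha> 0 g = g 1"
| "urn \<alpha> (Suc r) g = urn \<alpha> r (\<lambda>j. ((real j + \<alpha>) * g (Suc j) + (real r + 2 - real j - \<alpha>) * g j) / (real r + 2))"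

lemma urn_add: "urn \<alpha> r (\<lambda>j. g j + h j) = urn \<alpha> r g + urn \<alpha> r h"
proof (induction r arbitrary: g h)
  case (Suc r)
  show ?case unfolding urn.simps Suc[symmetric]
    by (intro arg_cong[where f = "urn \<alpha> r"] ext) (simp add: add_divide_distrib[symmetric] algebra_simps)
qed simp

text \<open>The tagged letter is drawn first and the others follow: a letter of another block
  changes nothing, one of the same block joins the tagged colour with probability
  \<open>(j + \<alpha>) / (r + 2)\<close>. The total weight \<open>r + 2\<close> is where
  \<open>k * \<alpha> = 1\<close> enters.\<close>

lemma urn_average:
  assumes "finite J" "i \<notin> J" "x ` insert i J \<subseteq> {1..k}" "0 < \<alpha>" "1 \<le> k" "real k * \<alpha> = 1"
  shows "avg (wrd (insert i J) k) (kap \<alpha> k (insert i J) x) (\<lambda>y. g (cnt2 (insert i J) x y (x i) (y i)))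
    = urn \<alpha> (cnt J x (x i)) g"
  using assms(1-3)
proof (induction J arbitrary: g)
  case empty
  have xi: "x i \<in> {1..k}" using empty.prems by simp
  have "avg (wrd {i} k) (kap \<alpha> k {i} x) (\<lambda>y. g (cnt2 {i} x y (x i) (y i)))
      = avg (wrd {} k) (kap \<alpha> k {} x) (\<lambda>u. \<Sum>c=1..k. wt \<alpha> k {} x u (x i) c * g 1)"
    using avg_kap_insert[where x = x and I = "{}" and i = i and k = k and \<alpha> = \<alpha>, OF _ _ xi] by (simp add: cnt2_insert)
  also have "\<dots> = g 1"
    using wt_sum[of "{}" \<alpha> k "\<lambda>_. undefined" x "x i"] assms(4,5)
    by (simp add: avg_def sum_distrib_right[symmetric])
  finally show ?case by simp
next
  case (insert l J)
  let ?I = "insert i J"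
  have l: "l \<notin> ?I" "finite ?I" "x l \<in> {1..k}" "l \<noteq> i" using insert by auto
  have il: "insert i (insert l J) = insert l ?I" by auto
  let ?J = "\<lambda>u. cnt2 ?I x u (x i) (u i)"
  have cx: "cnt ?I x (x i) = Suc (cnt J x (x i))" using insert by (simp add: cnt_insert)
  have upd: "cnt2 (insert l ?I) x (u(l := c)) (x i) ((u(l := c)) i) = ?J u + (if x l = x i \<and> c = u i then 1 else 0)" for u c
    using l cnt2_insert[OF l(2,1), of x "u(l := c)" "x i" "u i"] by auto
  let ?g = "\<lambda>j. if x l = x i then ((real j + \<alpha>) * g (Suc j) + (real (cnt J x (x i)) + 2 - real j - \<alpha>) * g j) / (real (cnt J x (x i)) + 2) else g j"
  have inner: "(\<Sum>c=1..k. wt \<alpha> k ?I x u (x l) c * g (?J u + (if x l = x i \<and> c = u i then 1 else 0))) = ?g (?J u)"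
    if u: "u \<in> wrd ?I k" for u
  proof -
    have ws: "(\<Sum>c=1..k. wt \<alpha> k ?I x u (x l) c) = 1" using wt_sum[OF l(2) assms(4,5) u] .
    show ?thesis
    proof (cases "x l = x i")
      case True
      have ui: "u i \<in> {1..k}" using u by auto
      have w: "wt \<alpha> k ?I x u (x l) (u i) = (real (?J u) + \<alpha>) / (real (cnt J x (x i)) + 2)"
        unfolding wt_def True cx assms(6) by (simp add: add_ac)
      have "(\<Sum>c=1..k. wt \<alpha> k ?I x u (x l) c * g (?J u + (if x l = x i \<and> c = u i then 1 else 0)))
          = (\<Sum>c=1..k. wt \<alpha> k ?I x u (x l) c * g (?J u) +
              (if c = u i then wt \<alpha> k ?I x u (x l) (u i) * (g (Suc (?J u)) - g (?J u)) else 0))"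
        using True by (intro sum.cong) (auto simp: algebra_simps)
      also have "\<dots> = g (?J u) + wt \<alpha> k ?I x u (x l) (u i) * (g (Suc (?J u)) - g (?J u))"
        unfolding sum.distrib sum_distrib_right[symmetric] ws using ui by simp
      also have "\<dots> = ?g (?J u)" unfolding w using True by (simp add: field_simps)
      finally show ?thesis .
    next
      case False
      then show ?thesis using ws by (simp add: sum_distrib_right[symmetric])
    qed
  qed
  have "avg (wrd (insert l ?I) k) (kap \<alpha> k (insert l ?I) x) (\<lambda>y. g (cnt2 (insert l ?I) x y (x i) (y i)))
      = avg (wrd ?I k) (kap \<alpha> k ?I x) (\<lambda>u. ?g (?J u))"
    unfolding avg_kap_insert[where x = x, OF l(2,1,3)] upd by (intro avg_cong inner)
  also have "\<dots> = urn \<alpha> (cnt J x (x i)) ?g"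
    using insert.prems insert.hyps by (intro insert.IH) auto
  also have "\<dots> = urn \<alpha> (cnt (insert l J) x (x i)) g"
    using insert.hyps by (cases "x l = x i") (simp_all add: cnt_insert)
  finally show ?case unfolding il .
qed

text \<open>A letter chosen uniformly in a block of \<open>m\<close> letters has a size-biased part of the block.\<close>

lemma urn_size_biased:
  assumes "finite I" "x ` I \<subseteq> {1..k}" "0 < \<alpha>" "1 \<le> k" "real k * \<alpha> = 1"
  shows "avg (wrd I k) (kap \<alpha> k I x) (\<lambda>y. \<Sum>b=1..k. real (cnt2 I x y a b) * g (cnt2 I x y a b))
    = real (cnt I x a) * urn \<alpha> (cnt I x a - 1) g"
proof -
  let ?A = "{i\<in>I. x i = a}"
  have swap: "(\<Sum>b=1..k. real (cnt2 I x y a b) * g (cnt2 I x y a b)) = (\<Sum>i\<in>?A. g (cnt2 I x y a (y i)))"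
    if y: "y \<in> wrd I k" for y
  proof -
    have "(\<Sum>i\<in>?A. g (cnt2 I x y a (y i))) = (\<Sum>b=1..k. \<Sum>i\<in>{i\<in>?A. y i = b}. g (cnt2 I x y a (y i)))"
      using assms(1) y by (intro sum.group[symmetric]) auto
    also have "\<dots> = (\<Sum>b=1..k. real (cnt2 I x y a b) * g (cnt2 I x y a b))"
    proof (rule sum.cong[OF refl])
      fix b
      have "{i\<in>?A. y i = b} = {i\<in>I. (x i, y i) = (a, b)}" by auto
      then show "(\<Sum>i\<in>{i\<in>?A. y i = b}. g (cnt2 I x y a (y i))) = real (cnt2 I x y a b) * g (cnt2 I x y a b)"
        by (simp add: cnt2_def cnt_def)
    qed
    finally show ?thesis by simp
  qed
  have "avg (wrd I k) (kap \<alpha> k I x) (\<lambda>y. \<Sum>b=1..k. real (cnt2 I x y a b) * g (cnt2 I x y a b))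
      = avg (wrd I k) (kap \<alpha> k I x) (\<lambda>y. (\<Sum>i\<in>?A. g (cnt2 I x y a (y i))) / 1)"
    by (intro avg_cong) (simp add: swap del: One_nat_def)
  also have "\<dots> = (\<Sum>i\<in>?A. avg (wrd I k) (kap \<alpha> k I x) (\<lambda>y. g (cnt2 I x y a (y i)))) / 1"
    by (rule avg_sum_divide)
  also have "\<dots> = (\<Sum>i\<in>?A. urn \<alpha> (cnt I x a - 1) g)"
    unfolding div_by_1
  proof (rule sum.cong[OF refl])
    fix i assume i: "i \<in> ?A"
    have I: "I = insert i (I - {i})" and fin: "finite (I - {i})" using i assms(1) by auto
    have "cnt (insert i (I - {i})) x a = Suc (cnt (I - {i}) x a)"
      using i cnt_insert[OF fin, of i x a] by simp
    then have "cnt (I - {i}) x (x i) = cnt I x a - 1" using I i by simp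
    moreover have "x ` insert i (I - {i}) \<subseteq> {1..k}" using assms(2) i by auto
    ultimately show "avg (wrd I k) (kap \<alpha> k I x) (\<lambda>y. g (cnt2 I x y a (y i))) = urn \<alpha> (cnt I x a - 1) g"
      using urn_average[of "I - {i}" i x k \<alpha> g, OF fin] assms(3-5) i unfolding I[symmetric] by simp
  qed
  finally show ?thesis by (simp add: cnt_def)
qed

section \<open>Lower bounds for the tagged count\<close>

lemma sum_shift_urn:
  fixes g a :: "nat \<Rightarrow> real"
  shows "(\<Sum>j=1..s. a j * g (Suc j)) = (\<Sum>j=1..Suc s. (if j = 1 then 0 else a (j - 1)) * g j)"
  by (induction s) simp_all

lemma sum_drop_last:
  fixes b g :: "nat \<Rightarrow> real"
  shows "(\<Sum>j=1..s. b j * g j) = (\<Sum>j=1..Suc s. (if j = Suc s then 0 else b j) * g j)"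
proof -
  have "(\<Sum>j=1..s. b j * g j) = (\<Sum>j=1..s. (if j = Suc s then 0 else b j) * g j)"
    by (intro sum.cong) auto
  then show ?thesis by simp
qed

text \<open>For \<alpha> = 0 this is the classical two-colour urn started with one ball of each
  colour, whose count is uniform on \<open>{1..r + 1}\<close>. A positive \<alpha> only pushes the
  count upward, and the conditional mean of an increasing function is increasing.\<close>

lemma urn_increasing:
  assumes "0 \<le> \<alpha>" "\<alpha> \<le> 1" "\<And>j. 1 \<le> j \<Longrightarrow> j \<le> r \<Longrightarrow> g j \<le> g (Suc j)"
  shows "(\<Sum>j=1..Suc r. g j) / (real r + 1) \<le> urn \<alpha> r g"
  using assms(3)
proof (induction r arbitrary: g)
  case (Suc r)
  let ?T = "\<lambda>j. ((real j + \<alpha>) * g (Suc j) + (real r + 2 - real j - \<alpha>) * g j) / (real r + 2)"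
  have "(\<Sum>j=1..Suc r. (real j * g (Suc j) + (real r + 2 - real j) * g j) / (real r + 2)) \<le> (\<Sum>j=1..Suc r. ?T j)"
  proof (intro sum_mono divide_right_mono)
    fix j assume j: "j \<in> {1..Suc r}"
    then have "0 \<le> \<alpha> * (g (Suc j) - g j)" using Suc.prems[of j] assms(1) by simp
    then show "real j * g (Suc j) + (real r + 2 - real j) * g j
        \<le> (real j + \<alpha>) * g (Suc j) + (real r + 2 - real j - \<alpha>) * g j"
      by (simp add: algebra_simps)
  qed simp
  \<comment> \<open>The coefficient of \<open>g j\<close> is \<open>(j - 1) + (r + 2 - j)\<close>,
    the same for every \<open>j\<close>: uniformity passes from \<open>r\<close> to
    \<open>r + 1\<close>.\<close>
  moreover have "(\<Sum>j=1..Suc r. real j * g (Suc j) + (real r + 2 - real j) * g j) = (real r + 1) * (\<Sum>j=1..Suc (Suc r). g j)"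
    unfolding sum.distrib sum_shift_urn sum_drop_last[where s = "Suc r"] sum_distrib_left
    unfolding sum.distrib[symmetric] by (intro sum.cong refl) (auto simp: of_nat_diff algebra_simps)
  ultimately have "(real r + 1) * (\<Sum>j=1..Suc (Suc r). g j) / (real r + 2) \<le> (\<Sum>j=1..Suc r. ?T j)"
    by (simp only: sum_divide_distrib[symmetric])
  then have "(\<Sum>j=1..Suc (Suc r). g j) / (real r + 2) \<le> (\<Sum>j=1..Suc r. ?T j) / (real r + 1)"
    by (simp only: pos_le_divide_eq) (simp add: mult.commute)
  also have "\<dots> \<le> urn \<alpha> r ?T"
  proof (rule Suc.IH)
    fix j assume j: "1 \<le> j" "j \<le> r"
    have "0 \<le> (real j + 1 + \<alpha>) * (g (Suc (Suc j)) - g (Suc j))"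
      using j assms(1) Suc.prems[of "Suc j"] by (intro mult_nonneg_nonneg) auto
    moreover have "0 \<le> (real r + 2 - real j - \<alpha>) * (g (Suc j) - g j)"
      using j assms(2) Suc.prems[of j] by (intro mult_nonneg_nonneg) auto
    ultimately show "?T j \<le> ?T (Suc j)"
      by (intro divide_right_mono) (simp_all add: algebra_simps)
  qed
  finally show ?case by (simp add: add_ac)
qed simp

text \<open>A pointwise lower bound for the law of the tagged count, for use with
  \<open>gain\<close>, which is not monotone. Against the uniform law it loses little when
  \<open>j\<close> is close to \<open>r + 1\<close>; elsewhere \<open>gain\<close> vanishes.\<close>

lemma urn_point_mass:
  assumes "0 \<le> \<alpha>" "\<alpha> \<le> 1" "\<And>j. 1 \<le> j \<Longrightarrow> j \<le> Suc r \<Longrightarrow> 0 \<le> g j"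
  shows "(\<Sum>j=1..Suc r. (1 - (real r + 1 - real j) * \<alpha>) * g j) / (real r + 1) \<le> urn \<alpha> r g"
  using assms(3)
proof (induction r arbitrary: g)
  case (Suc r)
  let ?s = "real r + 1"
  let ?\<beta> = "\<lambda>j. 1 - (?s - real j) * \<alpha>"
  let ?T = "\<lambda>j. ((real j + \<alpha>) * g (Suc j) + (real r + 2 - real j - \<alpha>) * g j) / (real r + 2)"
  let ?cf = "\<lambda>j. (if j = 1 then 0 else ?\<beta> (j - 1) * (real (j - 1) + \<alpha>)) +
      (if j = Suc (Suc r) then 0 else ?\<beta> j * (real r + 2 - real j - \<alpha>))"
  \<comment> \<open>One urn step carries the bound for \<open>r\<close> to at least the bound for
    \<open>r + 1\<close>. The end points are separate because there one of the two ways to reach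
    \<open>j\<close> is absent.\<close>
  have coeff: "?s * (1 - (real (Suc r) + 1 - real j) * \<alpha>) \<le> ?cf j" if j: "j \<in> {1..Suc (Suc r)}" for j
  proof -
    consider "j = 1" | "j = Suc (Suc r)" | "1 < j" "j < Suc (Suc r)" using j by force
    then show ?thesis
    proof cases
      case 1
      have "?s * (1 - ?s * \<alpha>) \<le> (1 - real r * \<alpha>) * (?s - \<alpha>)"
      proof -
        have "(1 - real r * \<alpha>) * (?s - \<alpha>) - ?s * (1 - ?s * \<alpha>) = \<alpha> * real r + real r * \<alpha> * \<alpha>"
          by (simp add: algebra_simps)
        moreover have "0 \<le> \<alpha> * real r + real r * \<alpha> * \<alpha>" using assms(1) by simp
        ultimately show ?thesis by linarith
      qed
      then show ?thesis using 1 by (simp add: algebra_simps)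
    next
      case 2
      then show ?thesis using assms(1) by (simp add: algebra_simps)
    next
      case 3
      have "?cf j = ?s * (1 - (real (Suc r) + 1 - real j) * \<alpha>) + \<alpha> * (real r + 2 - real j - \<alpha>)"
        using 3 by (simp add: of_nat_diff algebra_simps)
      moreover have "0 \<le> \<alpha> * (real r + 2 - real j - \<alpha>)" using 3 assms(1,2) by (intro mult_nonneg_nonneg) auto
      ultimately show ?thesis by linarith
    qed
  qed
  have "?s * (\<Sum>j=1..Suc (Suc r). (1 - (real (Suc r) + 1 - real j) * \<alpha>) * g j) \<le> (\<Sum>j=1..Suc (Suc r). ?cf j * g j)"
    unfolding sum_distrib_left mult.assoc[symmetric] using coeff Suc.prems
    by (intro sum_mono mult_right_mono) auto
  also have "\<dots> = (\<Sum>j=1..Suc r. ?\<beta> j * (real j + \<alpha>) * g (Suc j)) + (\<Sum>j=1..Suc r. ?\<beta> j * (real r + 2 - real j - \<alpha>) * g j)"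
    unfolding sum_shift_urn[of "\<lambda>j. ?\<beta> j * (real j + \<alpha>)"] sum_drop_last[of "\<lambda>j. ?\<beta> j * (real r + 2 - real j - \<alpha>)"]
      sum.distrib[symmetric] by (intro sum.cong refl) (simp only: distrib_right)
  also have "\<dots> = (\<Sum>j=1..Suc r. ?\<beta> j * ?T j) * (real r + 2)"
    unfolding sum.distrib[symmetric] sum_distrib_right
  proof (rule sum.cong[OF refl])
    fix j
    have cancel: "b * (N / c) * c = b * N" if "c \<noteq> 0" for b N c :: real using that by simp
    have r2: "real r + 2 \<noteq> 0" by linarith
    show "?\<beta> j * (real j + \<alpha>) * g (Suc j) + ?\<beta> j * (real r + 2 - real j - \<alpha>) * g j = ?\<beta> j * ?T j * (real r + 2)"
      unfolding cancel[OF r2] 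
      by (rule trans[OF _ distrib_left[symmetric]]) (simp only: mult.assoc)
  qed
  finally have "(\<Sum>j=1..Suc (Suc r). (1 - (real (Suc r) + 1 - real j) * \<alpha>) * g j) / (real r + 2) \<le> (\<Sum>j=1..Suc r. ?\<beta> j * ?T j) / ?s"
    by (simp only: pos_le_divide_eq) (simp add: mult.commute pos_divide_le_eq)
  also have "\<dots> \<le> urn \<alpha> r ?T"
  proof (rule Suc.IH)
    fix j assume j: "1 \<le> j" "j \<le> Suc r"
    then show "0 \<le> ?T j" using assms(1,2) Suc.prems[of j] Suc.prems[of "Suc j"]
      by (intro divide_nonneg_nonneg add_nonneg_nonneg mult_nonneg_nonneg) auto
  qed
  finally show ?case by (simp add: add_ac)
qed simp

section \<open>Logarithmic drift of the largest block\<close>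

text \<open>If one part \<open>j\<close> has at least two thirds of a block of \<open>m\<close>, the
  other parts are at most half of \<open>j\<close>, so each of their \<open>m - j\<close> letters
  falls short of the maximum by at least \<open>ln 2\<close> in logarithm. The slack is credited to
  the large part; the factor \<open>1 - j / m\<close> keeps its size-biased weight below
  \<open>ln 2 * (m - j)\<close>.\<close>

definition gain :: "nat \<Rightarrow> nat \<Rightarrow> real" where
  "gain m j = (if 2 * m \<le> 3 * j then ln 2 * (1 - real j / real m) else 0)"

lemma sum_ln_lower:
  assumes "1 \<le> m"
  shows "real m * ln (real m) - real m + 1 \<le> (\<Sum>j=1..m. ln (real j))"
  using assms
proof (induction m rule: dec_induct)
  case (step m)
  have "ln (real (Suc m)) - ln (real m) = ln (real (Suc m) / real m)" using step by (simp add: ln_div)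
  also have "\<dots> = ln (1 + 1 / real m)" using step by (simp add: add_divide_distrib add.commute)
  also have "\<dots> \<le> 1 / real m" by (rule ln_add_one_self_le_self) simp
  finally have "real m * (ln (real (Suc m)) - ln (real m)) \<le> real m * (1 / real m)" by (intro mult_left_mono) auto
  then have "real m * ln (real (Suc m)) - real m * ln (real m) \<le> 1" using step by (simp add: right_diff_distrib)
  then show ?case using step by (simp add: distrib_right)
qed simp

text \<open>Splitting \<open>1 / 2 = 3 / 4 * (2 / 3)\<close> makes \<open>ln x \<le> x - 1\<close>
  sharp enough: the gain of \<open>1 / 100\<close> requires
  \<open>ln 2 \<ge> 54 / 100\<close>.\<close>

lemma ln_2_lower: "7 / 12 \<le> ln (2::real)"
proof -
  have "ln (3 / 4 * (2 / 3)) = ln (3 / 4) + ln (2 / 3 :: real)" by (rule ln_mult_pos) simp_all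
  also have "\<dots> \<le> (3 / 4 - 1) + (2 / 3 - 1)" by (intro add_mono ln_le_minus_one) simp_all
  finally have "ln (1 / 2 :: real) \<le> - 7 / 12" by simp
  then show ?thesis by (simp add: ln_div)
qed

lemma gain_nonneg: "j \<le> m \<Longrightarrow> 0 \<le> gain m j"
  by (cases "m = 0") (auto simp: gain_def intro!: mult_nonneg_nonneg)

lemma sum_gain_lower:
  assumes "4 \<le> m"
  shows "real m / 36 * ln 2 \<le> (\<Sum>j=1..m. gain m j)"
proof -
  define q where "q = m div 3"
  have q: "3 * q \<le> m" "m \<le> 3 * q + 2" unfolding q_def by linarith+
  have "(\<Sum>i\<le>q. real i) = real q * (real q + 1) / 2" by (induction q) (simp_all add: field_simps)
  moreover have "real m * real m \<le> 18 * (real q * (real q + 1))"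
  proof -
    have "1 \<le> q" using q assms by linarith
    then have "real m \<le> 3 * real q + 2" "1 \<le> real q" using q by linarith+
    then have "real m * real m \<le> (3 * real q + 2) * (3 * real q + 2)" by (intro mult_mono) auto
    also have "\<dots> \<le> 18 * (real q * (real q + 1))"
      using mult_mono[of 1 "real q" 1 "real q"] \<open>1 \<le> real q\<close> by (simp add: algebra_simps)
    finally show ?thesis .
  qed
  ultimately have "real m * real m / 36 \<le> (\<Sum>i\<le>q. real i)" by linarith
  then have "real m * real m / 36 / real m \<le> (\<Sum>i\<le>q. real i) / real m" by (intro divide_right_mono) auto
  then have "real m / 36 * ln 2 \<le> (\<Sum>i\<le>q. real i) / real m * ln 2" using assms by (intro mult_right_mono) auto
  also have "\<dots> = (\<Sum>i\<le>q. gain m (m - i))"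
    unfolding sum_divide_distrib sum_distrib_right
    using q assms by (intro sum.cong) (auto simp: gain_def of_nat_diff field_simps)
  also have "\<dots> = (\<Sum>j\<in>(\<lambda>i. m - i) ` {..q}. gain m j)"
  proof -
    have "inj_on (\<lambda>i. m - i) {..q}" using q by (intro inj_onI) auto
    then show ?thesis by (simp add: sum.reindex)
  qed
  also have "\<dots> \<le> (\<Sum>j=1..m. gain m j)"
    using q assms by (intro sum_mono2) (auto intro: gain_nonneg)
  finally show ?thesis .
qed

text \<open>The mean of \<open>ln\<close> over \<open>{1..m}\<close> is at least
  \<open>ln m - 1 + 1 / m\<close>. For \<open>m \<le> 3\<close> the term \<open>1 / m\<close>
  supplies the missing \<open>1 / 100\<close>; from 4 on the gain does, being at least
  \<open>2 / 3 * (1 / 36) * ln 2 = ln 2 / 54\<close>.\<close>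

lemma urn_drift:
  assumes "1 \<le> m" "m \<le> n"
  shows "ln (real m) - 99 / 100 \<le> urn (1 / real n) (m - 1) (\<lambda>j. ln (real j) + gain m j)"
proof -
  let ?\<alpha> = "1 / real n"
  have \<alpha>: "0 \<le> ?\<alpha>" "?\<alpha> \<le> 1" using assms by auto
  have m: "Suc (m - 1) = m" "real (m - 1) + 1 = real m" using assms by auto
  have "(real m * ln (real m) - real m + 1) / real m \<le> (\<Sum>j=1..m. ln (real j)) / real m"
    using sum_ln_lower[OF assms(1)] by (intro divide_right_mono) auto
  also have "\<dots> \<le> urn ?\<alpha> (m - 1) (\<lambda>j. ln (real j))"
    using urn_increasing[OF \<alpha>, of "m - 1" "\<lambda>j. ln (real j)"] unfolding m by simp
  finally have 1: "ln (real m) - 1 + 1 / real m \<le> urn ?\<alpha> (m - 1) (\<lambda>j. ln (real j))"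
    using assms by (simp add: add_divide_distrib diff_divide_distrib)
  have gain: "(\<Sum>j=1..m. (1 - (real m - real j) * ?\<alpha>) * gain m j) / real m \<le> urn ?\<alpha> (m - 1) (gain m)"
    using urn_point_mass[OF \<alpha>, of "m - 1" "gain m"] gain_nonneg[of _ m] unfolding m by blast
  \<comment> \<open>Where \<open>gain\<close> does not vanish,
    \<open>m - j \<le> m / 3 \<le> n / 3\<close>, so the correction to the uniform law costs at most
    a third.\<close>
  have le: "2 / 3 * gain m j \<le> (1 - (real m - real j) * ?\<alpha>) * gain m j" if "j \<in> {1..m}" for j
  proof (cases "2 * m \<le> 3 * j")
    case True
    then have "real (2 * m) \<le> real (3 * j)" by (simp only: of_nat_le_iff)
    then have "3 * (real m - real j) \<le> real m" by simp
    then have "3 * (real m - real j) \<le> real n" using assms by linarith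
    then have "(real m - real j) * ?\<alpha> \<le> 1 / 3" using assms by (simp add: field_simps)
    then show ?thesis using gain_nonneg[of j m] that by (intro mult_right_mono) auto
  next
    case False
    then show ?thesis by (simp add: gain_def)
  qed
  have "(\<Sum>j=1..m. 2 / 3 * gain m j) \<le> (\<Sum>j=1..m. (1 - (real m - real j) * ?\<alpha>) * gain m j)"
    using le by (rule sum_mono)
  then have "(\<Sum>j=1..m. 2 / 3 * gain m j) / real m \<le> urn ?\<alpha> (m - 1) (gain m)"
    using gain by (meson divide_right_mono of_nat_0_le_iff order_trans)
  then have 2: "2 / 3 * (\<Sum>j=1..m. gain m j) / real m \<le> urn ?\<alpha> (m - 1) (gain m)"
    by (simp add: sum_distrib_left)
  have "1 / 100 \<le> 1 / real m + urn ?\<alpha> (m - 1) (gain m)"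
  proof (cases "4 \<le> m")
    case True
    have "2 / 3 * (real m / 36 * ln 2) / real m \<le> 2 / 3 * (\<Sum>j=1..m. gain m j) / real m"
      using sum_gain_lower[OF True] by (intro divide_right_mono mult_left_mono) auto
    then have "ln 2 / 54 \<le> urn ?\<alpha> (m - 1) (gain m)" using 2 assms by simp
    then have "1 / 100 \<le> urn ?\<alpha> (m - 1) (gain m)" using ln_2_lower by linarith
    then show ?thesis by (simp add: add_increasing)
  next
    case False
    have "0 \<le> (\<Sum>j=1..m. gain m j)" by (intro sum_nonneg gain_nonneg) auto
    then have "0 \<le> 2 / 3 * (\<Sum>j=1..m. gain m j) / real m" by simp
    then have "0 \<le> urn ?\<alpha> (m - 1) (gain m)" using 2 by linarith
    moreover have "1 / 100 \<le> 1 / real m"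
    proof -
      have "real m \<le> 100" using False by linarith
      then show ?thesis using assms by (intro divide_left_mono) auto
    qed
    ultimately show ?thesis by linarith
  qed
  then show ?thesis using 1 unfolding urn_add by linarith
qed

text \<open>The size-biased average of \<open>ln\<close> is below \<open>ln\<close> of the maximum; \<open>gain\<close> is part of the slack,
  present when one part dominates.\<close>

lemma size_biased_ln_le:
  fixes N :: "nat \<Rightarrow> nat"
  assumes A: "finite A" "(\<Sum>b\<in>A. N b) = m" and m: "1 \<le> m"
    and L: "1 \<le> L" "\<And>b. b \<in> A \<Longrightarrow> real (N b) \<le> L"
  shows "(\<Sum>b\<in>A. real (N b) * (ln (real (N b)) + gain m (N b))) \<le> real m * ln L"
proof (cases "\<exists>b\<in>A. 2 * m \<le> 3 * N b")
  case True
  then obtain c where c: "c \<in> A" "2 * m \<le> 3 * N c" by blast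
  have split: "(\<Sum>b\<in>A. F b) = F c + (\<Sum>b\<in>A - {c}. F b)" for F :: "nat \<Rightarrow> real"
    using A(1) c(1) by (rule sum.remove)
  have rest: "(\<Sum>b\<in>A - {c}. N b) = m - N c" "N c \<le> m"
    using sum.remove[OF A(1) c(1), of N] A(2) by auto
  have other: "real (N b) * (ln (real (N b)) + gain m (N b)) \<le> real (N b) * (ln L - ln 2)" if b: "b \<in> A - {c}" for b
  proof (cases "N b = 0")
    case False
    have "N b \<le> m - N c" using member_le_sum[of b "A - {c}" N] b A(1) rest(1) by auto
    then have Nb: "3 * N b \<le> m" using c(2) rest(2) by linarith
    then have "gain m (N b) = 0" using False by (simp add: gain_def)
    moreover have "ln (real (N b)) \<le> ln (L / 2)"
    proof -
      have "2 * real (N b) \<le> real (N c)" using Nb c(2) by linarith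
      then have "real (N b) \<le> L / 2" using L(2)[OF c(1)] by linarith
      then show ?thesis using False by simp
    qed
    then have "ln (real (N b)) \<le> ln L - ln 2" using L(1) by (simp add: ln_div)
    ultimately show ?thesis by (intro mult_left_mono) auto
  qed simp
  have rest': "(\<Sum>b\<in>A - {c}. real (N b)) = real m - real (N c)"
    using rest by (simp add: of_nat_diff flip: of_nat_sum)
  have "(\<Sum>b\<in>A - {c}. real (N b) * (ln (real (N b)) + gain m (N b))) \<le> (\<Sum>b\<in>A - {c}. real (N b) * (ln L - ln 2))"
    using other by (rule sum_mono)
  also have "\<dots> = (real m - real (N c)) * (ln L - ln 2)"
    unfolding sum_distrib_right[symmetric] rest' ..
  finally have 1: "(\<Sum>b\<in>A - {c}. real (N b) * (ln (real (N b)) + gain m (N b))) \<le> (real m - real (N c)) * (ln L - ln 2)" .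
  have Nc: "1 \<le> N c" using c(2) m by linarith
  have "real (N c) * gain m (N c) \<le> ln 2 * (real m - real (N c))"
  proof -
    have "real (N c) * gain m (N c) = ln 2 * (real m - real (N c)) * (real (N c) / real m)"
      using c(2) m by (simp add: gain_def field_simps)
    also have "\<dots> \<le> ln 2 * (real m - real (N c)) * 1"
      using rest(2) m by (intro mult_left_mono) auto
    finally show ?thesis by simp
  qed
  moreover have "real (N c) * ln (real (N c)) \<le> real (N c) * ln L"
    using L(2)[OF c(1)] Nc by (intro mult_left_mono) auto
  ultimately have "real (N c) * (ln (real (N c)) + gain m (N c)) \<le> real (N c) * ln L + ln 2 * (real m - real (N c))"
    by (simp add: distrib_left)
  then show ?thesis unfolding split using 1 by (simp add: algebra_simps)
next
  case False
  have "(\<Sum>b\<in>A. real (N b) * (ln (real (N b)) + gain m (N b))) \<le> (\<Sum>b\<in>A. real (N b) * ln L)"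
  proof (rule sum_mono)
    fix b assume b: "b \<in> A"
    then have "gain m (N b) = 0" using False by (simp add: gain_def)
    then show "real (N b) * (ln (real (N b)) + gain m (N b)) \<le> real (N b) * ln L"
      using L(2)[OF b] by (cases "N b = 0") (auto intro!: mult_left_mono)
  qed
  also have "\<dots> = real m * ln L" using A(2) by (simp add: sum_distrib_right[symmetric] flip: of_nat_sum)
  finally show ?thesis .
qed

section \<open>The largest letter count when k = n\<close>

definition maxc :: "nat \<Rightarrow> (nat \<Rightarrow> nat) \<Rightarrow> nat" where
  "maxc n y = Max (cnt {1..n} y ` {1..n})"

locale square_chain =
  fixes n :: nat
  assumes n2: "2 \<le> n"

sublocale square_chain \<subseteq> word_chain n n
  using n2 by unfold_locales simp

context square_chain
begin

lemma maxc_ge: "b \<in> {1..n} \<Longrightarrow> cnt {1..n} y b \<le> maxc n y"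
  unfolding maxc_def by (intro Max_ge) auto

lemma maxc_attained: "\<exists>a\<in>{1..n}. cnt {1..n} y a = maxc n y"
proof -
  have "maxc n y \<in> cnt {1..n} y ` {1..n}" unfolding maxc_def using n2 by (intro Max_in) auto
  then show ?thesis by auto
qed

lemma cnt_le: "cnt {1..n} y b \<le> n"
proof -
  have "card {i\<in>{1..n}. y i = b} \<le> card {1..n}" by (intro card_mono) auto
  then show ?thesis by (simp add: cnt_def)
qed

lemma maxc_le: "maxc n y \<le> n"
  using maxc_attained[of y] cnt_le by metis

lemma maxc_pos:
  assumes "y \<in> words n n"
  shows "1 \<le> maxc n y"
proof (rule ccontr)
  assume "\<not> 1 \<le> maxc n y"
  then have "cnt {1..n} y b = 0" if "b \<in> {1..n}" for b using maxc_ge[OF that, of y] by linarith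
  moreover have "(\<Sum>b=1..n. cnt {1..n} y b) = n" using assms by (subst cnt_sum) (auto simp: words_def)
  ultimately show False using n2 by simp
qed

text \<open>A random letter of the largest block size-biases the parts into which this block splits,
  and no part exceeds a letter count of \<open>y\<close>; so the size-biased mean of the logarithm
  bounds \<open>ln (maxc n y)\<close> from below, with \<open>gain\<close> to spare.\<close>

lemma step_ln_maxc:
  assumes x: "x \<in> words n n"
  shows "ln (real (maxc n x)) - 99 / 100 \<le> K.step (\<lambda>y. ln (real (maxc n y))) x"
proof -
  let ?I = "{1..n}"
  obtain a where a: "a \<in> ?I" "cnt ?I x a = maxc n x" using maxc_attained by blast
  define m where "m = maxc n x"
  have m: "1 \<le> m" "m \<le> n" "cnt ?I x a = m" using maxc_pos[OF x] maxc_le a by (auto simp: m_def)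
  let ?N = "\<lambda>y b. cnt2 ?I x y a b"
  let ?g = "\<lambda>j. ln (real j) + gain m j"
  have al: "0 < 1 / real n" "1 \<le> n" "real n * (1 / real n) = 1" using n2 by auto
  have xI: "x ` ?I \<subseteq> {1..n}" using x by (auto simp: words_def)
  have "real m * (ln (real m) - 99 / 100) \<le> real m * urn (1 / real n) (m - 1) ?g"
    using urn_drift[OF m(1,2)] by (intro mult_left_mono) auto
  also have "\<dots> = avg (wrd ?I n) (kap (1 / real n) n ?I x) (\<lambda>y. \<Sum>b=1..n. real (?N y b) * ?g (?N y b))"
    using urn_size_biased[of ?I x n "1 / real n" a ?g] al xI m(3) by (simp only: finite_atLeastAtMost)
  also have "\<dots> \<le> avg (wrd ?I n) (kap (1 / real n) n ?I x) (\<lambda>y. real m * ln (real (maxc n y)))"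
  proof (rule avg_mono)
    fix y assume y: "y \<in> wrd ?I n"
    show "(\<Sum>b=1..n. real (?N y b) * ?g (?N y b)) \<le> real m * ln (real (maxc n y))"
    proof (rule size_biased_ln_le)
      show "(\<Sum>b=1..n. ?N y b) = m" using y m(3) by (subst cnt2_sum) auto
      show "1 \<le> real (maxc n y)" using maxc_pos[of y] y by (simp add: words_def)
      fix b assume b: "b \<in> {1..n}"
      have "?N y b \<le> cnt ?I y b" unfolding cnt2_def cnt_def by (intro card_mono) auto
      then show "real (?N y b) \<le> real (maxc n y)" using maxc_ge[OF b, of y] by linarith
    qed (use m(1) in auto)
  qed (simp add: kap_nonneg)
  also have "\<dots> = real m * K.step (\<lambda>y. ln (real (maxc n y))) x"
    unfolding avg_scale step_K_eq[OF x] ..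
  finally show ?thesis using m(1) by (simp add: m_def)
qed

lemma funpow_ln_maxc:
  assumes "x \<in> words n n"
  shows "ln (real (maxc n x)) - real t * (99 / 100) \<le> (K.step ^^ t) (\<lambda>y. ln (real (maxc n y))) x"
  using assms
proof (induction t arbitrary: x)
  case (Suc t)
  have "1 * K.step (\<lambda>y. ln (real (maxc n y))) x + - (real t * (99 / 100))
      = K.step (\<lambda>y. 1 * ln (real (maxc n y)) + - (real t * (99 / 100))) x"
    using K.step_affine[OF Suc.prems] by metis
  also have "\<dots> \<le> K.step ((K.step ^^ t) (\<lambda>y. ln (real (maxc n y)))) x"
    using Suc.IH by (intro K.step_mono[OF Suc.prems]) auto
  finally show ?case using step_ln_maxc[OF Suc.prems] by (simp add: field_simps)
qed simp

end

section \<open>The largest block under the stationary law\<close>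

text \<open>Rising factorials are the moments adapted to this urn: for
  \<open>?P N = pochhammer (N + 1) p\<close> the identity
  \<open>(N + 1) * ?P (Suc N) = (N + 1 + p) * ?P N\<close> makes every draw multiply the mean by a
  deterministic factor.\<close>

lemma avg_pochhammer_cnt:
  assumes "finite I" "a \<in> {1..k}" "b \<in> {1..k}" "\<And>i. i \<in> I \<Longrightarrow> x i = a"
  shows "avg (wrd I k) (kap 1 k I x) (\<lambda>y. pochhammer (real (cnt I y b) + 1) p)
    = fact p * (\<Prod>r<card I. 1 + real p / (real k + real r))"
  using assms(1,4)
proof (induction I)
  case empty
  show ?case by (simp add: avg_def pochhammer_fact)
next
  case (insert i I)
  let ?P = "\<lambda>N :: nat. pochhammer (real N + 1) p"
  have xi: "x i \<in> {1..k}" "x i = a" using insert.prems assms(2) by auto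
  have k: "1 \<le> k" using assms(2) by simp
  have c2: "cnt2 I x u a = cnt I u" "cnt I x a = card I" for u
  proof -
    have "{j \<in> I. (x j, u j) = (a, b)} = {j \<in> I. u j = b}" for b using insert.prems by auto
    then show "cnt2 I x u a = cnt I u" by (intro ext) (simp add: cnt2_def cnt_def)
    have "{j \<in> I. x j = a} = I" using insert.prems by auto
    then show "cnt I x a = card I" by (simp add: cnt_def)
  qed
  have ratio: "(real N + 1) * ?P (Suc N) = (real N + 1 + real p) * ?P N" for N
    using pochhammer_rec[of "real N + 1" p] pochhammer_rec'[of "real N + 1" p] by (simp add: add_ac)
  let ?c = "1 + real p / (real k + real (card I))"
  have inner: "(\<Sum>c=1..k. wt 1 k I x u (x i) c * ?P (cnt (insert i I) (u(i := c)) b)) = ?c * ?P (cnt I u b)"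
    if u: "u \<in> wrd I k" for u
  proof -
    have upd: "cnt (insert i I) (u(i := c)) b = cnt I u b + (if c = b then 1 else 0)" for c
      using insert.hyps by (simp add: cnt_insert)
    have "(\<Sum>c=1..k. wt 1 k I x u (x i) c * ?P (cnt (insert i I) (u(i := c)) b))
       = (\<Sum>c=1..k. wt 1 k I x u (x i) c * ?P (cnt I u b) +
           (if c = b then wt 1 k I x u (x i) b * (?P (Suc (cnt I u b)) - ?P (cnt I u b)) else 0))"
      unfolding upd by (intro sum.cong) (auto simp: algebra_simps)
    also have "\<dots> = ?P (cnt I u b) + wt 1 k I x u (x i) b * (?P (Suc (cnt I u b)) - ?P (cnt I u b))"
      unfolding sum.distrib sum_distrib_right[symmetric] wt_sum[OF insert.hyps(1) zero_less_one k u]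
      using assms(3) by simp
    also have "wt 1 k I x u (x i) b = (real (cnt I u b) + 1) / (real k + real (card I))"
      unfolding wt_def xi(2) c2 by simp
    also have "(real (cnt I u b) + 1) / (real k + real (card I)) * (?P (Suc (cnt I u b)) - ?P (cnt I u b))
        = ((real (cnt I u b) + 1) * ?P (Suc (cnt I u b)) - (real (cnt I u b) + 1) * ?P (cnt I u b)) / (real k + real (card I))"
      by (simp only: right_diff_distrib times_divide_eq_left diff_divide_distrib)
    also have "\<dots> = real p * ?P (cnt I u b) / (real k + real (card I))"
      unfolding ratio by (simp add: algebra_simps)
    finally show ?thesis by (simp add: distrib_right fun_upd_def)
  qed
  have "avg (wrd (insert i I) k) (kap 1 k (insert i I) x) (\<lambda>y. ?P (cnt (insert i I) y b))
      = avg (wrd I k) (kap 1 k I x) (\<lambda>u. ?c * ?P (cnt I u b))"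
    unfolding avg_kap_insert[where x = x, OF insert.hyps(1,2) xi(1)] by (intro avg_cong inner)
  also have "\<dots> = ?c * (fact p * (\<Prod>r<card I. 1 + real p / (real k + real r)))"
    using insert unfolding avg_scale by simp
  finally show ?case using insert.hyps by (simp add: mult_ac)
qed

lemma power_le_pochhammer: "0 \<le> (x::real) \<Longrightarrow> x ^ p \<le> pochhammer x p"
  by (induction p) (auto simp: pochhammer_Suc mult.commute[of x] intro!: mult_mono pochhammer_ge_0)

context square_chain
begin

lemma avg_law_eq: "avg (words n n) \<pi>\<^sub>K f = avg (wrd {1..n} n) (kap 1 n {1..n} (const_word n 1)) f"
  unfolding avg_def words_def[symmetric] using n2
  by (intro sum.cong refl arg_cong2[where f = "(*)"] law_K_eq) auto

text \<open>The \<open>p\<close>-th power of the maximum is at most the sum of the rising factorials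
  of all counts, whose mean is at most \<open>n * fact p * exp p\<close>; Jensen's inequality takes
  the logarithm outside. A large \<open>p\<close> makes the coefficient of \<open>ln n\<close>
  small.\<close>

lemma avg_law_ln_maxc:
  "real p * avg (words n n) \<pi>\<^sub>K (\<lambda>y. ln (real (maxc n y))) \<le> ln (real n) + ln (fact p) + real p"
proof -
  let ?P = "\<lambda>N :: nat. pochhammer (real N + 1) p"
  let ?S = "\<lambda>y. \<Sum>b=1..n. ?P (cnt {1..n} y b)"
  \<comment> \<open>This bounds the mean of \<open>?S\<close>; Jensen's inequality takes the form of
    the tangent bound \<open>ln s \<le> s / A + ln A - 1\<close>.\<close>
  define A where "A = real n * (fact p * exp (real p))"
  have A: "0 < A" using n2 by (simp add: A_def)
  have one: "1 \<in> {1..n}" using n2 by simp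
  have mean: "avg (words n n) \<pi>\<^sub>K (\<lambda>y. ?P (cnt {1..n} y b)) \<le> fact p * exp (real p)" if b: "b \<in> {1..n}" for b
  proof -
    have "(\<Prod>r<n. 1 + real p / (real n + real r)) \<le> (\<Prod>r<n. exp (real p / real n))"
    proof (intro prod_mono conjI)
      fix r
      have "1 + real p / (real n + real r) \<le> 1 + real p / real n"
        using n2 by (intro add_left_mono divide_left_mono) auto
      also have "\<dots> \<le> exp (real p / real n)" by (rule exp_ge_add_one_self)
      finally show "1 + real p / (real n + real r) \<le> exp (real p / real n)" .
    qed simp
    also have "\<dots> = exp (real p)" using n2 by (simp add: exp_of_nat_mult[symmetric])
    finally show ?thesis
      using avg_pochhammer_cnt[of "{1..n}" 1 n b "const_word n 1" p] one b
      by (simp add: avg_law_eq const_word_apply del: One_nat_def atLeastAtMost_iff)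
  qed
  have "avg (words n n) \<pi>\<^sub>K (\<lambda>y. real p * ln (real (maxc n y)))
      \<le> avg (words n n) \<pi>\<^sub>K (\<lambda>y. ?S y / A + (ln A - 1))"
  proof (rule avg_mono)
    fix y assume y: "y \<in> words n n"
    obtain b where b: "b \<in> {1..n}" "cnt {1..n} y b = maxc n y" using maxc_attained by blast
    have mp: "0 < real (maxc n y)" using maxc_pos[OF y] by simp
    have nn: "0 \<le> ?P N" for N by (intro pochhammer_ge_0) simp
    have "real (maxc n y) ^ p \<le> (real (maxc n y) + 1) ^ p" by (intro power_mono) auto
    also have "\<dots> \<le> ?P (cnt {1..n} y b)" unfolding b(2) by (intro power_le_pochhammer) simp
    also have "\<dots> \<le> ?S y" using b(1) nn by (intro member_le_sum) auto
    finally have le: "real (maxc n y) ^ p \<le> ?S y" .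
    have pos: "0 < real (maxc n y) ^ p" using mp by simp
    have S: "0 < ?S y" using le pos by linarith
    have "real p * ln (real (maxc n y)) = ln (real (maxc n y) ^ p)" using mp by (simp add: ln_realpow)
    also have "\<dots> \<le> ln (?S y)" using le pos S by (subst ln_le_cancel_iff) auto
    also have "\<dots> = ln (?S y / A) + ln A" using S A by (simp add: ln_div)
    also have "\<dots> \<le> ?S y / A + (ln A - 1)" using ln_le_minus_one[of "?S y / A"] S A by simp
    finally show "real p * ln (real (maxc n y)) \<le> ?S y / A + (ln A - 1)" .
  qed (rule K.law_nonneg)
  also have "\<dots> = (\<Sum>b=1..n. avg (words n n) \<pi>\<^sub>K (\<lambda>y. ?P (cnt {1..n} y b))) / A + (ln A - 1)"
    by (simp only: avg_add avg_const avg_sum_divide law_K_sum mult_1_right)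
  also have "\<dots> \<le> 1 + (ln A - 1)"
  proof -
    have "(\<Sum>b=1..n. avg (words n n) \<pi>\<^sub>K (\<lambda>y. ?P (cnt {1..n} y b))) \<le> (\<Sum>b=1..n. fact p * exp (real p))"
      using mean by (intro sum_mono)
    also have "\<dots> = A" by (simp add: A_def)
    finally show ?thesis using A by simp
  qed
  also have "1 + (ln A - 1) = ln (real n) + ln (fact p) + real p"
    using n2 by (simp add: A_def ln_mult)
  finally show ?thesis by (simp only: avg_scale)
qed

end

section \<open>The lower bound for equally many letters and positions\<close>

lemma (in finite_chain) funpow_affine:
  "s \<in> S \<Longrightarrow> (step ^^ t) (\<lambda>r. a * f r + b) s = a * (step ^^ t) f s + b"
proof (induction t arbitrary: s)
  case (Suc t)
  have "step ((step ^^ t) (\<lambda>r. a * f r + b)) = step (\<lambda>r. a * (step ^^ t) f r + b)"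
    by (intro step_cong Suc.IH)
  then show ?case using step_affine[OF Suc.prems] by simp
qed simp

text \<open>The positions outside \<open>A\<close> are revealed last and their predictive weights
  sum to 1: the urn laws for different sets of positions are consistent.\<close>

lemma avg_marginal:
  assumes "finite R" "finite A" "A \<inter> R = {}" "0 < \<alpha>" "1 \<le> k" "x ` R \<subseteq> {1..k}"
    and F: "\<And>y y'. (\<And>i. i \<in> A \<Longrightarrow> y i = y' i) \<Longrightarrow> F y = F y'"
  shows "avg (wrd (A \<union> R) k) (kap \<alpha> k (A \<union> R) x) F = avg (wrd A k) (kap \<alpha> k A x) F"
  using assms(1,3,6)
proof (induction R)
  case (insert i R)
  have i: "finite (A \<union> R)" "i \<notin> A \<union> R" "x i \<in> {1..k}" using insert assms(2) by auto
  have "(\<Sum>c=1..k. wt \<alpha> k (A \<union> R) x u (x i) c * F (u(i := c))) = F u" if u: "u \<in> wrd (A \<union> R) k" for u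
  proof -
    have "F (u(i := c)) = F u" for c by (rule F) (use i(2) in auto)
    then show ?thesis using wt_sum[OF i(1) assms(4,5) u] by (simp only: sum_distrib_right[symmetric] mult_1_left)
  qed
  then have "avg (wrd (insert i (A \<union> R)) k) (kap \<alpha> k (insert i (A \<union> R)) x) F = avg (wrd (A \<union> R) k) (kap \<alpha> k (A \<union> R) x) F"
    unfolding avg_kap_insert[where x = x, OF i] by (rule avg_cong)
  then show ?case using insert by simp
qed simp

context square_chain
begin

lemma dK_lower_large:
  assumes "ln (fact 400) + 400 \<le> ln (real n)" "a \<in> {1..n}" "real l \<le> ln (real n)"
  shows "1 / 200 \<le> dK_from n n (const_word n a) l"
proof -
  let ?x = "const_word n a" and ?h = "\<lambda>y. ln (real (maxc n y))"
  let ?f = "\<lambda>y. 1 / ln (real n) * ?h y + 0"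
  have x: "?x \<in> words n n" by (rule const_word_words[OF assms(2)])
  have L: "0 < ln (real n)" using n2 by simp
  have "cnt {1..n} ?x a = n"
  proof -
    have "{i\<in>{1..n}. ?x i = a} = {1..n}" using const_word_apply by auto
    then show ?thesis by (simp add: cnt_def)
  qed
  then have mx: "maxc n ?x = n" using maxc_ge[OF assms(2), of ?x] maxc_le[of ?x] by simp
  have unit: "unit_valued (words n n) ?f"
    unfolding unit_valued_def
  proof (intro ballI conjI)
    fix y assume y: "y \<in> words n n"
    have "1 \<le> real (maxc n y)" "real (maxc n y) \<le> real n" using maxc_pos[OF y] maxc_le[of y] by auto
    then have "0 \<le> ?h y" "?h y \<le> ln (real n)" by auto
    then show "0 \<le> ?f y" "?f y \<le> 1" using L by auto
  qed
  have "(ln (real n) - real l * (99 / 100)) \<le> (K.step ^^ l) ?h ?x"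
    using funpow_ln_maxc[OF x, of l] mx by simp
  then have "ln (real n) * (1 / 100) \<le> (K.step ^^ l) ?h ?x" using assms(3) by argo
  \<comment> \<open>With \<open>p = 400\<close> and the assumption on \<open>n\<close> the
    stationary mean is at most \<open>(ln n) / 200\<close>, half of the \<open>(ln n) / 100\<close>
    that survives \<open>l\<close> steps from a constant word.\<close>
  moreover have "400 * avg (words n n) \<pi>\<^sub>K ?h \<le> 2 * ln (real n)"
    using avg_law_ln_maxc[of 400] assms(1) by simp
  ultimately have "ln (real n) * (1 / 200) \<le> (K.step ^^ l) ?h ?x - avg (words n n) \<pi>\<^sub>K ?h" by linarith
  then have "1 / ln (real n) * (ln (real n) * (1 / 200)) \<le> 1 / ln (real n) * ((K.step ^^ l) ?h ?x - avg (words n n) \<pi>\<^sub>K ?h)"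
    using L by (intro mult_left_mono) auto
  then have "1 / 200 \<le> 1 / ln (real n) * ((K.step ^^ l) ?h ?x - avg (words n n) \<pi>\<^sub>K ?h)"
    using L by simp
  also have "\<dots> = (K.step ^^ l) ?f ?x - avg (words n n) \<pi>\<^sub>K ?f"
    unfolding K.funpow_affine[OF x] avg_affine by (simp add: right_diff_distrib)
  also have "\<dots> \<le> dK_from n n ?x l"
    unfolding dK_from_eq by (rule K.dist_from_ge[OF x unit])
  finally show ?thesis .
qed

text \<open>The indicator of \<open>x\<^sub>1 = x\<^sub>2\<close> is, up to an additive constant, an eigenfunction.\<close>

lemma step_pair:
  assumes w: "w \<in> words n n"
  shows "K.step (\<lambda>y. of_bool (y 1 = y 2)) w
    = 1 / real n + (real n - 1) / (2 * real n) * of_bool (w 1 = w 2)"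
proof -
  let ?\<alpha> = "1 / real n" and ?F = "\<lambda>y :: nat \<Rightarrow> nat. of_bool (y 1 = y 2) :: real"
  have al: "0 < ?\<alpha>" "1 \<le> n" using n2 by auto
  have w12: "w 1 \<in> {1..n}" "w 2 \<in> {1..n}" using w n2 by (auto simp: words_def)
  have I: "{1..n} = {1, 2} \<union> {3..n}" using n2 by auto
  have fin2: "finite {2::nat}" "1 \<notin> {2::nat}" by auto
  have "K.step ?F w = avg (wrd ({1, 2} \<union> {3..n}) n) (kap ?\<alpha> n ({1, 2} \<union> {3..n}) w) ?F"
    by (simp only: step_K_eq[OF w] I[symmetric])
  also have "\<dots> = avg (wrd {1, 2} n) (kap ?\<alpha> n {1, 2} w) ?F"
  proof (rule avg_marginal[where F = ?F, OF _ _ _ al])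
    show "w ` {3..n} \<subseteq> {1..n}"
    proof (rule image_subsetI)
      fix i assume "i \<in> {3..n}"
      then have "i \<in> {1..n}" by simp
      then show "w i \<in> {1..n}" using w unfolding words_def by (rule PiE_mem[rotated])
    qed
    show "{1, 2} \<inter> {3..n} = {}" by simp
    show "?F y = ?F y'" if "\<And>i. i \<in> {1, 2} \<Longrightarrow> y i = y' i" for y y' :: "nat \<Rightarrow> nat"
      using that[of 1] that[of 2] by simp
  qed (rule finite_atLeastAtMost, rule finite.intros, rule finite.intros, rule finite.intros)
  also have "\<dots> = avg (wrd {2} n) (kap ?\<alpha> n {2} w) (\<lambda>u. \<Sum>c=1..n. wt ?\<alpha> n {2} w u (w 1) c * ?F (u(1 := c)))"
    by (rule avg_kap_insert[where x = w, OF fin2 w12(1)])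
  also have "\<dots> = avg (wrd {2} n) (kap ?\<alpha> n {2} w) (\<lambda>u. 1 / real n + (real n - 1) / (2 * real n) * of_bool (w 1 = w 2))"
  proof (rule avg_cong)
    fix u assume u: "u \<in> wrd {2} n"
    have u2: "u 2 \<in> {1..n}" using u by auto
    have "(\<Sum>c=1..n. wt ?\<alpha> n {2} w u (w 1) c * ?F (u(1 := c)))
        = (\<Sum>c=1..n. if c = u 2 then wt ?\<alpha> n {2} w u (w 1) (u 2) else 0)"
      by (intro sum.cong) auto
    also have "\<dots> = wt ?\<alpha> n {2} w u (w 1) (u 2)" using u2 by simp
    also have "\<dots> = 1 / real n + (real n - 1) / (2 * real n) * of_bool (w 1 = w 2)"
    proof -
      have "cnt2 {2} w u (w 1) (u 2) = of_bool (w 1 = w 2)" "cnt {2} w (w 1) = of_bool (w 1 = w 2)"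
        using cnt2_insert[of "{}" 2 w u "w 1" "u 2"] cnt_insert[of "{}" 2 w "w 1"] by auto
      then show ?thesis using n2 by (auto simp: wt_def field_simps)
    qed
    finally show "(\<Sum>c=1..n. wt ?\<alpha> n {2} w u (w 1) c * ?F (u(1 := c)))
        = 1 / real n + (real n - 1) / (2 * real n) * of_bool (w 1 = w 2)" .
  qed
  also have "\<dots> = 1 / real n + (real n - 1) / (2 * real n) * of_bool (w 1 = w 2)"
    using sum_kap[of "{2}" ?\<alpha> n w] al w12(2) by (simp add: avg_const)
  finally show ?thesis .
qed

text \<open>The stationary probability of \<open>y 1 = y 2\<close> is
  \<open>2 / (n + 1) \<le> 2 / 3\<close>, so from a constant word the deviation starts at no less
  than \<open>1 / 3\<close>; each step multiplies it by the eigenvalue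
  \<open>(n - 1) / (2 * n)\<close>, at least \<open>1 / 4\<close> for
  \<open>n \<ge> 2\<close>.\<close>

lemma dK_lower_small:
  assumes a: "a \<in> {1..n}"
  shows "(1 / 4) ^ l / 3 \<le> dK_from n n (const_word n a) l"
proof -
  let ?x = "const_word n a" and ?F = "\<lambda>y :: nat \<Rightarrow> nat. of_bool (y 1 = y 2) :: real"
  let ?q = "(real n - 1) / (2 * real n)"
  define p where "p = avg (words n n) \<pi>\<^sub>K ?F"
  have x: "?x \<in> words n n" by (rule const_word_words[OF a])
  have n: "2 \<le> real n" using n2 by simp
  have "p = avg (words n n) \<pi>\<^sub>K (K.step ?F)" by (simp add: p_def K.avg_law_step)
  also have "\<dots> = avg (words n n) \<pi>\<^sub>K (\<lambda>w. ?q * ?F w + 1 / real n)"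
    by (intro avg_cong) (simp only: step_pair add.commute)
  also have "\<dots> = ?q * p + 1 / real n" by (simp only: avg_affine law_K_sum p_def mult_1_right)
  finally have p: "p = ?q * p + 1 / real n" .
  have "2 * real n * p = 2 * real n * (?q * p + 1 / real n)" using p by simp
  also have "\<dots> = (real n - 1) * p + 2" using n by (simp add: distrib_left)
  finally have "(real n + 1) * p = 2" by (simp add: algebra_simps)
  then have "p = 2 / (real n + 1)" using n by (simp add: eq_divide_eq mult.commute)
  also have "\<dots> \<le> 2 / 3" using n by (intro divide_left_mono) auto
  finally have p3: "p \<le> 2 / 3" .
  have arith: "Q * ((p - r * p) + r * F) + (p - Q * p) = p + r * Q * (F - p)" for Q r F p :: real
    by (simp add: algebra_simps)
  have iter: "(K.step ^^ t) ?F w = p + ?q ^ t * (?F w - p)" if "w \<in> words n n" for t w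
    using that
  proof (induction t arbitrary: w)
    case (Suc t)
    have "K.step ((K.step ^^ t) ?F) = K.step (\<lambda>w. ?q ^ t * ?F w + (p - ?q ^ t * p))"
    proof (rule K.step_cong)
      fix s assume "s \<in> words n n"
      then have "(K.step ^^ t) ?F s = p + (?q ^ t * ?F s - ?q ^ t * p)"
        by (simp only: Suc.IH right_diff_distrib)
      then show "(K.step ^^ t) ?F s = ?q ^ t * ?F s + (p - ?q ^ t * p)" by linarith
    qed
    then have "(K.step ^^ Suc t) ?F w = ?q ^ t * (1 / real n + ?q * ?F w) + (p - ?q ^ t * p)"
      by (simp only: funpow.simps o_apply K.step_affine[OF Suc.prems] step_pair[OF Suc.prems])
    also have "1 / real n = p - ?q * p" using p by linarith
    also have "?q ^ t * ((p - ?q * p) + ?q * ?F w) + (p - ?q ^ t * p) = p + ?q ^ Suc t * (?F w - p)"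
      unfolding power_Suc by (rule arith)
    finally show ?case .
  qed simp
  have q: "1 / 4 \<le> ?q" using n by (simp add: field_simps)
  have "(1 / 4) ^ l / 3 = (1 / 4) ^ l * (1 / 3 :: real)" by simp
  also have "\<dots> \<le> ?q ^ l * (1 - p)" using q p3 by (intro mult_mono power_mono zero_le_power) linarith+
  also have "\<dots> = (K.step ^^ l) ?F ?x - avg (words n n) \<pi>\<^sub>K ?F"
    unfolding p_def[symmetric] using iter[OF x, of l] n2 by (simp add: const_word_def)
  also have "\<dots> \<le> dK_from n n ?x l"
    unfolding dK_from_eq by (rule K.dist_from_ge[OF x]) (simp add: unit_valued_def)
  finally show ?thesis .
qed

lemma dK_Suc_le_dQ: "dK n n (Suc t) \<le> dQ n n t"
  unfolding dK_def dQ_def by (rule dist_worst_K_Suc_le)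

end

text \<open>Below the threshold of the moment argument,
  \<open>l \<le> ln n \<le> n < exp (ln (fact 400) + 400)\<close>, so an absolute number caps the
  exponent in the bound from the pair function.\<close>

definition BE_const :: real where
  "BE_const = min (1 / 200) ((1 / 4) ^ nat \<lceil>exp (ln (fact 400) + 400 :: real)\<rceil> / 3)"

lemma BE_const_pos: "0 < BE_const"
  by (simp add: BE_const_def)

context square_chain
begin

lemma dK_from_lower:
  assumes a: "a \<in> {1..n}" and l: "int l \<le> \<lfloor>ln (real n)\<rfloor>"
  shows "BE_const \<le> dK_from n n (const_word n a) l"
proof (cases "ln (fact 400) + 400 \<le> ln (real n)")
  case True
  have "real l \<le> ln (real n)" using l by linarith
  then show ?thesis using dK_lower_large[OF True a] by (simp add: BE_const_def min_le_iff_disj)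
next
  case False
  let ?N = "nat \<lceil>exp (ln (fact 400) + 400 :: real)\<rceil>"
  have "real l \<le> ln (real n)" using l by linarith
  also have "\<dots> \<le> exp (ln (real n))" using exp_ge_add_one_self[of "ln (real n)"] by linarith
  also have "\<dots> \<le> exp (ln (fact 400) + 400 :: real)" using False by simp
  finally have "l \<le> ?N" by linarith
  then have "(1 / 4 :: real) ^ ?N \<le> (1 / 4) ^ l" by (intro power_decreasing) auto
  then have "(1 / 4 :: real) ^ ?N / 3 \<le> (1 / 4) ^ l / 3" by simp
  also have "\<dots> \<le> dK_from n n (const_word n a) l" by (rule dK_lower_small[OF a])
  finally show ?thesis by (simp add: BE_const_def min_le_iff_disj)
qed

lemma dK_lower:
  assumes "int l \<le> \<lfloor>ln (real n)\<rfloor>"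
  shows "BE_const \<le> dK n n l"
proof -
  have one: "1 \<in> {1..n}" using n2 by simp
  have "BE_const \<le> dK_from n n (const_word n 1) l" by (rule dK_from_lower[OF one assms])
  also have "\<dots> \<le> dK n n l"
    unfolding dK_from_eq dK_def by (rule K.dist_worst_ge[OF const_word_words[OF one]])
  finally show ?thesis .
qed

lemma dQ_lower: "int t \<le> \<lfloor>ln (real n)\<rfloor> - 1 \<Longrightarrow> BE_const \<le> dQ n n t"
  using dK_lower[of "Suc t"] dK_Suc_le_dQ[of t] by simp

lemma tmix_lower:
  "enat (nat (\<lfloor>ln (real n)\<rfloor> + 1)) \<le> tmixK n n (BE_const / 2)"
  "enat (nat \<lfloor>ln (real n)\<rfloor>) \<le> tmixQ n n (BE_const / 2)"
proof -
  have half: "BE_const / 2 < BE_const" using BE_const_pos by simp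
  have "BE_const / 2 < dK n n t" if "t < nat (\<lfloor>ln (real n)\<rfloor> + 1)" for t
    using half dK_lower[of t] that by linarith
  then show "enat (nat (\<lfloor>ln (real n)\<rfloor> + 1)) \<le> tmixK n n (BE_const / 2)"
    unfolding tmixK_def mixing_time_def dK_def by (rule first_below_ge)
  have "BE_const / 2 < dQ n n t" if "t < nat \<lfloor>ln (real n)\<rfloor>" for t
    using half dQ_lower[of t] that by linarith
  then show "enat (nat \<lfloor>ln (real n)\<rfloor>) \<le> tmixQ n n (BE_const / 2)"
    unfolding tmixQ_def mixing_time_def dQ_def by (rule first_below_ge)
qed

end

theorem theorem5p17:
  shows
    \<comment> \<open>(a)\<close>
    "(\<forall>(n::nat) (k::nat). 1 \<le> n \<longrightarrow> 2 \<le> k \<longrightarrow>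
        (\<forall>t\<ge>1. dQ n k t \<le> (1 - 1 / fact n) ^ t \<and> dK n k t \<le> (1 - 1 / fact n) ^ t) \<and>
        (\<forall>\<epsilon>::real. 0 < \<epsilon> \<longrightarrow> \<epsilon> < 1 \<longrightarrow>
           tmixQ n k \<epsilon> \<le> enat (nat \<lceil>fact n * ln (1 / \<epsilon>)\<rceil>) \<and>
           tmixK n k \<epsilon> \<le> enat (nat \<lceil>fact n * ln (1 / \<epsilon>)\<rceil>)))
    \<and>
    \<comment> \<open>(b)\<close>
    (\<forall>(n::nat) (k::nat). 1 \<le> n \<longrightarrow> 2 \<le> k \<longrightarrow>
        (\<forall>t\<ge>1. dQ n k t \<le> real n * (1 - 1 / real k) ^ (t - 1)) \<and>
        (\<forall>\<epsilon>::real. 0 < \<epsilon> \<longrightarrow> \<epsilon> < 1 \<longrightarrow>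
           tmixQ n k \<epsilon> \<le> enat (1 + nat \<lceil>real k * ln (real n / \<epsilon>)\<rceil>)))
    \<and>
    \<comment> \<open>(c)\<close>
    (\<forall>k::nat. 2 \<le> k \<longrightarrow>
        (\<exists>c::real. 0 < c \<and> c < 1 \<and>
           (\<forall>(n::nat) g. 1 \<le> n \<longrightarrow> is_full_cycle n g \<longrightarrow>
              (\<forall>t\<ge>1. dQ_from n k g t \<le> (1 - c) ^ (t - 1)) \<and>
              (\<forall>\<epsilon>::real. 0 < \<epsilon> \<longrightarrow> \<epsilon> < 1 \<longrightarrow>
                 tmixQ_from n k g \<epsilon> \<le> enat (1 + nat \<lceil>inverse c * ln (1 / \<epsilon>)\<rceil>)))))
    \<and>
    \<comment> \<open>(d): here \<open>k = n\<close>, so \<open>k \<ge> 2\<close> reads \<open>n \<ge> 2\<close>\<close>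
    (\<exists>c::real. 0 < c \<and>
        (\<forall>n::nat. 2 \<le> n \<longrightarrow>
           (\<forall>a\<in>{1..n}. \<forall>l::nat. int l \<le> \<lfloor>ln (real n)\<rfloor> \<longrightarrow>
              c \<le> dK_from n n (const_word n a) l) \<and>
           (\<forall>l::nat. int l \<le> \<lfloor>ln (real n)\<rfloor> \<longrightarrow> c \<le> dK n n l) \<and>
           (\<forall>t::nat. int t \<le> \<lfloor>ln (real n)\<rfloor> - 1 \<longrightarrow> c \<le> dQ n n t) \<and>
           enat (nat (\<lfloor>ln (real n)\<rfloor> + 1)) \<le> tmixK n n (c / 2) \<and>
           enat (nat \<lfloor>ln (real n)\<rfloor>) \<le> tmixQ n n (c / 2)))"
proof (intro conjI)
  have chain: "word_chain k" if "2 \<le> k" for k using that by unfold_locales simp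
  show "\<forall>(n::nat) (k::nat). 1 \<le> n \<longrightarrow> 2 \<le> k \<longrightarrow>
        (\<forall>t\<ge>1. dQ n k t \<le> (1 - 1 / fact n) ^ t \<and> dK n k t \<le> (1 - 1 / fact n) ^ t) \<and>
        (\<forall>\<epsilon>::real. 0 < \<epsilon> \<longrightarrow> \<epsilon> < 1 \<longrightarrow>
           tmixQ n k \<epsilon> \<le> enat (nat \<lceil>fact n * ln (1 / \<epsilon>)\<rceil>) \<and>
           tmixK n k \<epsilon> \<le> enat (nat \<lceil>fact n * ln (1 / \<epsilon>)\<rceil>))"
    using word_chain.dQ_le_fact[OF chain] word_chain.dK_le_fact[OF chain]
      word_chain.tmix_le_fact[OF chain] by blast
  show "\<forall>(n::nat) (k::nat). 1 \<le> n \<longrightarrow> 2 \<le> k \<longrightarrow>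
        (\<forall>t\<ge>1. dQ n k t \<le> real n * (1 - 1 / real k) ^ (t - 1)) \<and>
        (\<forall>\<epsilon>::real. 0 < \<epsilon> \<longrightarrow> \<epsilon> < 1 \<longrightarrow>
           tmixQ n k \<epsilon> \<le> enat (1 + nat \<lceil>real k * ln (real n / \<epsilon>)\<rceil>))"
  proof (intro allI impI conjI)
    fix n k t :: nat assume "2 \<le> k" "1 \<le> t"
    then show "dQ n k t \<le> real n * (1 - 1 / real k) ^ (t - 1)"
      using word_chain.dQ_Suc_le_lip[OF chain, of k n "t - 1"] by simp
  next
    fix n k :: nat and \<epsilon> :: real assume "1 \<le> n" "2 \<le> k" "0 < \<epsilon>"
    then show "tmixQ n k \<epsilon> \<le> enat (1 + nat \<lceil>real k * ln (real n / \<epsilon>)\<rceil>)"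
      using word_chain.tmixQ_le_lip[OF chain] by blast
  qed
  show "\<forall>k::nat. 2 \<le> k \<longrightarrow>
        (\<exists>c::real. 0 < c \<and> c < 1 \<and>
           (\<forall>(n::nat) g. 1 \<le> n \<longrightarrow> is_full_cycle n g \<longrightarrow>
              (\<forall>t\<ge>1. dQ_from n k g t \<le> (1 - c) ^ (t - 1)) \<and>
              (\<forall>\<epsilon>::real. 0 < \<epsilon> \<longrightarrow> \<epsilon> < 1 \<longrightarrow>
                 tmixQ_from n k g \<epsilon> \<le> enat (1 + nat \<lceil>inverse c * ln (1 / \<epsilon>)\<rceil>))))"
  proof (intro allI impI)
    fix k :: nat assume k: "2 \<le> k"
    interpret word_chain n k for n using chain[OF k] .
    \<comment> \<open>The witness \<open>cycle_rate k\<close> is a closed expression in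
      \<open>k\<close>, fixed before \<open>n\<close> and \<open>g\<close> are quantified.\<close>
    have "dQ_from n k g t \<le> (1 - cycle_rate k) ^ (t - 1)" if "1 \<le> n" "is_full_cycle n g" "1 \<le> t" for n g t
      using dQ_from_cycle_le[OF that(1,2), of "t - 1"] that(3) by simp
    then show "\<exists>c::real. 0 < c \<and> c < 1 \<and>
           (\<forall>(n::nat) g. 1 \<le> n \<longrightarrow> is_full_cycle n g \<longrightarrow>
              (\<forall>t\<ge>1. dQ_from n k g t \<le> (1 - c) ^ (t - 1)) \<and>
              (\<forall>\<epsilon>::real. 0 < \<epsilon> \<longrightarrow> \<epsilon> < 1 \<longrightarrow>
                 tmixQ_from n k g \<epsilon> \<le> enat (1 + nat \<lceil>inverse c * ln (1 / \<epsilon>)\<rceil>)))"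
      using cycle_rate_bounds[OF k] tmixQ_from_cycle_le[OF _ k] by blast
  qed
  show "\<exists>c::real. 0 < c \<and>
        (\<forall>n::nat. 2 \<le> n \<longrightarrow>
           (\<forall>a\<in>{1..n}. \<forall>l::nat. int l \<le> \<lfloor>ln (real n)\<rfloor> \<longrightarrow>
              c \<le> dK_from n n (const_word n a) l) \<and>
           (\<forall>l::nat. int l \<le> \<lfloor>ln (real n)\<rfloor> \<longrightarrow> c \<le> dK n n l) \<and>
           (\<forall>t::nat. int t \<le> \<lfloor>ln (real n)\<rfloor> - 1 \<longrightarrow> c \<le> dQ n n t) \<and>
           enat (nat (\<lfloor>ln (real n)\<rfloor> + 1)) \<le> tmixK n n (c / 2) \<and>
           enat (nat \<lfloor>ln (real n)\<rfloor>) \<le> tmixQ n n (c / 2))"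
  proof (intro exI[of _ BE_const] conjI allI impI ballI BE_const_pos)
    fix n :: nat assume "2 \<le> n"
    then interpret square_chain n by unfold_locales
    show "BE_const \<le> dK_from n n (const_word n a) l" if "a \<in> {1..n}" "int l \<le> \<lfloor>ln (real n)\<rfloor>" for a l
      by (rule dK_from_lower[OF that])
    show "BE_const \<le> dK n n l" if "int l \<le> \<lfloor>ln (real n)\<rfloor>" for l by (rule dK_lower[OF that])
    show "BE_const \<le> dQ n n t" if "int t \<le> \<lfloor>ln (real n)\<rfloor> - 1" for t by (rule dQ_lower[OF that])
    show "enat (nat (\<lfloor>ln (real n)\<rfloor> + 1)) \<le> tmixK n n (BE_const / 2)"
      "enat (nat \<lfloor>ln (real n)\<rfloor>) \<le> tmixQ n n (BE_const / 2)"
      by (rule tmix_lower)+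
  qed
qed

end
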